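(* Let $d\ge 2$, $N\ge 1$, $L>1$ be integers, $\beta\in\mathbb{R}$, $G\in\{SO(N),SU(N)\}$, and assume $K_{\mathcal S}>0$, where $$K_{\mathcal S}=\frac{N+2}{4}-1-8N|\beta|(d-1)\ \text{ if } G=SO(N),\qquad K_{\mathcal S}=\frac{N+2}{2}-1-8N|\beta|(d-1)\ \text{ if } G=SU(N).$$ Let $\mathrm{Cov}_{N,\beta,L}$ denote covariance under $\mu_{\Lambda_L,N,\beta}$. For every $e_0\in E^+_{\Lambda_L}$ and every unit vector $E$ in $M_N$, $$\sum_{e\in E^+_{\Lambda_L}}\mathrm{Cov}_{N,\beta,L}\big(\langle Q_{e_0},E\rangle,\langle Q_e,E\rangle\big)\le\begin{cases}1/K_{\mathcal S},&G=SO(N),\\2/K_{\mathcal S},&G=SU(N).\end{cases}$$ In particular, $$\Big|\sum_{e\in E^+_{\Lambda_L}\setminus\{e_0\}}\mathrm{Cov}_{N,\beta,L}\big(\langle Q_{e_0},E\rangle,\langle Q_e,E\rangle\big)\Big|\le\begin{cases}2/K_{\mathcal S},&G=SO(N),\\4/K_{\mathcal S},&G=SU(N).\end{cases}$$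
   Context: $M_N=M_N(\mathbb C)$ is the space of $N\times N$ matrices with inner product $\langle X,Y\rangle=\mathrm{Re}\,\mathrm{Tr}(XY^* )$; unit vector means $\langle E,E\rangle=1$. $\Lambda_L=\mathbb Z^d\cap L\mathbb T^d$ is the discrete $d$-dimensional torus of side length $L$ (periodic boundary conditions); $E^+_{\Lambda_L}$ is its set of positively oriented nearest-neighbour edges (starting point lexicographically smaller than ending point in $\mathbb Z^d$). For a negatively oriented edge $e$, $Q_e=Q_{e^{-1}}^{-1}$ where $e^{-1}$ is $e$ reversed. A plaquette is a closed path $p=e_1e_2e_3e_4$ of oriented edges tracing the boundary of a unit square; $Q_p=Q_{e_1}Q_{e_2}Q_{e_3}Q_{e_4}$; $\mathcal P^+_{\Lambda_L}$ is the set of plaquettes of $\Lambda_L$ for which the starting point of $e_1$ is the lexicographically smallest vertex and the ending point of $e_1$ the second smallest (one representative per unit square). $\mu_{\Lambda_L,N,\beta}$ is the probability measure on $G^{E^+_{\Lambda_L}}$ with density proportional to $\exp(\mathcal S(Q))$ with respect to the product of Haar measures, where $\mathcal S(Q)=N\beta\,\mathrm{Re}\sum_{p\in\mathcal P^+_{\Lambda_L}}\mathrm{Tr}(Q_p)$. *)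

theory Defs
  imports "HOL-Probability.Probability"
begin

section \<open>Matrices and gauge groups\<close>

definition cadjoint :: "complex^'n^'n \<Rightarrow> complex^'n^'n" where
  "cadjoint A = (\<chi> i j. cnj (A $ j $ i))"

definition hs_inner :: "complex^'n^'n \<Rightarrow> complex^'n^'n \<Rightarrow> real" where
  "hs_inner X Y = Re (trace (X ** cadjoint Y))"

lemma hs_inner_eq_inner: "hs_inner X Y = X \<bullet> Y"
  by (simp add: hs_inner_def cadjoint_def trace_def matrix_matrix_mult_def inner_vec_def
      inner_complex_def)

text \<open>A tag rather than the set itself: for \<open>N = 1\<close> the two groups are equal as sets, but
  their constants are not.\<close>

datatype gauge_type = SO | SU

text \<open>\<open>SO(N)\<close> is viewed inside the complex matrices through the entrywise embedding of the
  reals.\<close>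

fun gauge_group :: "gauge_type \<Rightarrow> (complex^'n^'n) set" where
  "gauge_group SO = map_matrix complex_of_real ` {A. rotation_matrix A}"
| "gauge_group SU = {A. A ** cadjoint A = mat 1 \<and> cadjoint A ** A = mat 1 \<and> det A = 1}"

text \<open>On a compact group there is exactly one left invariant Borel probability measure (and it
  is also right invariant), so for the groups above this predicate singles out the normalised Haar
  measure.\<close>

definition haar_prob :: "(complex^'n^'n) set \<Rightarrow> (complex^'n^'n) measure \<Rightarrow> bool" where
  "haar_prob G \<mu> \<longleftrightarrow>
     prob_space \<mu> \<and> sets \<mu> = sets (restrict_space borel G) \<and>
     (\<forall>A\<in>G. distr \<mu> \<mu> (\<lambda>B. A ** B) = \<mu>)"


section \<open>The lattice and its torus\<close>

text \<open>Points of \<open>\<int>\<^sup>d\<close> are functions that are \<open>undefined\<close> outside \<open>{..<d}\<close>.\<close>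

type_synonym point = "nat \<Rightarrow> int"
type_synonym edge = "point \<times> point"

definition lattice :: "nat \<Rightarrow> point set" where
  "lattice d = ({..<d} \<rightarrow>\<^sub>E UNIV)"

definition box :: "nat \<Rightarrow> nat \<Rightarrow> point set" where
  "box d L = ({..<d} \<rightarrow>\<^sub>E {0..<int L})"

definition lex_less :: "nat \<Rightarrow> point \<Rightarrow> point \<Rightarrow> bool" where
  "lex_less d x y \<longleftrightarrow> (\<exists>k<d. (\<forall>j<k. x j = y j) \<and> x k < y k)"

definition nearest_neighbours :: "nat \<Rightarrow> point \<Rightarrow> point \<Rightarrow> bool" where
  "nearest_neighbours d x y \<longleftrightarrow>
     x \<in> lattice d \<and> y \<in> lattice d \<and> (\<Sum>i<d. \<bar>x i - y i\<bar>) = 1"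

text \<open>An edge of the torus is a class of edges of \<open>\<int>\<^sup>d\<close> modulo common translation of both
  endpoints by \<open>L\<int>\<^sup>d\<close>. It is represented by its unique lift that starts in the box; the end
  point of the lift may lie one step outside. Edges across the boundary thus keep the orientation
  that they have in \<open>\<int>\<^sup>d\<close>, and each vertex starts exactly \<open>d\<close> positively oriented edges, also
  when \<open>L = 2\<close>.\<close>

definition pos_edges :: "nat \<Rightarrow> nat \<Rightarrow> edge set" where
  "pos_edges d L = {(x, y). x \<in> box d L \<and> nearest_neighbours d x y \<and> lex_less d x y}"

definition edge_rep :: "nat \<Rightarrow> nat \<Rightarrow> edge \<Rightarrow> edge" where
  "edge_rep d L = (\<lambda>(x, y).
     (\<lambda>i\<in>{..<d}. x i - int L * (x i div int L), \<lambda>i\<in>{..<d}. y i - int L * (x i div int L)))"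

text \<open>Plaquettes are given by their successive vertices, again lifted to \<open>\<int>\<^sup>d\<close> with the first
  vertex in the box. Four distinct vertices on a closed nearest-neighbour path of length four are
  the corners of a unit square.\<close>

definition pos_plaquettes :: "nat \<Rightarrow> nat \<Rightarrow> (point \<times> point \<times> point \<times> point) set" where
  "pos_plaquettes d L = {(v1, v2, v3, v4).
     v1 \<in> box d L \<and> distinct [v1, v2, v3, v4] \<and>
     nearest_neighbours d v1 v2 \<and> nearest_neighbours d v2 v3 \<and>
     nearest_neighbours d v3 v4 \<and> nearest_neighbours d v4 v1 \<and>
     (\<forall>v\<in>{v2, v3, v4}. lex_less d v1 v) \<and> (\<forall>v\<in>{v3, v4}. lex_less d v2 v)}"


section \<open>The lattice Yang-Mills measure\<close>

text \<open>The value of a configuration on an arbitrary oriented edge of \<open>\<int>\<^sup>d\<close>, by periodicity and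
  by inversion on negatively oriented edges.\<close>

definition edge_var :: "nat \<Rightarrow> nat \<Rightarrow> (edge \<Rightarrow> complex^'n^'n) \<Rightarrow> edge \<Rightarrow> complex^'n^'n" where
  "edge_var d L Q = (\<lambda>(x, y).
     if lex_less d x y then Q (edge_rep d L (x, y)) else matrix_inv (Q (edge_rep d L (y, x))))"

definition plaquette_var ::
    "nat \<Rightarrow> nat \<Rightarrow> (edge \<Rightarrow> complex^'n^'n) \<Rightarrow> point \<times> point \<times> point \<times> point \<Rightarrow> complex^'n^'n" where
  "plaquette_var d L Q = (\<lambda>(v1, v2, v3, v4).
     edge_var d L Q (v1, v2) ** edge_var d L Q (v2, v3) **
     edge_var d L Q (v3, v4) ** edge_var d L Q (v4, v1))"

definition ym_action :: "nat \<Rightarrow> nat \<Rightarrow> real \<Rightarrow> (edge \<Rightarrow> complex^'n^'n) \<Rightarrow> real" where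
  "ym_action d L \<beta> Q =
     real CARD('n) * \<beta> * Re (\<Sum>p\<in>pos_plaquettes d L. trace (plaquette_var d L Q p))"

definition ym_measure ::
    "nat \<Rightarrow> nat \<Rightarrow> real \<Rightarrow> (complex^'n^'n) measure \<Rightarrow> (edge \<Rightarrow> complex^'n^'n) measure" where
  "ym_measure d L \<beta> haar =
     (let P = (\<Pi>\<^sub>M e\<in>pos_edges d L. haar);
          Z = (\<integral>Q. exp (ym_action d L \<beta> Q) \<partial>P)
      in density P (\<lambda>Q. ennreal (exp (ym_action d L \<beta> Q) / Z)))"

definition covariance :: "'a measure \<Rightarrow> ('a \<Rightarrow> real) \<Rightarrow> ('a \<Rightarrow> real) \<Rightarrow> real" where
  "covariance M X Y =
     (\<integral>\<omega>. (X \<omega> - (\<integral>\<omega>'. X \<omega>' \<partial>M)) * (Y \<omega> - (\<integral>\<omega>'. Y \<omega>' \<partial>M)) \<partial>M)"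

fun K_S :: "gauge_type \<Rightarrow> nat \<Rightarrow> nat \<Rightarrow> real \<Rightarrow> real" where
  "K_S SO N d \<beta> = (real N + 2) / 4 - 1 - 8 * real N * \<bar>\<beta>\<bar> * (real d - 1)"
| "K_S SU N d \<beta> = (real N + 2) / 2 - 1 - 8 * real N * \<bar>\<beta>\<bar> * (real d - 1)"


section \<open>Explicit description of edges and plaquettes\<close>

lemma nearest_neighbours_lex_iff:
  "nearest_neighbours d x y \<and> lex_less d x y \<longleftrightarrow>
     x \<in> lattice d \<and> (\<exists>k<d. y = x(k := x k + 1))"
proof
  assume a: "nearest_neighbours d x y \<and> lex_less d x y"
  then obtain k where k: "k < d" "x k < y k" unfolding lex_less_def by blast
  have ext: "x \<in> lattice d" "y \<in> lattice d" and s: "(\<Sum>i<d. \<bar>x i - y i\<bar>) = 1"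
    using a unfolding nearest_neighbours_def by auto
  have split: "(\<Sum>i<d. \<bar>x i - y i\<bar>) = \<bar>x k - y k\<bar> + (\<Sum>i\<in>{..<d} - {k}. \<bar>x i - y i\<bar>)"
    using k by (subst sum.remove[of _ k]) auto
  have nn: "(\<Sum>i\<in>{..<d} - {k}. \<bar>x i - y i\<bar>) \<ge> 0" by (rule sum_nonneg) auto
  have yk: "y k = x k + 1" and z: "(\<Sum>i\<in>{..<d} - {k}. \<bar>x i - y i\<bar>) = 0"
    using split s nn k by linarith+
  have "\<forall>i\<in>{..<d} - {k}. \<bar>x i - y i\<bar> = 0"
    using z by (subst (asm) sum_nonneg_eq_0_iff) auto
  then have "y i = x i" if "i \<noteq> k" for i
    using ext that by (cases "i < d") (auto simp: lattice_def PiE_def extensional_def)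
  then have "y = x(k := x k + 1)"
    using yk by (auto simp: fun_eq_iff)
  with k ext show "x \<in> lattice d \<and> (\<exists>k<d. y = x(k := x k + 1))" by auto
next
  assume "x \<in> lattice d \<and> (\<exists>k<d. y = x(k := x k + 1))"
  then obtain k where k: "k < d" "y = x(k := x k + 1)" and x: "x \<in> lattice d" by auto
  have "(\<Sum>i<d. \<bar>x i - y i\<bar>) = (\<Sum>i<d. if i = k then 1 else 0)"
    by (rule sum.cong) (auto simp: k)
  also have "\<dots> = 1" using k by simp
  finally show "nearest_neighbours d x y \<and> lex_less d x y"
    using k x by (auto simp: nearest_neighbours_def lex_less_def lattice_def PiE_def extensional_def)
qed

lemma pos_edges_eq: "pos_edges d L = (\<lambda>(x, k). (x, x(k := x k + 1))) ` (box d L \<times> {..<d})"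
proof -
  have "box d L \<subseteq> lattice d" by (auto simp: box_def lattice_def)
  then show ?thesis
    unfolding pos_edges_def by (auto simp: nearest_neighbours_lex_iff image_iff)
qed

lemma finite_pos_edges: "finite (pos_edges d L)"
  unfolding pos_edges_eq box_def by (intro finite_imageI finite_cartesian_product finite_PiE) auto

lemma card_pos_edges: "card (pos_edges d L) = d * L ^ d"
proof -
  have "inj_on (\<lambda>(x, k). (x, x(k := x k + 1))) (box d L \<times> {..<d})"
    by (auto simp: inj_on_def fun_eq_iff split: if_splits)
  then have "card (pos_edges d L) = card (box d L \<times> {..<d})"
    unfolding pos_edges_eq by (rule card_image)
  then show ?thesis by (simp add: box_def card_cartesian_product card_PiE)
qed

lemma lex_less_linear:
  assumes "x \<in> lattice d" "y \<in> lattice d" "x \<noteq> y"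
  shows "lex_less d x y \<or> lex_less d y x"
proof -
  have ex: "\<exists>k. k < d \<and> x k \<noteq> y k"
    using assms unfolding lattice_def by (metis PiE_ext lessThan_iff)
  define k where "k = (LEAST k. k < d \<and> x k \<noteq> y k)"
  have k: "k < d" "x k \<noteq> y k" using LeastI_ex[OF ex] unfolding k_def by auto
  have "\<forall>j<k. x j = y j" using not_less_Least[of _ "\<lambda>k. k < d \<and> x k \<noteq> y k"] k
    unfolding k_def by (metis dual_order.strict_trans)
  then show ?thesis using k unfolding lex_less_def by (metis linorder_neqE)
qed

lemma nearest_neighbours_sym: "nearest_neighbours d x y \<longleftrightarrow> nearest_neighbours d y x"
  by (auto simp: nearest_neighbours_def abs_minus_commute)

lemma pos_plaquettes_eq:
  "pos_plaquettes d L = {(x, x(j := x j + 1), x(i := x i + 1, j := x j + 1), x(i := x i + 1))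
     | x i j. x \<in> box d L \<and> i < j \<and> j < d}" (is "_ = ?R")
proof (intro set_eqI iffI)
  fix p assume "p \<in> pos_plaquettes d L"
  then obtain v1 v2 v3 v4 where p: "p = (v1, v2, v3, v4)" and b: "v1 \<in> box d L"
    and di: "distinct [v1, v2, v3, v4]"
    and nn: "nearest_neighbours d v1 v2" "nearest_neighbours d v2 v3"
      "nearest_neighbours d v3 v4" "nearest_neighbours d v1 v4"
    and lx: "lex_less d v1 v2" "lex_less d v1 v4" "lex_less d v2 v3" "lex_less d v2 v4"
    unfolding pos_plaquettes_def by (auto simp: nearest_neighbours_sym)
  obtain j where j: "j < d" "v2 = v1(j := v1 j + 1)"
    using nn(1) lx(1) nearest_neighbours_lex_iff by metis
  obtain i where i: "i < d" "v4 = v1(i := v1 i + 1)"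
    using nn(4) lx(2) nearest_neighbours_lex_iff by metis
  obtain m where m: "m < d" "v3 = v2(m := v2 m + 1)"
    using nn(2) lx(3) nearest_neighbours_lex_iff by metis
  have ij: "i < j"
    using lx(4) i j by (auto simp: lex_less_def split: if_splits) (metis linorder_neqE_nat)
  have "v3 \<in> lattice d" "v4 \<in> lattice d" using nn(3) by (auto simp: nearest_neighbours_def)
  then have "lex_less d v3 v4 \<or> lex_less d v4 v3" using di by (intro lex_less_linear) auto
  then have "v3 = v1(i := v1 i + 1, j := v1 j + 1)"
  proof
    assume "lex_less d v3 v4"
    then obtain n where n: "v4 = v3(n := v3 n + 1)"
      using nn(3) nearest_neighbours_lex_iff by metis
    have "v4 j \<ge> v1 j + 1" unfolding n m j by auto
    then show ?thesis using i ij by auto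
  next
    assume "lex_less d v4 v3"
    then obtain n where n: "v3 = v4(n := v4 n + 1)"
      using nn(3) nearest_neighbours_lex_iff nearest_neighbours_sym by metis
    have "v3 j \<ge> v1 j + 1" unfolding m j by auto
    then have "n = j" using n i ij by (auto split: if_splits)
    then show ?thesis using n i ij by auto
  qed
  then show "p \<in> ?R" using p b i j ij by auto
next
  fix p assume "p \<in> ?R"
  then obtain x i j where p: "p = (x, x(j := x j + 1), x(i := x i + 1, j := x j + 1), x(i := x i + 1))"
    and b: "x \<in> box d L" and ij: "i < j" "j < d" by auto
  have step: "nearest_neighbours d y (y(k := y k + 1)) \<and> lex_less d y (y(k := y k + 1))"
    if "y \<in> lattice d" "k < d" for y k
    using that by (subst nearest_neighbours_lex_iff) auto
  have x: "x \<in> lattice d" using b by (auto simp: box_def lattice_def)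
  have up: "x(j := x j + 1) \<in> lattice d" "x(i := x i + 1) \<in> lattice d"
    using x ij by (auto simp: lattice_def PiE_def extensional_def)
  have "x(i := x i + 1, j := x j + 1) = x(j := x j + 1, i := x i + 1)"
    using ij by (auto simp: fun_eq_iff)
  then have s: "nearest_neighbours d (x(j := x j + 1)) (x(i := x i + 1, j := x j + 1))"
       "lex_less d (x(j := x j + 1)) (x(i := x i + 1, j := x j + 1))"
       "nearest_neighbours d (x(i := x i + 1)) (x(i := x i + 1, j := x j + 1))"
    using step[OF up(1), of i] step[OF up(2), of j] ij by auto
  have l: "lex_less d (x(j := x j + 1)) (x(i := x i + 1))"
    "lex_less d x (x(i := x i + 1, j := x j + 1))"
    using ij unfolding lex_less_def by (auto intro!: exI[of _ i])
  have "distinct [x, x(j := x j + 1), x(i := x i + 1, j := x j + 1), x(i := x i + 1)]"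
    using ij by (auto simp: fun_eq_iff)
  then show "p \<in> pos_plaquettes d L"
    unfolding p pos_plaquettes_def
    using b ij s l step[OF x, of i] step[OF x, of j] by (auto simp: nearest_neighbours_sym)
qed

end

(* The proof is an integrated Bakry-Emery argument that uses only polynomials in the matrix
   entries, neither semigroups nor manifolds. Let X_i be the vector fields generated by left
   multiplication with an orthonormal basis of the Lie algebra on each edge, and let
   L_t = sum_i X_i^2 + t sum_i (X_i S) X_i, which is symmetric for the weight exp (t S).
   Because sum_i X_i^2 commutes with each X_j,
     int (L_t f)^2 >= (Ric - h) int |grad f|^2,
   where the antisymmetric part of X_i X_j f contributes the Ricci curvature Ric and h bounds
   the Hessian of S. This a priori estimate is uniform in t, so density of the range of L_t
   among functions modulo constants propagates from t = 0 to t = 1 by a Neumann iteration; at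
   t = 0 it is linear algebra, since each polynomial lies in a finite-dimensional invariant space,
   together with the generation of the group by plane rotations, which makes functions with
   vanishing gradient constant.
   Duality gives the Poincare inequality with constant 1 / (Ric - h). It is applied to the sum of
   <Q_e, E> over all edges: by the symmetries of the torus, which act transitively on edges,
   every row sum of the covariance matrix is the variance of that sum divided by the number of
   edges. *)
theory Submission
  imports Defs
begin


section \<open>A spectral gap for algebras of derivations\<close>

text \<open>Away from \<open>t = 0\<close> the drift in \<open>L t\<close> can raise the degree of a
  polynomial, so no finite-dimensional space is invariant and the range is out of reach of linear
  algebra. Hence \<open>bochner\<close> does two jobs: it makes the continuation in \<open>t\<close>
  possible, and it then enters the duality. The curvature constants come from Ric(v, v) = 1/4 sum
  |[v, b]|^2 over an orthonormal basis of the Lie algebra: (N-2)/4 for \<open>SO\<close> and N/2 for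
  \<open>SU\<close>, which are (N+2)/4 - 1 and (N+2)/2 - 1. The Hessian constant 8 N |beta| (d-1) is
  the coupling N |beta|, times 4 from (x+y+z+w)^2 <= 4 (x^2+y^2+z^2+w^2), times the 2(d-1)
  plaquettes at an edge. The gradient of <Q_e, E> is a projection of the unit vector E Q_e^{-1}, and
  gradients at different edges are orthogonal, so the sum over all edges has squared gradient at
  most the number of edges. Row sum and diagonal variance then both lie in [0, 1/K_S], and so does
  the modulus of their difference, for either group; the stated constants leave room.\<close>

text \<open>The weights \<open>exp (t S)\<close>, \<open>0 \<le> t \<le> 1\<close>, deform \<open>\<nu>\<close> into the Gibbs measure. The constant
  \<open>\<kappa>\<close> is a lower bound for the Ricci curvature and \<open>h\<close> an upper bound for the Hessian of \<open>S\<close>. The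
  assumption \<open>finite_span\<close> replaces the compactness of the resolvent, and \<open>kernel\<close> expresses
  connectedness.\<close>

locale derivation_algebra = prob_space \<nu>
  for \<nu> :: "'q measure" +
  fixes A :: "('q \<Rightarrow> real) set" and I :: "'i set"
    and X :: "'i \<Rightarrow> ('q \<Rightarrow> real) \<Rightarrow> 'q \<Rightarrow> real"
    and c :: "'i \<Rightarrow> 'i \<Rightarrow> 'i \<Rightarrow> real" and S :: "'q \<Rightarrow> real" and \<kappa> h :: real
  assumes finite_I [simp, intro]: "finite I"
    and const [simp, intro]: "(\<lambda>_. r) \<in> A"
    and add [simp, intro]: "f \<in> A \<Longrightarrow> g \<in> A \<Longrightarrow> (\<lambda>q. f q + g q) \<in> A"
    and mult [simp, intro]: "f \<in> A \<Longrightarrow> g \<in> A \<Longrightarrow> (\<lambda>q. f q * g q) \<in> A"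
    and X_closed [simp, intro]: "i \<in> I \<Longrightarrow> f \<in> A \<Longrightarrow> X i f \<in> A"
    and X_const [simp]: "i \<in> I \<Longrightarrow> X i (\<lambda>_. r) = (\<lambda>_. 0)"
    and X_add: "i \<in> I \<Longrightarrow> f \<in> A \<Longrightarrow> g \<in> A \<Longrightarrow> X i (\<lambda>q. f q + g q) = (\<lambda>q. X i f q + X i g q)"
    and X_mult: "i \<in> I \<Longrightarrow> f \<in> A \<Longrightarrow> g \<in> A \<Longrightarrow>
      X i (\<lambda>q. f q * g q) = (\<lambda>q. X i f q * g q + f q * X i g q)"
    and commutator: "i \<in> I \<Longrightarrow> j \<in> I \<Longrightarrow> f \<in> A \<Longrightarrow>
      X i (X j f) q - X j (X i f) q = (\<Sum>k\<in>I. c i j k * X k f q)"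
    and c_swap12: "i \<in> I \<Longrightarrow> j \<in> I \<Longrightarrow> k \<in> I \<Longrightarrow> c i j k = - c j i k"
    and c_swap23: "i \<in> I \<Longrightarrow> j \<in> I \<Longrightarrow> k \<in> I \<Longrightarrow> c i j k = - c i k j"
    and measurable_A [measurable, intro]: "f \<in> A \<Longrightarrow> f \<in> borel_measurable \<nu>"
    and bounded_A: "f \<in> A \<Longrightarrow> \<exists>C. \<forall>q\<in>space \<nu>. \<bar>f q\<bar> \<le> C"
    and S_in [simp, intro]: "S \<in> A"
    and ibp: "i \<in> I \<Longrightarrow> f \<in> A \<Longrightarrow>
      (\<integral>q. (X i f q + t * (f q * X i S q)) * exp (t * S q) \<partial>\<nu>) = 0"
    and hess: "q \<in> space \<nu> \<Longrightarrow>
      (\<Sum>j\<in>I. \<Sum>i\<in>I. a j * a i * X j (X i S) q) \<le> h * (\<Sum>i\<in>I. (a i)\<^sup>2)"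
    and curvature: "\<kappa> * (\<Sum>k\<in>I. (a k)\<^sup>2) \<le> (1/4) * (\<Sum>j\<in>I. \<Sum>i\<in>I. (\<Sum>k\<in>I. c i j k * a k)\<^sup>2)"
    and h_nonneg: "h \<ge> 0" and gap: "h < \<kappa>"
    and finite_span: "f \<in> A \<Longrightarrow> \<exists>n a. (\<exists>k\<le>n::nat. a k \<noteq> (0::real)) \<and>
      (\<forall>q. (\<Sum>k\<le>n. a k * ((\<lambda>f q. \<Sum>i\<in>I. X i (X i f) q) ^^ k) f q) = 0)"
    and kernel: "f \<in> A \<Longrightarrow> (\<integral>q. (\<Sum>i\<in>I. (X i f q)\<^sup>2) \<partial>\<nu>) = 0 \<Longrightarrow> \<exists>r. \<forall>q\<in>space \<nu>. f q = r"
begin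

lemma cmult [simp, intro]: "f \<in> A \<Longrightarrow> (\<lambda>q. r * f q) \<in> A"
  by (rule mult) auto

lemma diff [simp, intro]: "f \<in> A \<Longrightarrow> g \<in> A \<Longrightarrow> (\<lambda>q. f q - g q) \<in> A"
  using add[of f "\<lambda>q. -1 * g q"] cmult[of g "-1"] by simp

lemma power2_in [simp, intro]: "f \<in> A \<Longrightarrow> (\<lambda>q. (f q)\<^sup>2) \<in> A"
  unfolding power2_eq_square by auto

lemma sum_in [simp, intro]: "(\<And>j. j \<in> J \<Longrightarrow> f j \<in> A) \<Longrightarrow> (\<lambda>q. \<Sum>j\<in>J. f j q) \<in> A"
  by (induction J rule: infinite_finite_induct) auto

lemma X_cmult: "i \<in> I \<Longrightarrow> f \<in> A \<Longrightarrow> X i (\<lambda>q. r * f q) = (\<lambda>q. r * X i f q)"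
  using X_mult[of i "\<lambda>_. r" f] by simp

lemma X_sum: "i \<in> I \<Longrightarrow> (\<And>j. j \<in> J \<Longrightarrow> f j \<in> A) \<Longrightarrow> X i (\<lambda>q. \<Sum>j\<in>J. f j q) = (\<lambda>q. \<Sum>j\<in>J. X i (f j) q)"
  by (induction J rule: infinite_finite_induct) (auto simp: X_add)

lemma X_diff: "i \<in> I \<Longrightarrow> f \<in> A \<Longrightarrow> g \<in> A \<Longrightarrow> X i (\<lambda>q. f q - g q) = (\<lambda>q. X i f q - X i g q)"
  using X_add[of i f "\<lambda>q. -1 * g q"] X_cmult[of i g "-1"] cmult[of g "-1"] by simp

section \<open>Integration against the weights \<open>exp (t * S)\<close>\<close>

definition J :: "real \<Rightarrow> ('q \<Rightarrow> real) \<Rightarrow> real" where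
  "J t f = (\<integral>q. f q * exp (t * S q) \<partial>\<nu>)"

lemma integrable_weighted [simp, intro]: 
  assumes "f \<in> A"
  shows "integrable \<nu> (\<lambda>q. f q * exp (t * S q))"
proof -
  obtain C where C: "\<And>q. q \<in> space \<nu> \<Longrightarrow> \<bar>f q\<bar> \<le> C" using bounded_A assms by blast
  obtain s where s: "\<And>q. q \<in> space \<nu> \<Longrightarrow> \<bar>t * S q\<bar> \<le> s" using bounded_A[of "\<lambda>q. t * S q"] by auto
  show ?thesis
  proof (rule integrable_const_bound)
    show "AE q in \<nu>. norm (f q * exp (t * S q)) \<le> C * exp s"
    proof (rule AE_I2)
      fix q assume q: "q \<in> space \<nu>"
      show "norm (f q * exp (t * S q)) \<le> C * exp s"
        unfolding norm_mult using C[OF q] s[OF q] by (intro mult_mono) auto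
    qed
    show "(\<lambda>q. f q * exp (t * S q)) \<in> borel_measurable \<nu>"
      using assms S_in by (auto intro!: borel_measurable_times borel_measurable_exp measurable_compose[OF _ borel_measurable_exp])
  qed
qed

lemma J_add: "f \<in> A \<Longrightarrow> g \<in> A \<Longrightarrow> J t (\<lambda>q. f q + g q) = J t f + J t g"
  unfolding J_def by (simp add: distrib_right)

lemma J_diff: "f \<in> A \<Longrightarrow> g \<in> A \<Longrightarrow> J t (\<lambda>q. f q - g q) = J t f - J t g"
  unfolding J_def by (simp add: left_diff_distrib)

lemma J_cmult: "J t (\<lambda>q. r * f q) = r * J t f"
  unfolding J_def by (simp add: mult.assoc)

lemma J_zero [simp]: "J t (\<lambda>q. 0) = 0"
  unfolding J_def by simp

lemma J_sum: "(\<And>j. j \<in> K \<Longrightarrow> f j \<in> A) \<Longrightarrow> J t (\<lambda>q. \<Sum>j\<in>K. f j q) = (\<Sum>j\<in>K. J t (f j))"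
  by (induction K rule: infinite_finite_induct) (auto simp: J_add)

lemma J_mono: "f \<in> A \<Longrightarrow> g \<in> A \<Longrightarrow> (\<And>q. q \<in> space \<nu> \<Longrightarrow> f q \<le> g q) \<Longrightarrow> J t f \<le> J t g"
  unfolding J_def by (intro integral_mono) auto

lemma J_nonneg: "(\<And>q. q \<in> space \<nu> \<Longrightarrow> f q \<ge> 0) \<Longrightarrow> J t f \<ge> 0"
  unfolding J_def by (intro integral_nonneg_AE AE_I2) auto

lemma J_cong: "(\<And>q. q \<in> space \<nu> \<Longrightarrow> f q = g q) \<Longrightarrow> J t f = J t g"
  unfolding J_def by (intro Bochner_Integration.integral_cong) auto

text \<open>A function of zero norm vanishes almost everywhere, and so does its product with
  anything; this replaces Cauchy-Schwarz where only the null case matters.\<close>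

lemma J_square_zero:
  assumes "f \<in> A" "g \<in> A" "J t (\<lambda>q. (f q)\<^sup>2) = 0"
  shows "J t (\<lambda>q. g q * f q) = 0"
proof -
  have "AE q in \<nu>. (f q)\<^sup>2 * exp (t * S q) = 0"
    using assms integrable_weighted[of "\<lambda>q. (f q)\<^sup>2" t] unfolding J_def
    by (subst (asm) integral_nonneg_eq_0_iff_AE) auto
  then have "AE q in \<nu>. g q * f q * exp (t * S q) = 0" by eventually_elim auto
  then show ?thesis unfolding J_def by (simp add: integral_eq_zero_AE)
qed

section \<open>Gradient, Laplacian and weighted generator\<close>

definition grad :: "('q \<Rightarrow> real) \<Rightarrow> ('q \<Rightarrow> real) \<Rightarrow> 'q \<Rightarrow> real" where
  "grad f g = (\<lambda>q. \<Sum>i\<in>I. X i f q * X i g q)"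

definition \<Delta> :: "('q \<Rightarrow> real) \<Rightarrow> 'q \<Rightarrow> real" where
  "\<Delta> f = (\<lambda>q. \<Sum>i\<in>I. X i (X i f) q)"

definition L :: "real \<Rightarrow> ('q \<Rightarrow> real) \<Rightarrow> 'q \<Rightarrow> real" where
  "L t f = (\<lambda>q. \<Delta> f q + t * grad S f q)"

lemma grad_in [simp, intro]: "f \<in> A \<Longrightarrow> g \<in> A \<Longrightarrow> grad f g \<in> A"
  unfolding grad_def by auto

lemma \<Delta>_in [simp, intro]: "f \<in> A \<Longrightarrow> \<Delta> f \<in> A"
  unfolding \<Delta>_def by auto

lemma L_in [simp, intro]: "f \<in> A \<Longrightarrow> L t f \<in> A"
  unfolding L_def by auto

lemma \<Delta>_pow_in [simp, intro]: "f \<in> A \<Longrightarrow> (\<Delta> ^^ k) f \<in> A"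
  by (induction k) auto

lemma grad_add: "f \<in> A \<Longrightarrow> g \<in> A \<Longrightarrow> u \<in> A \<Longrightarrow> grad u (\<lambda>q. f q + g q) = (\<lambda>q. grad u f q + grad u g q)"
  unfolding grad_def by (simp add: X_add distrib_left sum.distrib)

lemma grad_cmult: "f \<in> A \<Longrightarrow> u \<in> A \<Longrightarrow> grad u (\<lambda>q. r * f q) = (\<lambda>q. r * grad u f q)"
  unfolding grad_def by (simp add: X_cmult sum_distrib_left mult.left_commute)

lemma \<Delta>_add: "f \<in> A \<Longrightarrow> g \<in> A \<Longrightarrow> \<Delta> (\<lambda>q. f q + g q) = (\<lambda>q. \<Delta> f q + \<Delta> g q)"
  unfolding \<Delta>_def by (simp add: X_add sum.distrib)

lemma \<Delta>_cmult: "f \<in> A \<Longrightarrow> \<Delta> (\<lambda>q. r * f q) = (\<lambda>q. r * \<Delta> f q)"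
  unfolding \<Delta>_def by (simp add: X_cmult sum_distrib_left)

lemma \<Delta>_zero [simp]: "\<Delta> (\<lambda>q. 0) = (\<lambda>q. 0)"
  unfolding \<Delta>_def by simp

lemma \<Delta>_sum: "(\<And>j. j \<in> K \<Longrightarrow> f j \<in> A) \<Longrightarrow> \<Delta> (\<lambda>q. \<Sum>j\<in>K. f j q) = (\<lambda>q. \<Sum>j\<in>K. \<Delta> (f j) q)"
  by (induction K rule: infinite_finite_induct) (auto simp: \<Delta>_add)

lemma L_add: "f \<in> A \<Longrightarrow> g \<in> A \<Longrightarrow> L t (\<lambda>q. f q + g q) = (\<lambda>q. L t f q + L t g q)"
  unfolding L_def by (simp add: \<Delta>_add grad_add algebra_simps)

text \<open>Integration by parts is applied to \<open>g * X i f\<close> for each \<open>i\<close>;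
  the derivative of the weight supplies exactly the drift in \<open>L t\<close>. This is the
  symmetry of \<open>L t\<close>.\<close>

lemma green:
  assumes "f \<in> A" "g \<in> A"
  shows "J t (\<lambda>q. g q * L t f q) = - J t (grad g f)"
proof -
  let ?F = "\<lambda>i q. X i (\<lambda>q. g q * X i f q) q + t * ((g q * X i f q) * X i S q)"
  have "J t (\<lambda>q. g q * L t f q) + J t (grad g f) = J t (\<lambda>q. g q * L t f q + grad g f q)"
    using assms by (subst J_add) auto
  also have "\<dots> = J t (\<lambda>q. \<Sum>i\<in>I. ?F i q)"
    using assms unfolding L_def \<Delta>_def grad_def
    by (intro J_cong) (simp add: X_mult sum.distrib sum_distrib_left algebra_simps)
  also have "\<dots> = (\<Sum>i\<in>I. J t (?F i))"
    using assms by (intro J_sum) (intro add cmult mult X_closed; simp)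
  also have "\<dots> = 0"
    unfolding J_def using assms by (intro sum.neutral ballI ibp) auto
  finally show ?thesis by simp
qed

lemma c_swap13: "i \<in> I \<Longrightarrow> j \<in> I \<Longrightarrow> k \<in> I \<Longrightarrow> c k j i = - c i j k"
  using c_swap12[of k j i] c_swap23[of j k i] c_swap12[of j i k] by simp

text \<open>Moving \<open>X j\<close> past each square leaves structure constants
  \<open>c i j k\<close>, antisymmetric in \<open>i\<close> and \<open>k\<close>, contracted with
  the symmetric X_i X_k + X_k X_i.\<close>

lemma casimir:
  assumes "f \<in> A" "j \<in> I"
  shows "\<Delta> (X j f) q = X j (\<Delta> f) q"
proof -
  have 1: "X i (X i (X j f)) q - X j (X i (X i f)) q =
      (\<Sum>k\<in>I. c i j k * (X i (X k f) q + X k (X i f) q))" if i: "i \<in> I" for i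
  proof -
    have eq: "X i (X j f) = (\<lambda>q. X j (X i f) q + (\<Sum>k\<in>I. c i j k * X k f q))"
    proof
      fix q show "X i (X j f) q = X j (X i f) q + (\<Sum>k\<in>I. c i j k * X k f q)"
        using commutator[OF i assms(2,1), of q] by simp
    qed
    have "X i (X i (X j f)) q = X i (X j (X i f)) q + (\<Sum>k\<in>I. c i j k * X i (X k f) q)"
      unfolding eq using assms i by (simp add: X_add X_sum X_cmult)
    moreover have "X i (X j (X i f)) q = X j (X i (X i f)) q + (\<Sum>k\<in>I. c i j k * X k (X i f) q)"
      using commutator[OF i assms(2), of "X i f" q] assms i by simp
    ultimately show ?thesis by (simp add: distrib_left sum.distrib)
  qed
  let ?T = "\<Sum>i\<in>I. \<Sum>k\<in>I. c i j k * (X i (X k f) q + X k (X i f) q)"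
  have "\<Delta> (X j f) q - X j (\<Delta> f) q = ?T"
    unfolding \<Delta>_def using assms by (simp add: X_sum 1 flip: sum_subtractf)
  moreover have "?T = (\<Sum>k\<in>I. \<Sum>i\<in>I. c i j k * (X i (X k f) q + X k (X i f) q))"
    by (rule sum.swap)
  moreover have "\<dots> = - ?T"
    unfolding sum_negf[symmetric]
  proof (intro sum.cong refl)
    fix x y assume "x \<in> I" "y \<in> I"
    then show "c y j x * (X y (X x f) q + X x (X y f) q) = - (c x j y * (X x (X y f) q + X y (X x f) q))"
      using c_swap13[of x j y] assms by (simp add: add.commute)
  qed
  ultimately show ?thesis by linarith
qed

text \<open>Besides the Hessian of \<open>S\<close>, differentiating the drift leaves commutators of
  \<open>X j\<close> with \<open>X i\<close>; their contraction with the gradient of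
  \<open>f\<close> vanishes by \<open>bracket_term_zero\<close>.\<close>

lemma X_L:
  assumes "f \<in> A" "j \<in> I"
  shows "X j (L t f) q = L t (X j f) q + t * (\<Sum>i\<in>I. X j (X i S) q * X i f q)
    + t * (\<Sum>i\<in>I. X i S q * (X j (X i f) q - X i (X j f) q))"
proof -
  have "X j (L t f) q = X j (\<Delta> f) q + t * X j (grad S f) q"
    unfolding L_def using assms by (simp add: X_add X_cmult)
  also have "X j (grad S f) q = (\<Sum>i\<in>I. X j (X i S) q * X i f q + X i S q * X j (X i f) q)"
    unfolding grad_def using assms by (simp add: X_sum X_mult)
  finally show ?thesis
    unfolding L_def casimir[OF assms, symmetric] grad_def
    by (simp add: sum.distrib algebra_simps sum_subtractf)
qed

text \<open>Once the commutator is expanded, the structure constants are antisymmetric in the two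
  indices that carry the symmetric product \<open>X j f q * X k f q\<close>.\<close>

lemma bracket_term_zero:
  assumes "f \<in> A"
  shows "(\<Sum>j\<in>I. X j f q * (\<Sum>i\<in>I. X i S q * (X j (X i f) q - X i (X j f) q))) = 0"
proof -
  let ?g = "\<lambda>j i k. X i S q * c j i k * X j f q * X k f q"
  have "(\<Sum>j\<in>I. X j f q * (\<Sum>i\<in>I. X i S q * (X j (X i f) q - X i (X j f) q)))
      = (\<Sum>j\<in>I. \<Sum>i\<in>I. \<Sum>k\<in>I. ?g j i k)"
    using assms by (simp add: commutator sum_distrib_left mult_ac)
  also have "\<dots> = (\<Sum>i\<in>I. \<Sum>j\<in>I. \<Sum>k\<in>I. ?g j i k)" by (rule sum.swap)
  also have "\<dots> = 0"
  proof (rule sum.neutral, intro ballI)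
    fix i assume i: "i \<in> I"
    have "(\<Sum>j\<in>I. \<Sum>k\<in>I. ?g j i k) = (\<Sum>k\<in>I. \<Sum>j\<in>I. ?g j i k)" by (rule sum.swap)
    also have "\<dots> = - (\<Sum>j\<in>I. \<Sum>k\<in>I. ?g j i k)"
      unfolding sum_negf[symmetric]
      by (intro sum.cong refl) (subst c_swap13, auto simp: i)
    finally show "(\<Sum>j\<in>I. \<Sum>k\<in>I. ?g j i k) = 0" by simp
  qed
  finally show ?thesis .
qed

text \<open>The matrix of second derivatives is at least as large as its antisymmetric part, which
  is half the commutator; squaring this half gives the factor 1/4 in
  \<open>curvature\<close>.\<close>

lemma hessian_bound:
  assumes "f \<in> A"
  shows "\<kappa> * grad f f q \<le> (\<Sum>j\<in>I. grad (X j f) (X j f) q)"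
proof -
  have "\<kappa> * grad f f q \<le> (1/4) * (\<Sum>j\<in>I. \<Sum>i\<in>I. (\<Sum>k\<in>I. c i j k * X k f q)\<^sup>2)"
    using curvature[of "\<lambda>k. X k f q"] by (simp add: grad_def power2_eq_square)
  also have "\<dots> = (1/4) * (\<Sum>j\<in>I. \<Sum>i\<in>I. (X i (X j f) q - X j (X i f) q)\<^sup>2)"
    using assms by (simp add: commutator)
  also have "\<dots> \<le> (1/4) * (\<Sum>j\<in>I. \<Sum>i\<in>I. 2 * (X i (X j f) q)\<^sup>2 + 2 * (X j (X i f) q)\<^sup>2)"
  proof (intro mult_left_mono sum_mono)
    fix i j show "(X i (X j f) q - X j (X i f) q)\<^sup>2 \<le> 2 * (X i (X j f) q)\<^sup>2 + 2 * (X j (X i f) q)\<^sup>2"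
      using zero_le_power2[of "X i (X j f) q + X j (X i f) q"] by (simp add: power2_sum power2_diff)
  qed simp
  also have "\<dots> = (1/4) * (2 * (\<Sum>j\<in>I. \<Sum>i\<in>I. (X i (X j f) q)\<^sup>2) + 2 * (\<Sum>i\<in>I. \<Sum>j\<in>I. (X j (X i f) q)\<^sup>2))"
    unfolding sum.distrib sum_distrib_left[symmetric]
    by (subst (3) sum.swap) (rule refl)
  also have "\<dots> = (\<Sum>j\<in>I. grad (X j f) (X j f) q)"
    by (simp add: grad_def power2_eq_square)
  finally show ?thesis .
qed

text \<open>\<open>green\<close> is used twice: to turn the square of \<open>L t f\<close> into a
  pairing of gradients and, after \<open>X j\<close> has been moved past \<open>L t\<close>, to
  produce second derivatives. As \<open>h\<close> is nonnegative and \<open>t\<close> at most 1, t h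
  is replaced by h and the constant is uniform in \<open>t\<close>.\<close>

lemma bochner:
  assumes f: "f \<in> A" and t: "0 \<le> t" "t \<le> 1"
  shows "(\<kappa> - h) * J t (grad f f) \<le> J t (\<lambda>q. (L t f q)\<^sup>2)"
proof -
  let ?H = "\<lambda>q. \<Sum>j\<in>I. \<Sum>i\<in>I. X j f q * X i f q * X j (X i S) q"
  have H_in: "?H \<in> A" using f by auto
  have "J t (\<lambda>q. (L t f q)\<^sup>2) = - J t (grad (L t f) f)"
    using green[OF f L_in[OF f], of t] by (simp add: power2_eq_square)
  also have "J t (grad (L t f) f) = J t (\<lambda>q. (\<Sum>j\<in>I. X j f q * L t (X j f) q) + t * ?H q)"
  proof (rule J_cong)
    fix q
    have "grad (L t f) f q = (\<Sum>j\<in>I. X j f q * L t (X j f) q) + t * ?H q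
       + t * (\<Sum>j\<in>I. X j f q * (\<Sum>i\<in>I. X i S q * (X j (X i f) q - X i (X j f) q)))"
      unfolding grad_def using f
      by (simp add: X_L sum.distrib sum_distrib_left algebra_simps)
    then show "grad (L t f) f q = (\<Sum>j\<in>I. X j f q * L t (X j f) q) + t * ?H q"
      by (simp add: bracket_term_zero[OF f])
  qed
  also have "\<dots> = (\<Sum>j\<in>I. J t (\<lambda>q. X j f q * L t (X j f) q)) + J t (\<lambda>q. t * ?H q)"
    using f H_in by (subst J_add) (auto simp: J_sum)
  also have "(\<Sum>j\<in>I. J t (\<lambda>q. X j f q * L t (X j f) q)) = - J t (\<lambda>q. \<Sum>j\<in>I. grad (X j f) (X j f) q)"
    using f by (simp add: green J_sum sum_negf)
  finally have eq: "J t (\<lambda>q. (L t f q)\<^sup>2) = J t (\<lambda>q. \<Sum>j\<in>I. grad (X j f) (X j f) q) - J t (\<lambda>q. t * ?H q)"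
    by simp
  have "J t (\<lambda>q. \<kappa> * grad f f q) \<le> J t (\<lambda>q. \<Sum>j\<in>I. grad (X j f) (X j f) q)"
    using f by (intro J_mono hessian_bound) auto
  moreover have "J t (\<lambda>q. t * ?H q) \<le> J t (\<lambda>q. h * grad f f q)"
  proof (rule J_mono)
    fix q assume "q \<in> space \<nu>"
    then have H: "?H q \<le> h * grad f f q"
      using hess[of q "\<lambda>i. X i f q"] by (simp add: grad_def power2_eq_square)
    have "0 \<le> h * grad f f q"
      unfolding grad_def using h_nonneg by (simp add: sum_nonneg)
    then have "t * (h * grad f f q) \<le> 1 * (h * grad f f q)"
      using t by (intro mult_right_mono) auto
    then show "t * ?H q \<le> h * grad f f q"
      using mult_left_mono[OF H t(1)] by simp
  qed (use f H_in in auto)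
  ultimately show ?thesis by (simp add: eq J_cmult left_diff_distrib)
qed

section \<open>Orthogonality to constants and comparison of norms\<close>

lemma uminus [simp, intro]: "f \<in> A \<Longrightarrow> (\<lambda>q. - f q) \<in> A"
  using cmult[of f "-1"] by simp

lemma divide [simp, intro]: "f \<in> A \<Longrightarrow> (\<lambda>q. f q / r) \<in> A"
  using cmult[of f "1 / r"] by simp

lemma L_cmult: "f \<in> A \<Longrightarrow> L t (\<lambda>q. r * f q) = (\<lambda>q. r * L t f q)"
  unfolding L_def by (simp add: \<Delta>_cmult grad_cmult algebra_simps)

lemma L_zero [simp]: "L t (\<lambda>q. 0) = (\<lambda>q. 0)"
  using L_cmult[of "\<lambda>q. 0" t 0] by simp

lemma J_L: "f \<in> A \<Longrightarrow> J t (L t f) = 0"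
  using green[of f "\<lambda>_. 1" t] by (simp add: grad_def)

lemma J_const_L: "f \<in> A \<Longrightarrow> J t (\<lambda>q. r * L t f q) = 0"
  by (simp add: J_cmult J_L)

text \<open>Constants are orthogonal to the range of \<open>L t\<close>, so adding one can only
  increase the norm.\<close>

lemma J_shift_L:
  assumes "f \<in> A"
  shows "J t (\<lambda>q. (L t f q)\<^sup>2) \<le> J t (\<lambda>q. (r + L t f q)\<^sup>2)"
proof -
  have "J t (\<lambda>q. (r + L t f q)\<^sup>2) = J t (\<lambda>q. r\<^sup>2 + ((2 * r) * L t f q + (L t f q)\<^sup>2))"
    by (intro J_cong) (simp add: power2_sum)
  also have "\<dots> = J t (\<lambda>q. r\<^sup>2) + J t (\<lambda>q. (L t f q)\<^sup>2)"
    using assms by (subst J_add, auto)+ (simp add: J_const_L)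
  finally show ?thesis using J_nonneg[of "\<lambda>q. r\<^sup>2" t] by simp
qed

lemma J_square_add:
  assumes "f \<in> A" "g \<in> A"
  shows "J t (\<lambda>q. (f q + g q)\<^sup>2) \<le> 2 * J t (\<lambda>q. (f q)\<^sup>2) + 2 * J t (\<lambda>q. (g q)\<^sup>2)"
proof -
  have "J t (\<lambda>q. (f q + g q)\<^sup>2) \<le> J t (\<lambda>q. 2 * (f q)\<^sup>2 + 2 * (g q)\<^sup>2)"
  proof (rule J_mono)
    fix q show "(f q + g q)\<^sup>2 \<le> 2 * (f q)\<^sup>2 + 2 * (g q)\<^sup>2"
      using zero_le_power2[of "f q - g q"] by (simp add: power2_sum power2_diff)
  qed (use assms in auto)
  then show ?thesis using assms by (simp add: J_add J_cmult)
qed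

lemma J_square_diff:
  assumes "f \<in> A" "g \<in> A"
  shows "J t (\<lambda>q. (f q - g q)\<^sup>2) \<le> 2 * J t (\<lambda>q. (f q)\<^sup>2) + 2 * J t (\<lambda>q. (g q)\<^sup>2)"
  using J_square_add[of f "\<lambda>q. -1 * g q" t] assms cmult[of g "-1"] by simp

text \<open>For parameters in [0, 1] two weights differ at most by the factor exp (sup |S|). This
  carries an error measured at \<open>t\<close> over to the norm at
  \<open>t + \<delta>\<close>.\<close>

lemma weight_compare: "\<exists>M>0. \<forall>t u f. 0 \<le> t \<longrightarrow> t \<le> 1 \<longrightarrow> 0 \<le> u \<longrightarrow> u \<le> 1 \<longrightarrow> f \<in> A \<longrightarrow>
    J t (\<lambda>q. (f q)\<^sup>2) \<le> M * J u (\<lambda>q. (f q)\<^sup>2)"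
proof -
  obtain s where s: "\<And>q. q \<in> space \<nu> \<Longrightarrow> \<bar>S q\<bar> \<le> s" using bounded_A[OF S_in] by auto
  have "J t (\<lambda>q. (f q)\<^sup>2) \<le> exp s * J u (\<lambda>q. (f q)\<^sup>2)"
    if "0 \<le> t" "t \<le> 1" "0 \<le> u" "u \<le> 1" "f \<in> A" for t u f
  proof -
    have "J t (\<lambda>q. (f q)\<^sup>2) \<le> (\<integral>q. exp s * ((f q)\<^sup>2 * exp (u * S q)) \<partial>\<nu>)"
      unfolding J_def
    proof (rule integral_mono)
      fix q assume q: "q \<in> space \<nu>"
      have "(t - u) * S q \<le> \<bar>t - u\<bar> * \<bar>S q\<bar>" by (metis abs_ge_self abs_mult)
      also have "\<dots> \<le> 1 * s" using that s[OF q] by (intro mult_mono) auto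
      finally have "t * S q \<le> s + u * S q" by (simp add: left_diff_distrib)
      then have "exp (t * S q) \<le> exp s * exp (u * S q)" by (simp flip: exp_add)
      then show "(f q)\<^sup>2 * exp (t * S q) \<le> exp s * ((f q)\<^sup>2 * exp (u * S q))"
        using mult_left_mono[of "exp (t * S q)" "exp s * exp (u * S q)" "(f q)\<^sup>2"] by (simp add: mult.left_commute)
    qed (use that in auto)
    then show ?thesis unfolding J_def by simp
  qed
  then show ?thesis by (intro exI[of _ "exp s"]) auto
qed

text \<open>Density of constants plus the range of \<open>L t\<close> in the weighted norm. Both
  \<open>f\<close> and \<open>\<phi>\<close> stay in \<open>A\<close>, so neither a closure of the
  operator nor regularity of solutions enters.\<close>

definition solvable :: "real \<Rightarrow> bool" where
  "solvable t \<longleftrightarrow> (\<forall>f\<in>A. \<forall>\<epsilon>>0. \<exists>\<phi>\<in>A. \<exists>r. J t (\<lambda>q. (f q - r - L t \<phi> q)\<^sup>2) \<le> \<epsilon>)"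

text \<open>At \<open>t = 0\<close> a polynomial relation between the \<open>\<Delta>\<^sup>k f\<close> splits off the kernel of a power
  of \<open>\<Delta>\<close>, which by symmetry consists of constants.\<close>

lemma \<Delta>_pow_kernel:
  assumes "g \<in> A" "J 0 (\<lambda>q. ((\<Delta> ^^ Suc m) g q)\<^sup>2) = 0"
  shows "J 0 (\<lambda>q. (\<Delta> g q)\<^sup>2) = 0"
  using assms(2)
proof (induction m)
  case (Suc m)
  let ?u = "(\<Delta> ^^ m) g"
  have L0: "L 0 f = \<Delta> f" for f by (simp add: L_def)
  have sym: "J 0 (\<lambda>q. \<Delta> ?u q * \<Delta> ?u q) = J 0 (\<lambda>q. ?u q * \<Delta> (\<Delta> ?u) q)"
    using green[of ?u "\<Delta> ?u" 0] green[of "\<Delta> ?u" ?u 0] assms(1)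
    by (simp add: L0 grad_def mult.commute)
  have "J 0 (\<lambda>q. ?u q * \<Delta> (\<Delta> ?u) q) = 0"
    using Suc.prems assms(1) by (intro J_square_zero) auto
  then show ?case using Suc.IH sym by (simp add: power2_eq_square)
qed simp

lemma solvable_0: "solvable 0"
  unfolding solvable_def
proof (intro ballI allI impI)
  fix f :: "'q \<Rightarrow> real" and \<epsilon> :: real assume f: "f \<in> A" and \<epsilon>: "0 < \<epsilon>"
  have L0: "L 0 f = \<Delta> f" for f by (simp add: L_def)
  obtain n a where nz: "\<exists>k\<le>n. a k \<noteq> (0::real)"
    and rel: "\<And>q. (\<Sum>k\<le>n. a k * (\<Delta> ^^ k) f q) = 0"
    using finite_span[OF f] unfolding \<Delta>_def by blast
  \<comment> \<open>The lowest nonzero coefficient sits at \<open>m\<close>. The relation reads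
    \<open>(\<Delta> ^^ m) g = 0\<close>, where g is \<open>a m\<close> times \<open>f\<close> plus
    a value of \<open>\<Delta>\<close>; once \<open>g\<close> is constant, dividing by
    \<open>a m\<close> solves the equation for \<open>f\<close> exactly.\<close>
  define m where "m = (LEAST k. a k \<noteq> 0)"
  have m: "a m \<noteq> 0" "\<And>k. k < m \<Longrightarrow> a k = 0" "m \<le> n"
    using nz LeastI_ex[of "\<lambda>k. a k \<noteq> 0"] not_less_Least[of _ "\<lambda>k. a k \<noteq> 0"] Least_le[of "\<lambda>k. a k \<noteq> 0"]
    unfolding m_def by (blast, blast, metis order.trans)
  define g where "g = (\<lambda>q. \<Sum>k\<in>{m..n}. a k * (\<Delta> ^^ (k - m)) f q)"
  define b where "b k = - a k / a m" for k
  define \<phi> where "\<phi> = (\<lambda>q. \<Sum>k\<in>{Suc m..n}. b k * (\<Delta> ^^ (k - Suc m)) f q)"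
  have in_A: "g \<in> A" "\<phi> \<in> A" unfolding g_def \<phi>_def using f by auto
  have pow: "(\<Delta> ^^ l) g = (\<lambda>q. \<Sum>k\<in>{m..n}. a k * (\<Delta> ^^ (l + (k - m))) f q)" for l
    by (induction l) (use f in \<open>auto simp: g_def \<Delta>_sum \<Delta>_cmult\<close>)
  have "(\<Delta> ^^ m) g q = (\<Sum>k\<le>n. a k * (\<Delta> ^^ k) f q)" for q
    unfolding pow using m by (intro sum.mono_neutral_cong_left) auto
  then have top: "(\<Delta> ^^ m) g = (\<lambda>q. 0)" using rel by auto
  \<comment> \<open>For \<open>m = 0\<close> the relation itself says g = 0. Otherwise
    \<open>\<Delta> g\<close> has zero norm, hence so has the gradient of \<open>g\<close>, and
    \<open>kernel\<close> applies.\<close>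
  have "\<exists>r. \<forall>q\<in>space \<nu>. g q = r"
  proof (cases m)
    case 0 then show ?thesis using top by auto
  next
    case (Suc l)
    then have "J 0 (\<lambda>q. (\<Delta> g q)\<^sup>2) = 0" using top in_A by (intro \<Delta>_pow_kernel[of g l]) auto
    then have "J 0 (grad g g) = 0"
      using green[of g g 0] J_square_zero[of "\<Delta> g" g 0] in_A by (simp add: L0)
    then show ?thesis
      using in_A by (intro kernel) (auto simp: J_def grad_def power2_eq_square)
  qed
  then obtain r where r: "\<And>q. q \<in> space \<nu> \<Longrightarrow> g q = r" by auto
  have "f q - r / a m - L 0 \<phi> q = 0" if q: "q \<in> space \<nu>" for q
  proof -
    have "{m..n} = insert m {Suc m..n}" using m by auto
    then have "g q = a m * f q + (\<Sum>k\<in>{Suc m..n}. a k * (\<Delta> ^^ (k - m)) f q)"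
      unfolding g_def by simp
    moreover have "\<Delta> \<phi> q = (\<Sum>k\<in>{Suc m..n}. b k * (\<Delta> ^^ (k - m)) f q)"
    proof -
      have "\<Delta> ((\<Delta> ^^ (k - Suc m)) f) = (\<Delta> ^^ (k - m)) f" if "Suc m \<le> k" for k
      proof -
        have "k - m = Suc (k - Suc m)" using that by simp
        then show ?thesis by simp
      qed
      then show ?thesis unfolding \<phi>_def using f by (simp add: \<Delta>_sum \<Delta>_cmult)
    qed
    moreover have "a m * (\<Sum>k\<in>{Suc m..n}. b k * (\<Delta> ^^ (k - m)) f q)
        = - (\<Sum>k\<in>{Suc m..n}. a k * (\<Delta> ^^ (k - m)) f q)"
      using m(1) by (simp add: b_def sum_distrib_left flip: sum_negf)
    ultimately have "a m * (f q - r / a m - L 0 \<phi> q) = 0"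
      using r[OF q] m(1) by (simp add: L0 right_diff_distrib)
    then show ?thesis using m(1) by simp
  qed
  then have "J 0 (\<lambda>q. (f q - r / a m - L 0 \<phi> q)\<^sup>2) = J 0 (\<lambda>q. 0)"
    by (intro J_cong) simp
  then show "\<exists>\<phi>\<in>A. \<exists>r. J 0 (\<lambda>q. (f q - r - L 0 \<phi> q)\<^sup>2) \<le> \<epsilon>"
    using in_A \<epsilon> by (intro bexI[of _ \<phi>] exI[of _ "r / a m"]) auto
qed

text \<open>\<open>L (t + \<delta>)\<close> and \<open>L t\<close> differ by \<open>\<delta>\<close>
  times this drift. Pointwise Cauchy-Schwarz bounds it by the gradient and \<open>bochner\<close>
  bounds the gradient by \<open>L t f\<close>, uniformly in \<open>t\<close>, so the continuation
  can use steps of one fixed size.\<close>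

lemma perturbation_bound: "\<exists>b>0. \<forall>t f. 0 \<le> t \<longrightarrow> t \<le> 1 \<longrightarrow> f \<in> A \<longrightarrow>
    J t (\<lambda>q. (grad S f q)\<^sup>2) \<le> b * J t (\<lambda>q. (L t f q)\<^sup>2)"
proof -
  have "(\<lambda>q. grad S S q) \<in> A" by auto
  then obtain s where s: "\<And>q. q \<in> space \<nu> \<Longrightarrow> \<bar>grad S S q\<bar> \<le> s" using bounded_A by blast
  let ?s = "\<bar>s\<bar> + 1"
  have "J t (\<lambda>q. (grad S f q)\<^sup>2) \<le> (?s / (\<kappa> - h)) * J t (\<lambda>q. (L t f q)\<^sup>2)"
    if t: "0 \<le> t" "t \<le> 1" and f: "f \<in> A" for t f
  proof -
    have "J t (\<lambda>q. (grad S f q)\<^sup>2) \<le> J t (\<lambda>q. ?s * grad f f q)"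
    proof (rule J_mono)
      fix q assume q: "q \<in> space \<nu>"
      have "(grad S f q)\<^sup>2 \<le> grad S S q * grad f f q"
        using Cauchy_Schwarz_ineq_sum[of "\<lambda>i. X i S q" "\<lambda>i. X i f q" I]
        by (simp add: grad_def power2_eq_square)
      also have "\<dots> \<le> ?s * grad f f q"
        using s[OF q] by (intro mult_right_mono) (auto simp: grad_def intro!: sum_nonneg)
      finally show "(grad S f q)\<^sup>2 \<le> ?s * grad f f q" .
    qed (use f in auto)
    also have "\<dots> = (?s / (\<kappa> - h)) * ((\<kappa> - h) * J t (grad f f))"
      using gap by (simp add: J_cmult)
    also have "\<dots> \<le> (?s / (\<kappa> - h)) * J t (\<lambda>q. (L t f q)\<^sup>2)"
      using gap by (intro mult_left_mono bochner f t) auto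
    finally show ?thesis .
  qed
  then show ?thesis using gap by (intro exI[of _ "?s / (\<kappa> - h)"]) auto
qed

text \<open>An approximate solution at \<open>t\<close> is reused at \<open>t + \<delta>\<close>. In
  squared norms, an error of 1/16 leaves the range part at most 2 + 2/16 = 17/8, and the new
  remainder is at most 2/16 + 2/16 * 17/8 = 25/64, below one half.\<close>

lemma solvable_halving:
  assumes t: "0 \<le> t" "t \<le> 1" and sol: "solvable t" and f: "f \<in> A"
    and b: "\<And>f. f \<in> A \<Longrightarrow> J t (\<lambda>q. (grad S f q)\<^sup>2) \<le> b * J t (\<lambda>q. (L t f q)\<^sup>2)"
    and \<delta>: "\<delta>\<^sup>2 * b \<le> 1 / 16"
  shows "\<exists>\<phi>\<in>A. \<exists>r. J t (\<lambda>q. (f q - r - L (t + \<delta>) \<phi> q)\<^sup>2) \<le> (1/2) * J t (\<lambda>q. (f q)\<^sup>2)"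
proof (cases "J t (\<lambda>q. (f q)\<^sup>2) = 0")
  case True
  then show ?thesis by (intro bexI[of _ "\<lambda>q. 0"] exI[of _ 0]) auto
next
  case False
  let ?N = "\<lambda>f. J t (\<lambda>q. (f q)\<^sup>2)"
  have pos: "?N f > 0" using False J_nonneg[of "\<lambda>q. (f q)\<^sup>2" t] by simp
  then obtain \<phi> r where \<phi>: "\<phi> \<in> A" and e: "?N (\<lambda>q. f q - r - L t \<phi> q) \<le> ?N f / 16"
    using sol f unfolding solvable_def by (meson divide_pos_pos zero_less_numeral)
  let ?e = "\<lambda>q. f q - r - L t \<phi> q"
  have e_in: "?e \<in> A" using f \<phi> by auto
  have "?N (L t \<phi>) \<le> ?N (\<lambda>q. r + L t \<phi> q)" by (rule J_shift_L[OF \<phi>])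
  also have "\<dots> = ?N (\<lambda>q. f q - ?e q)" by (simp add: algebra_simps)
  also have "\<dots> \<le> 2 * ?N f + 2 * ?N ?e" by (rule J_square_diff[OF f e_in])
  finally have L: "?N (L t \<phi>) \<le> (17/8) * ?N f" using e by simp
  have "?N (\<lambda>q. \<delta> * grad S \<phi> q) = \<delta>\<^sup>2 * ?N (grad S \<phi>)"
    by (simp add: power_mult_distrib J_cmult)
  also have "\<dots> \<le> \<delta>\<^sup>2 * (b * ?N (L t \<phi>))" using b[OF \<phi>] by (intro mult_left_mono) auto
  also have "\<dots> = (\<delta>\<^sup>2 * b) * ?N (L t \<phi>)" by simp
  also have "\<dots> \<le> (1/16) * ?N (L t \<phi>)" using \<delta> by (intro mult_right_mono J_nonneg) auto
  finally have B: "?N (\<lambda>q. \<delta> * grad S \<phi> q) \<le> (1/16) * ((17/8) * ?N f)" using L by simp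
  have "?N (\<lambda>q. f q - r - L (t + \<delta>) \<phi> q) = ?N (\<lambda>q. ?e q - \<delta> * grad S \<phi> q)"
    by (simp add: L_def algebra_simps)
  also have "\<dots> \<le> 2 * ?N ?e + 2 * ?N (\<lambda>q. \<delta> * grad S \<phi> q)"
    using e_in \<phi> by (intro J_square_diff) auto
  finally show ?thesis using e B \<phi> pos by (intro bexI[of _ \<phi>] exI[of _ r]) auto
qed

text \<open>The halving is applied to each remainder in turn, always in the norm at
  \<open>t\<close>, where solvability is known; only the final error is moved to the norm at
  \<open>t + \<delta>\<close>.\<close>

lemma solvable_step:
  assumes t: "0 \<le> t" "t \<le> 1" "0 \<le> t + \<delta>" "t + \<delta> \<le> 1" and sol: "solvable t"
    and b: "\<And>f. f \<in> A \<Longrightarrow> J t (\<lambda>q. (grad S f q)\<^sup>2) \<le> b * J t (\<lambda>q. (L t f q)\<^sup>2)"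
    and \<delta>: "\<delta>\<^sup>2 * b \<le> 1 / 16"
  shows "solvable (t + \<delta>)"
  unfolding solvable_def
proof (intro ballI allI impI)
  fix f :: "'q \<Rightarrow> real" and \<epsilon> :: real assume f: "f \<in> A" and \<epsilon>: "0 < \<epsilon>"
  let ?N = "\<lambda>f. J t (\<lambda>q. (f q)\<^sup>2)"
  have iter: "\<exists>\<phi>\<in>A. \<exists>r. ?N (\<lambda>q. f q - r - L (t + \<delta>) \<phi> q) \<le> (1/2) ^ n * ?N f" for n
  proof (induction n)
    case 0 show ?case by (intro bexI[of _ "\<lambda>q. 0"] exI[of _ 0]) auto
  next
    case (Suc n)
    then obtain \<phi> r where \<phi>: "\<phi> \<in> A" "?N (\<lambda>q. f q - r - L (t + \<delta>) \<phi> q) \<le> (1/2) ^ n * ?N f" by auto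
    have in_A: "(\<lambda>q. f q - r - L (t + \<delta>) \<phi> q) \<in> A" using f \<phi> by auto
    obtain \<psi> s where \<psi>: "\<psi> \<in> A" "?N (\<lambda>q. (f q - r - L (t + \<delta>) \<phi> q) - s - L (t + \<delta>) \<psi> q)
        \<le> (1/2) * ?N (\<lambda>q. f q - r - L (t + \<delta>) \<phi> q)"
      using solvable_halving[OF t(1,2) sol in_A b \<delta>] by blast
    have "?N (\<lambda>q. f q - (r + s) - L (t + \<delta>) (\<lambda>q. \<phi> q + \<psi> q) q)
        = ?N (\<lambda>q. (f q - r - L (t + \<delta>) \<phi> q) - s - L (t + \<delta>) \<psi> q)"
      using \<phi> \<psi> by (simp add: L_add algebra_simps)
    also have "\<dots> \<le> (1/2) ^ Suc n * ?N f" using \<phi>(2) \<psi>(2) by simp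
    finally show ?case using \<phi> \<psi> by (intro bexI[of _ "\<lambda>q. \<phi> q + \<psi> q"] exI[of _ "r + s"]) auto
  qed
  obtain M where M: "M > 0" "\<And>f. f \<in> A \<Longrightarrow> J (t + \<delta>) (\<lambda>q. (f q)\<^sup>2) \<le> M * ?N f"
    using weight_compare t by blast
  have "(\<lambda>n. (1/2) ^ n * (M * ?N f)) \<longlonglongrightarrow> 0 * (M * ?N f)"
    by (intro tendsto_mult LIMSEQ_power_zero tendsto_const) simp
  then have "eventually (\<lambda>n. (1/2) ^ n * (M * ?N f) < \<epsilon>) sequentially"
    using \<epsilon> by (auto dest: order_tendstoD)
  then obtain n where n: "(1/2) ^ n * (M * ?N f) < \<epsilon>" by (meson eventually_happens' sequentially_bot)
  obtain \<phi> r where \<phi>: "\<phi> \<in> A" "?N (\<lambda>q. f q - r - L (t + \<delta>) \<phi> q) \<le> (1/2) ^ n * ?N f"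
    using iter by blast
  have "J (t + \<delta>) (\<lambda>q. (f q - r - L (t + \<delta>) \<phi> q)\<^sup>2) \<le> M * ?N (\<lambda>q. f q - r - L (t + \<delta>) \<phi> q)"
    using f \<phi> by (intro M(2)) auto
  also have "\<dots> \<le> M * ((1/2) ^ n * ?N f)" using \<phi>(2) M(1) by (intro mult_left_mono) auto
  also have "\<dots> \<le> \<epsilon>" using n by (simp add: mult.left_commute)
  finally show "\<exists>\<phi>\<in>A. \<exists>r. J (t + \<delta>) (\<lambda>q. (f q - r - L (t + \<delta>) \<phi> q)\<^sup>2) \<le> \<epsilon>"
    using \<phi>(1) by blast
qed

lemma solvable_1: "solvable 1"
proof -
  obtain b where b: "b > 0" "\<And>t f. 0 \<le> t \<Longrightarrow> t \<le> 1 \<Longrightarrow> f \<in> A \<Longrightarrow>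
      J t (\<lambda>q. (grad S f q)\<^sup>2) \<le> b * J t (\<lambda>q. (L t f q)\<^sup>2)"
    using perturbation_bound by blast
  \<comment> \<open>With step 1/n and n at least 1, (1/n)^2 is at most 1/n, so n at least 16 b meets
    the step condition; \<open>b\<close> serves all \<open>t\<close>, so n such steps reach
    1.\<close>
  obtain n :: nat where n: "real n \<ge> max 1 (16 * b)" using real_arch_simple by blast
  then have n0: "real n > 0" "n > 0" by auto
  have "(1 / real n)\<^sup>2 * b \<le> (1 / real n) * b"
    using n b(1) by (intro mult_right_mono) (auto simp: power2_eq_square divide_simps)
  also have "\<dots> \<le> 1 / 16" using n n0 by (simp add: divide_simps)
  finally have \<delta>: "(1 / real n)\<^sup>2 * b \<le> 1 / 16" .
  have "k \<le> n \<Longrightarrow> solvable (real k / real n)" for k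
  proof (induction k)
    case (Suc k)
    have "solvable (real k / real n + 1 / real n)"
      using Suc n0 by (intro solvable_step[OF _ _ _ _ _ b(2) \<delta>]) (auto simp: divide_simps)
    then show ?case by (simp add: add_divide_distrib add.commute)
  qed (simp add: solvable_0)
  from this[of n] show ?thesis using n0 by simp
qed

text \<open>Up to a small \<open>e\<close>, the centred function is a constant plus
  \<open>L 1 \<phi>\<close>. Pairing it with this expression turns the variance into a pairing of
  the gradients of \<open>f\<close> and \<open>\<phi>\<close>, and \<open>bochner\<close> absorbs
  the gradient of \<open>\<phi>\<close>.\<close>

theorem poincare:
  assumes f: "f \<in> A"
  defines "m \<equiv> J 1 f / J 1 (\<lambda>_. 1)"
  shows "(\<kappa> - h) * J 1 (\<lambda>q. (f q - m)\<^sup>2) \<le> J 1 (grad f f)"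
proof -
  let ?g = "\<lambda>q. f q - m"
  let ?V = "J 1 (\<lambda>q. (?g q)\<^sup>2)"
  have g_in: "?g \<in> A" using f by auto
  have "J 1 (\<lambda>_. 1) > 0"
  proof -
    have "J 1 (\<lambda>_. 1) \<noteq> 0"
    proof
      assume "J 1 (\<lambda>_. 1) = 0"
      then have "AE q in \<nu>. exp (1 * S q) = 0"
        using integrable_weighted[of "\<lambda>_. 1" 1] unfolding J_def
        by (subst (asm) integral_nonneg_eq_0_iff_AE) auto
      then show False by (simp add: AE_False)
    qed
    then show ?thesis using J_nonneg[of "\<lambda>_. 1" 1] by simp
  qed
  then have mean: "J 1 ?g = 0"
    using f J_cmult[of 1 m "\<lambda>_. 1"] by (simp add: J_diff m_def)
  have grad_g: "grad ?g u = grad f u" "grad u ?g = grad u f" if "u \<in> A" for u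
    using f by (auto simp: grad_def X_diff)
  have K: "\<kappa> - h > 0" using gap by simp
  have "?V \<le> J 1 (grad f f) / (\<kappa> - h) + \<epsilon>" if \<epsilon>: "\<epsilon> > 0" for \<epsilon>
  proof -
    obtain \<phi> r where \<phi>: "\<phi> \<in> A" and e: "J 1 (\<lambda>q. (?g q - r - L 1 \<phi> q)\<^sup>2) \<le> \<epsilon>"
      using solvable_1[unfolded solvable_def, rule_format, OF g_in \<epsilon>] by blast
    define e where "e = (\<lambda>q. ?g q - r - L 1 \<phi> q)"
    have e_in: "e \<in> A" unfolding e_def using f \<phi> by auto
    have "?V = J 1 (\<lambda>q. r * ?g q + (?g q * L 1 \<phi> q + ?g q * e q))"
      unfolding e_def by (intro J_cong) (simp add: algebra_simps power2_eq_square)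
    also have "\<dots> = r * J 1 ?g + (J 1 (\<lambda>q. ?g q * L 1 \<phi> q) + J 1 (\<lambda>q. ?g q * e q))"
      using g_in e_in \<phi> by (simp add: J_add J_cmult)
    finally have V: "?V = J 1 (\<lambda>q. ?g q * L 1 \<phi> q) + J 1 (\<lambda>q. ?g q * e q)" using mean by simp
    have "2 * J 1 (\<lambda>q. ?g q * L 1 \<phi> q) = J 1 (\<lambda>q. - 2 * grad f \<phi> q)"
      using green[OF \<phi> g_in, of 1] J_cmult[of 1 "-2" "grad f \<phi>"] \<phi> by (simp add: grad_g)
    \<comment> \<open>Young's inequality with weight \<open>\<kappa> - h\<close>, chosen so that the
      second term is the left side of \<open>bochner\<close>.\<close>
    also have "\<dots> \<le> J 1 (\<lambda>q. 1 / (\<kappa> - h) * grad f f q + (\<kappa> - h) * grad \<phi> \<phi> q)"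
    proof (rule J_mono)
      fix q
      have "- 2 * (X i f q * X i \<phi> q) \<le> 1 / (\<kappa> - h) * (X i f q * X i f q) + (\<kappa> - h) * (X i \<phi> q * X i \<phi> q)" for i
      proof -
        have "0 \<le> (X i f q + (\<kappa> - h) * X i \<phi> q)\<^sup>2 / (\<kappa> - h)" using K by simp
        also have "\<dots> = 1 / (\<kappa> - h) * (X i f q * X i f q) + (\<kappa> - h) * (X i \<phi> q * X i \<phi> q) + 2 * (X i f q * X i \<phi> q)"
          using K by (simp add: field_simps power2_eq_square)
        finally show ?thesis by simp
      qed
      then show "- 2 * grad f \<phi> q \<le> 1 / (\<kappa> - h) * grad f f q + (\<kappa> - h) * grad \<phi> \<phi> q"
        unfolding grad_def sum_distrib_left sum.distrib[symmetric] by (intro sum_mono)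
    qed (use f \<phi> in auto)
    also have "\<dots> = J 1 (grad f f) / (\<kappa> - h) + (\<kappa> - h) * J 1 (grad \<phi> \<phi>)"
      using f \<phi> J_cmult[of 1 "1 / (\<kappa> - h)" "grad f f"] by (subst J_add) (auto simp: J_cmult)
    also have "(\<kappa> - h) * J 1 (grad \<phi> \<phi>) \<le> J 1 (\<lambda>q. (L 1 \<phi> q)\<^sup>2)"
      by (intro bochner \<phi>) auto
    also have "J 1 (\<lambda>q. (L 1 \<phi> q)\<^sup>2) \<le> J 1 (\<lambda>q. (r + L 1 \<phi> q)\<^sup>2)" by (rule J_shift_L[OF \<phi>])
    also have "\<dots> = J 1 (\<lambda>q. (?g q)\<^sup>2 + (- 2 * (?g q * e q) + (e q)\<^sup>2))"
      unfolding e_def by (intro J_cong) (simp add: algebra_simps power2_eq_square)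
    also have "\<dots> = ?V + (- 2 * J 1 (\<lambda>q. ?g q * e q) + J 1 (\<lambda>q. (e q)\<^sup>2))"
      using g_in e_in J_cmult[of 1 "-2" "\<lambda>q. ?g q * e q"] cmult[of "\<lambda>q. ?g q * e q" "-2"]
      by (simp add: J_add J_diff J_cmult)
    \<comment> \<open>The pairing of the centred function with \<open>e\<close> enters with opposite
      signs and cancels; only the squared norm of \<open>e\<close>, at most
      \<open>\<epsilon>\<close>, remains.\<close>
    finally have "2 * ?V \<le> J 1 (grad f f) / (\<kappa> - h) + ?V + J 1 (\<lambda>q. (e q)\<^sup>2)"
      using V by simp
    then show ?thesis using e unfolding e_def by simp
  qed
  then have "?V \<le> J 1 (grad f f) / (\<kappa> - h)" by (rule field_le_epsilon)
  then show ?thesis using K by (simp add: field_simps)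
qed

end

section \<open>Complex matrices as a Euclidean space\<close>

lemma cadjoint_nth [simp]: "cadjoint A $ i $ j = cnj (A $ j $ i)"
  by (simp add: cadjoint_def)

lemma cadjoint_cadjoint [simp]: "cadjoint (cadjoint A) = A"
  by (simp add: vec_eq_iff)

lemma cadjoint_matrix_mul: "cadjoint (A ** B) = cadjoint B ** cadjoint A"
  by (simp add: vec_eq_iff matrix_matrix_mult_def mult.commute)

lemma cadjoint_mat_1 [simp]: "cadjoint (mat 1) = mat 1"
  by (auto simp: vec_eq_iff mat_def)

lemma cadjoint_add: "cadjoint (A + B) = cadjoint A + cadjoint B"
  by (simp add: vec_eq_iff)

lemma cadjoint_diff: "cadjoint (A - B) = cadjoint A - cadjoint B"
  by (simp add: vec_eq_iff)

lemma cadjoint_minus: "cadjoint (- A) = - cadjoint A"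
  by (simp add: vec_eq_iff)

lemma cadjoint_scaleR: "cadjoint (r *\<^sub>R A) = r *\<^sub>R cadjoint A"
  by (simp add: vec_eq_iff)

lemma cadjoint_zero [simp]: "cadjoint 0 = 0"
  by (simp add: vec_eq_iff)

lemma matrix_mul_scaleR_left: "(r *\<^sub>R A) ** B = r *\<^sub>R (A ** (B :: complex^'n^'n))"
  by (simp add: vec_eq_iff matrix_matrix_mult_def scaleR_sum_right)

lemma matrix_mul_scaleR_right: "(A :: complex^'n^'n) ** (r *\<^sub>R B) = r *\<^sub>R (A ** (B :: complex^'n^'n))"
  by (simp add: vec_eq_iff matrix_matrix_mult_def scaleR_sum_right)

lemma matrix_mul_add_left: "(A + B) ** C = A ** C + B ** (C :: complex^'n^'n)"
  by (simp add: vec_eq_iff matrix_matrix_mult_def distrib_right sum.distrib)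

lemma matrix_mul_diff_left: "(A - B) ** C = A ** C - B ** (C :: complex^'n^'n)"
  by (simp add: vec_eq_iff matrix_matrix_mult_def left_diff_distrib sum_subtractf)

lemma matrix_mul_diff_right: "A ** (B - C) = A ** B - A ** (C :: complex^'n^'n)"
  by (simp add: vec_eq_iff matrix_matrix_mult_def right_diff_distrib sum_subtractf)

lemma matrix_mul_minus_left: "(- A) ** B = - (A ** (B :: complex^'n^'n))"
  by (simp add: vec_eq_iff matrix_matrix_mult_def sum_negf)

lemma matrix_mul_minus_right: "A ** (- B) = - (A ** (B :: complex^'n^'n))"
  by (simp add: vec_eq_iff matrix_matrix_mult_def sum_negf)

lemmas matrix_mul_linear = matrix_add_ldistrib matrix_mul_add_left matrix_mul_diff_left
  matrix_mul_diff_right matrix_mul_minus_left matrix_mul_minus_right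
  matrix_mul_scaleR_left matrix_mul_scaleR_right

lemmas cadjoint_linear = cadjoint_add cadjoint_diff cadjoint_minus cadjoint_scaleR

lemma linear_matrix_mul_left: "linear (\<lambda>A. (A :: complex^'n^'n) ** (B :: complex^'n^'n))"
  by (rule linearI) (simp_all add: matrix_mul_linear)

lemma linear_matrix_mul_right: "linear (\<lambda>B. (A :: complex^'n^'n) ** (B :: complex^'n^'n))"
  by (rule linearI) (simp_all add: matrix_mul_linear)

lemma trace_cadjoint: "trace (cadjoint A) = cnj (trace A)"
  by (simp add: trace_def)

lemma inner_matrix_mul_left: "((A :: complex^'n^'n) ** B) \<bullet> C = (B :: complex^'n^'n) \<bullet> (cadjoint A ** C)"
proof -
  have "(A ** B) \<bullet> C = Re (trace (A ** (B ** cadjoint C)))"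
    by (simp add: hs_inner_def matrix_mul_assoc flip: hs_inner_eq_inner)
  also have "\<dots> = Re (trace ((B ** cadjoint C) ** A))" by (subst trace_mul_sym) (rule refl)
  also have "\<dots> = B \<bullet> (cadjoint A ** C)"
    by (simp add: hs_inner_def cadjoint_matrix_mul matrix_mul_assoc flip: hs_inner_eq_inner)
  finally show ?thesis .
qed

lemma inner_cadjoint: "cadjoint A \<bullet> cadjoint B = A \<bullet> B"
proof -
  have "cadjoint A \<bullet> cadjoint B = Re (trace (cadjoint A ** B))"
    by (simp add: hs_inner_def flip: hs_inner_eq_inner)
  also have "\<dots> = Re (trace (cadjoint (cadjoint A ** B)))" by (simp add: trace_cadjoint)
  also have "\<dots> = Re (trace (A ** cadjoint B))"
    by (simp add: cadjoint_matrix_mul trace_mul_sym[of A])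
  finally show ?thesis by (simp add: hs_inner_def flip: hs_inner_eq_inner)
qed

lemma inner_matrix_mul_right: "((A :: complex^'n^'n) ** (B :: complex^'n^'n)) \<bullet> C = A \<bullet> (C ** cadjoint B)"
  using inner_matrix_mul_left[of "cadjoint B" "cadjoint A" "cadjoint C"] inner_cadjoint[of "A ** B" C]
    inner_cadjoint[of A "C ** cadjoint B"]
  by (simp add: cadjoint_matrix_mul)

lemma norm_cadjoint [simp]: "norm (cadjoint A) = norm A"
  by (simp add: norm_eq_sqrt_inner inner_cadjoint)

lemma norm_unitary_mul:
  assumes "cadjoint U ** U = mat 1"
  shows "norm (U ** A) = norm (A :: complex^'n^'n)"
  by (simp add: norm_eq_sqrt_inner inner_matrix_mul_left matrix_mul_assoc assms)

lemma norm_mul_unitary: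
  assumes "U ** cadjoint U = mat 1"
  shows "norm (A ** U) = norm (A :: complex^'n^'n)"
  by (simp add: norm_eq_sqrt_inner inner_matrix_mul_right assms flip: matrix_mul_assoc)


section \<open>Polynomials in the link variables and their derivatives\<close>

text \<open>Pairing with an arbitrary \<open>Y\<close> yields real and imaginary parts of entries
  alike, and makes the coordinates stable under \<open>D\<close>, which merely changes
  \<open>Y\<close>.\<close>

inductive_set polys :: "'e set \<Rightarrow> (('e \<Rightarrow> complex^'n^'n) \<Rightarrow> real) set" for E :: "'e set" where
  polys_const [simp, intro]: "(\<lambda>_. r) \<in> polys E"
| polys_coord [simp, intro]: "e \<in> E \<Longrightarrow> (\<lambda>Q. Q e \<bullet> Y) \<in> polys E"
| polys_add [simp, intro]: "f \<in> polys E \<Longrightarrow> g \<in> polys E \<Longrightarrow> (\<lambda>Q. f Q + g Q) \<in> polys E"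
| polys_mult [simp, intro]: "f \<in> polys E \<Longrightarrow> g \<in> polys E \<Longrightarrow> (\<lambda>Q. f Q * g Q) \<in> polys E"

text \<open>The straight line in direction \<open>v e ** Q e\<close> leaves the group, but
  polynomials live on all matrices and the line has the same tangent as the orbit of a one-parameter
  subgroup; see \<open>D_curve\<close>.\<close>

definition D :: "('e \<Rightarrow> complex^'n^'n) \<Rightarrow> (('e \<Rightarrow> complex^'n^'n) \<Rightarrow> real) \<Rightarrow> ('e \<Rightarrow> complex^'n^'n) \<Rightarrow> real" where
  "D v f Q = deriv (\<lambda>t. f (\<lambda>e. Q e + t *\<^sub>R (v e ** Q e))) 0"

lemma polys_cmult [simp, intro]: "f \<in> polys E \<Longrightarrow> (\<lambda>Q. r * f Q) \<in> polys E"
  by (rule polys_mult) auto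

lemma polys_uminus [simp, intro]: "f \<in> polys E \<Longrightarrow> (\<lambda>Q. - f Q) \<in> polys E"
  using polys_cmult[of f E "-1"] by simp

lemma polys_diff [simp, intro]: "f \<in> polys E \<Longrightarrow> g \<in> polys E \<Longrightarrow> (\<lambda>Q. f Q - g Q) \<in> polys E"
  using polys_add[of f E "\<lambda>Q. -1 * g Q"] polys_cmult[of g E "-1"] by simp

lemma polys_sum [simp, intro]: "(\<And>j. j \<in> J \<Longrightarrow> f j \<in> polys E) \<Longrightarrow> (\<lambda>Q. \<Sum>j\<in>J. f j Q) \<in> polys E"
  by (induction J rule: infinite_finite_induct) auto

lemma has_derivative_D:
  "f \<in> polys E \<Longrightarrow> ((\<lambda>t. f (\<lambda>e. Q e + t *\<^sub>R (v e ** Q e))) has_real_derivative D v f Q) (at 0)"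
  unfolding D_def DERIV_deriv_iff_real_differentiable
proof (induction rule: polys.induct)
  case (polys_coord e Y)
  have "((\<lambda>t. (Q e + t *\<^sub>R (v e ** Q e)) \<bullet> Y) has_real_derivative (v e ** Q e) \<bullet> Y) (at 0)"
    unfolding inner_add_left inner_scaleR_left by (auto intro!: derivative_eq_intros)
  then show ?case by (auto simp: real_differentiable_def)
qed auto

lemma D_const [simp]: "D v (\<lambda>_. r) = (\<lambda>_. 0)"
  by (simp add: D_def fun_eq_iff)

lemma D_coord [simp]: "D v (\<lambda>Q. Q e \<bullet> Y) = (\<lambda>Q. Q e \<bullet> (cadjoint (v e) ** Y))"
proof
  fix Q :: "'a \<Rightarrow> complex^'b^'b"
  have "((\<lambda>t. (Q e + t *\<^sub>R (v e ** Q e)) \<bullet> Y) has_real_derivative (v e ** Q e) \<bullet> Y) (at 0)"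
    unfolding inner_add_left inner_scaleR_left by (auto intro!: derivative_eq_intros)
  then show "D v (\<lambda>Q. Q e \<bullet> Y) Q = Q e \<bullet> (cadjoint (v e) ** Y)"
    by (simp add: D_def inner_matrix_mul_left DERIV_imp_deriv)
qed

lemma D_add: "f \<in> polys E \<Longrightarrow> g \<in> polys E \<Longrightarrow> D v (\<lambda>Q. f Q + g Q) = (\<lambda>Q. D v f Q + D v g Q)"
  unfolding D_def[of v "\<lambda>Q. f Q + g Q"] fun_eq_iff
  by (intro allI DERIV_imp_deriv DERIV_add has_derivative_D)

lemma D_mult:
  assumes "f \<in> polys E" "g \<in> polys E"
  shows "D v (\<lambda>Q. f Q * g Q) = (\<lambda>Q. D v f Q * g Q + f Q * D v g Q)"
proof
  fix Q
  have "((\<lambda>t. f (\<lambda>e. Q e + t *\<^sub>R (v e ** Q e)) * g (\<lambda>e. Q e + t *\<^sub>R (v e ** Q e)))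
      has_real_derivative D v f Q * g Q + D v g Q * f Q) (at 0)"
    using DERIV_mult[OF has_derivative_D[OF assms(1), of Q v] has_derivative_D[OF assms(2), of Q v]]
    by simp
  then show "D v (\<lambda>Q. f Q * g Q) Q = D v f Q * g Q + f Q * D v g Q"
    unfolding D_def[of v "\<lambda>Q. f Q * g Q"] by (simp add: DERIV_imp_deriv mult.commute)
qed

lemma D_closed [simp, intro]: "f \<in> polys E \<Longrightarrow> D v f \<in> polys E"
  by (induction rule: polys.induct) (auto simp: D_add D_mult)

lemma D_cmult: "f \<in> polys E \<Longrightarrow> D v (\<lambda>Q. r * f Q) = (\<lambda>Q. r * D v f Q)"
  using D_mult[of "\<lambda>_. r" E f v] by simp

lemma D_sum: "(\<And>j. j \<in> J \<Longrightarrow> f j \<in> polys E) \<Longrightarrow> D v (\<lambda>Q. \<Sum>j\<in>J. f j Q) = (\<lambda>Q. \<Sum>j\<in>J. D v (f j) Q)"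
  by (induction J rule: infinite_finite_induct) (auto simp: D_add[where E = E])

lemma D_cong: "f \<in> polys E \<Longrightarrow> (\<And>e. e \<in> E \<Longrightarrow> v e = w e) \<Longrightarrow> D v f = D w f"
  by (induction rule: polys.induct) (auto simp: D_add D_mult)

lemma D_vadd: "f \<in> polys E \<Longrightarrow> D (\<lambda>e. v e + w e) f Q = D v f Q + D w f Q"
  by (induction rule: polys.induct)
    (auto simp: D_add D_mult cadjoint_linear matrix_mul_linear inner_add_right algebra_simps)

lemma D_vscaleR: "f \<in> polys E \<Longrightarrow> D (\<lambda>e. r *\<^sub>R v e) f Q = r * D v f Q"
  by (induction rule: polys.induct)
    (auto simp: D_add D_mult cadjoint_linear matrix_mul_linear algebra_simps)

lemma D_vzero [simp]: "f \<in> polys E \<Longrightarrow> D (\<lambda>e. 0) f Q = 0"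
  using D_vscaleR[of f E 0 "\<lambda>e. 0" Q] by simp

lemma D_vsum: "f \<in> polys E \<Longrightarrow> D (\<lambda>e. \<Sum>j\<in>J. v j e) f Q = (\<Sum>j\<in>J. D (v j) f Q)"
  by (induction J rule: infinite_finite_induct) (auto simp: D_vadd)

text \<open>Left multiplications generate right-invariant fields, whose bracket has the opposite
  order to the matrix commutator.\<close>

lemma D_commutator:
  "f \<in> polys E \<Longrightarrow> D v (D w f) Q - D w (D v f) Q = D (\<lambda>e. w e ** v e - v e ** w e) f Q"
proof (induction rule: polys.induct)
  case (polys_coord e Y)
  then show ?case
    by (simp add: cadjoint_linear cadjoint_matrix_mul matrix_mul_linear inner_diff_right
        flip: matrix_mul_assoc)
next
  case (polys_add f g)
  then show ?case by (simp add: D_add[where E = E] algebra_simps)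
next
  case (polys_mult f g)
  have "D v (D w (\<lambda>Q. f Q * g Q)) Q - D w (D v (\<lambda>Q. f Q * g Q)) Q
      = (D v (D w f) Q - D w (D v f) Q) * g Q + f Q * (D v (D w g) Q - D w (D v g) Q)"
    using polys_mult.hyps by (simp add: D_mult[where E = E] D_add[where E = E] algebra_simps)
  also have "\<dots> = D (\<lambda>e. w e ** v e - v e ** w e) (\<lambda>Q. f Q * g Q) Q"
    using polys_mult by (simp add: D_mult[where E = E])
  finally show ?case .
qed simp

section \<open>Finite-dimensional invariant spaces of polynomials\<close>

definition lin_span :: "('q \<Rightarrow> real) set \<Rightarrow> ('q \<Rightarrow> real) set" where
  "lin_span M = {f. \<exists>a. f = (\<lambda>q. \<Sum>m\<in>M. a m * m q)}"

lemma lin_span_base: "finite M \<Longrightarrow> m \<in> M \<Longrightarrow> m \<in> lin_span M"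
  unfolding lin_span_def
  by (auto intro!: exI[of _ "\<lambda>m'. if m' = m then 1 else 0"] simp: if_distrib[of "\<lambda>x. x * _"] cong: if_cong)

lemma lin_span_cmult: "f \<in> lin_span M \<Longrightarrow> (\<lambda>q. r * f q) \<in> lin_span M"
  unfolding lin_span_def by (auto simp: sum_distrib_left mult.assoc[symmetric])

lemma lin_span_add: "f \<in> lin_span M \<Longrightarrow> g \<in> lin_span M \<Longrightarrow> (\<lambda>q. f q + g q) \<in> lin_span M"
  unfolding lin_span_def by (auto simp flip: sum.distrib distrib_right)

lemma lin_span_sum: "(\<And>j. j \<in> J \<Longrightarrow> f j \<in> lin_span M) \<Longrightarrow> (\<lambda>q. \<Sum>j\<in>J. f j q) \<in> lin_span M"
proof (induction J rule: infinite_finite_induct)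
  case (insert x F)
  then show ?case using lin_span_add[of "f x" M] by auto
qed (auto simp: lin_span_def intro!: exI[of _ "\<lambda>_. 0"])

lemma lin_span_mono:
  assumes "f \<in> lin_span M" "finite M" "M \<subseteq> lin_span M'"
  shows "f \<in> lin_span M'"
  using assms by (auto simp: lin_span_def[of M] intro!: lin_span_sum lin_span_cmult)

lemma lin_span_mult:
  assumes "f \<in> lin_span M" "g \<in> lin_span M'" "finite M" "finite M'"
  shows "(\<lambda>q. f q * g q) \<in> lin_span ((\<lambda>(m, m') q. m q * m' q) ` (M \<times> M'))"
proof -
  let ?P = "(\<lambda>(m, m') q. m q * m' q) ` (M \<times> M')"
  obtain a b where ab: "f = (\<lambda>q. \<Sum>m\<in>M. a m * m q)" "g = (\<lambda>q. \<Sum>m\<in>M'. b m * m q)"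
    using assms unfolding lin_span_def by auto
  have "(\<lambda>q. f q * g q) = (\<lambda>q. \<Sum>m\<in>M. \<Sum>m'\<in>M'. (a m * b m') * (m q * m' q))"
    unfolding ab sum_product by (simp add: mult_ac)
  also have "\<dots> \<in> lin_span ?P"
    using assms by (intro lin_span_sum lin_span_cmult lin_span_base) force+
  finally show ?thesis .
qed

text \<open>Differentiation does not raise the degree: it sends linear coordinates of an edge to
  linear coordinates of the same edge. Sums take the union of two such families, products the
  pairwise products, and one \<open>M\<close> serves all directions \<open>v\<close>.\<close>

lemma polys_finite_span:
  "f \<in> polys E \<Longrightarrow> \<exists>M. finite M \<and> M \<subseteq> polys E \<and> f \<in> lin_span M \<and> (\<forall>v. \<forall>m\<in>M. D v m \<in> lin_span M)"
proof (induction rule: polys.induct)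
  case (polys_const r)
  have r: "(\<lambda>_. s) \<in> lin_span {\<lambda>_::'a \<Rightarrow> complex^'b^'b. 1}" for s
    using lin_span_cmult[OF lin_span_base[of "{\<lambda>_. 1}" "\<lambda>_. 1"], of s] by simp
  show ?case by (intro exI[of _ "{\<lambda>_. 1}"]) (use r in auto)
next
  case (polys_coord e Y)
  let ?M = "(\<lambda>b Q. Q e \<bullet> b) ` (Basis :: (complex^'b^'b) set)"
  have span: "(\<lambda>Q. Q e \<bullet> Y) \<in> lin_span ?M" for Y :: "complex^'b^'b"
  proof -
    have "(\<lambda>Q::'a \<Rightarrow> complex^'b^'b. Q e \<bullet> Y) = (\<lambda>Q. \<Sum>b\<in>Basis. (Y \<bullet> b) * (Q e \<bullet> b))"
      by (subst euclidean_inner) (simp add: mult.commute)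
    also have "\<dots> \<in> lin_span ?M" by (intro lin_span_sum lin_span_cmult lin_span_base) auto
    finally show ?thesis .
  qed
  show ?case
  proof (intro exI[of _ ?M] conjI allI ballI)
    show "?M \<subseteq> polys E" using polys_coord by blast
    fix v :: "'a \<Rightarrow> complex^'b^'b" and m assume "m \<in> ?M"
    then obtain b where "m = (\<lambda>Q. Q e \<bullet> b)" by blast
    then show "D v m \<in> lin_span ?M" by (simp only: D_coord span)
  next
    show "finite ?M" by (rule finite_imageI) (rule finite_Basis)
    show "(\<lambda>Q. Q e \<bullet> Y) \<in> lin_span ?M" by (rule span)
  qed
next
  case (polys_add f g)
  from polys_add.IH(1) obtain M where M: "finite M" "M \<subseteq> polys E" "f \<in> lin_span M"
    "\<And>v m. m \<in> M \<Longrightarrow> D v m \<in> lin_span M" by (elim exE conjE) simp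
  from polys_add.IH(2) obtain M' where M': "finite M'" "M' \<subseteq> polys E" "g \<in> lin_span M'"
    "\<And>v m. m \<in> M' \<Longrightarrow> D v m \<in> lin_span M'" by (elim exE conjE) simp
  have "f \<in> lin_span (M \<union> M')" if "f \<in> lin_span M" for f
    using that M M' by (intro lin_span_mono[OF that]) (auto intro: lin_span_base)
  moreover have "f \<in> lin_span (M \<union> M')" if "f \<in> lin_span M'" for f
    using that M M' by (intro lin_span_mono[OF that]) (auto intro: lin_span_base)
  ultimately show ?case
    using M M' by (intro exI[of _ "M \<union> M'"]) (auto intro: lin_span_add)
next
  case (polys_mult f g)
  from polys_mult.IH(1) obtain M where M: "finite M" "M \<subseteq> polys E" "f \<in> lin_span M"
    "\<And>v m. m \<in> M \<Longrightarrow> D v m \<in> lin_span M" by (elim exE conjE) simp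
  from polys_mult.IH(2) obtain M' where M': "finite M'" "M' \<subseteq> polys E" "g \<in> lin_span M'"
    "\<And>v m. m \<in> M' \<Longrightarrow> D v m \<in> lin_span M'" by (elim exE conjE) simp
  let ?P = "(\<lambda>(m, m') q. m q * m' q) ` (M \<times> M')"
  have "D v (\<lambda>q. m q * m' q) \<in> lin_span ?P" if m: "m \<in> M" "m' \<in> M'" for v m m'
  proof -
    have "m \<in> polys E" "m' \<in> polys E" using m M M' by auto
    then have "D v (\<lambda>q. m q * m' q) = (\<lambda>q. D v m q * m' q + m q * D v m' q)" by (rule D_mult)
    also have "\<dots> \<in> lin_span ?P"
      using m M M' by (intro lin_span_add lin_span_mult) (auto intro: lin_span_base)
    finally show ?thesis .
  qed
  moreover have "(\<lambda>q. f q * g q) \<in> lin_span ?P" using M M' by (intro lin_span_mult)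
  moreover have "?P \<subseteq> polys E" using M M' by (auto intro!: polys.polys_mult)
  moreover have "finite ?P" using M M' by (intro finite_imageI finite_cartesian_product)
  ultimately show ?case by (intro exI[of _ ?P] conjI allI ballI) (assumption | elim imageE; clarsimp)+
qed

text \<open>Gaussian elimination: the pivot \<open>p\<close> clears the equation \<open>m\<close>
  from the other unknowns.\<close>

lemma homogeneous_system:
  fixes a :: "'k \<Rightarrow> 'm \<Rightarrow> real"
  assumes "finite M" "finite K" "card M < card K"
  shows "\<exists>c. (\<exists>k\<in>K. c k \<noteq> 0) \<and> (\<forall>m\<in>M. (\<Sum>k\<in>K. c k * a k m) = 0)"
  using assms
proof (induction M arbitrary: K a rule: finite_induct)
  case empty
  then show ?case by (auto intro!: exI[of _ "\<lambda>_. 1"] simp: card_gt_0_iff)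
next
  case (insert m M)
  show ?case
  proof (cases "\<forall>k\<in>K. a k m = 0")
    case True
    then show ?thesis using insert.IH[of K a] insert.hyps insert.prems by auto
  next
    case False
    then obtain p where p: "p \<in> K" "a p m \<noteq> 0" by auto
    have "card M < card (K - {p})" using insert p by simp
    then obtain c where c: "\<exists>k\<in>K - {p}. c k \<noteq> 0"
      and c0: "\<And>m'. m' \<in> M \<Longrightarrow> (\<Sum>k\<in>K - {p}. c k * (a k m' - a k m / a p m * a p m')) = 0"
      using insert.IH[of "K - {p}" "\<lambda>k m'. a k m' - a k m / a p m * a p m'"] insert.prems by auto
    define s where "s = (\<Sum>k\<in>K - {p}. c k * a k m)"
    \<comment> \<open>The value at the pivot is forced by the equation \<open>m\<close>.\<close>
    let ?c = "c(p := - s / a p m)"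
    have split: "(\<Sum>k\<in>K. ?c k * a k m') = - s / a p m * a p m' + (\<Sum>k\<in>K - {p}. c k * a k m')" for m'
      using p insert.prems by (subst sum.remove[of _ p]) (auto intro!: sum.cong)
    have "(\<Sum>k\<in>K. ?c k * a k m) = 0" unfolding split using p by (simp add: s_def)
    moreover have "(\<Sum>k\<in>K. ?c k * a k m') = 0" if "m' \<in> M" for m'
    proof -
      have "s / a p m * a p m' = (\<Sum>k\<in>K - {p}. c k * (a k m / a p m * a p m'))"
        unfolding s_def sum_divide_distrib sum_distrib_right by (simp add: mult_ac)
      then show ?thesis
        unfolding split using c0[OF that] by (simp add: right_diff_distrib sum_subtractf)
    qed
    moreover have "\<exists>k\<in>K. ?c k \<noteq> 0" using c by auto
    ultimately show ?thesis by (intro exI[of _ ?c]) auto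
  qed
qed

text \<open>The coefficients belong to the indices \<open>k\<close>, not to the functions, so
  repetitions among the \<open>f k\<close> do no harm. One index more than the size of
  \<open>M\<close> is enough.\<close>

lemma lin_span_dependent:
  assumes "finite M" "\<And>k. f k \<in> lin_span M"
  shows "\<exists>n a. (\<exists>k\<le>n::nat. a k \<noteq> (0::real)) \<and> (\<forall>q. (\<Sum>k\<le>n. a k * f k q) = 0)"
proof -
  obtain b where b: "\<And>k. f k = (\<lambda>q. \<Sum>m\<in>M. b k m * m q)"
    using assms(2) unfolding lin_span_def mem_Collect_eq by metis
  obtain c where c: "\<exists>k\<in>{..card M}. c k \<noteq> 0" "\<And>m. m \<in> M \<Longrightarrow> (\<Sum>k\<in>{..card M}. c k * b k m) = 0"
    using homogeneous_system[OF assms(1), of "{..card M}" b] by auto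
  have "(\<Sum>k\<le>card M. c k * f k q) = 0" for q
  proof -
    have "(\<Sum>k\<le>card M. c k * f k q) = (\<Sum>m\<in>M. (\<Sum>k\<le>card M. c k * b k m) * m q)"
      unfolding b sum_distrib_left sum_distrib_right by (subst sum.swap) (simp add: mult_ac)
    then show ?thesis using c(2) by simp
  qed
  then show ?thesis using c(1) by (intro exI[of _ "card M"] exI[of _ c]) auto
qed

section \<open>The gauge groups and their Lie algebras\<close>

lemma det_cnj: "det (\<chi> i j. cnj (A $ i $ j)) = cnj (det A)"
  by (simp add: det_def)

lemma det_cadjoint: "det (cadjoint A) = cnj (det A)"
proof -
  have "cadjoint A = transpose (\<chi> i j. cnj (A $ i $ j))"
    by (simp add: vec_eq_iff transpose_def)
  then show ?thesis by (simp add: det_cnj)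
qed

lemma det_map_of_real: "det (map_matrix complex_of_real R) = complex_of_real (det R)"
  by (simp add: det_def)

text \<open>\<open>SO\<close> consists of the real matrices in \<open>SU\<close>; in this form most
  arguments treat both groups at once.\<close>

lemma gauge_group_iff:
  "A \<in> gauge_group G \<longleftrightarrow> A ** cadjoint A = mat 1 \<and> cadjoint A ** A = mat 1 \<and> det A = 1 \<and>
    (G = SO \<longrightarrow> (\<forall>i j. Im (A $ i $ j) = 0))" for A :: "complex^'n^'n"
proof (cases G)
  case SO
  have mul: "map_matrix complex_of_real (P ** R) = map_matrix complex_of_real P ** map_matrix complex_of_real R"
    for P R :: "real^'n^'n"
    by (simp add: vec_eq_iff matrix_matrix_mult_def)
  have adj: "cadjoint (map_matrix complex_of_real R) = map_matrix complex_of_real (transpose R)" for R :: "real^'n^'n"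
    by (simp add: vec_eq_iff transpose_def)
  have one: "map_matrix complex_of_real (mat 1) = (mat 1 :: complex^'n^'n)"
    by (simp add: vec_eq_iff mat_def)
  have inj: "map_matrix complex_of_real P = map_matrix complex_of_real R \<longleftrightarrow> P = R" for P R :: "real^'n^'n"
    by (simp add: vec_eq_iff)
  have key: "rotation_matrix R \<longleftrightarrow>
      (let A = map_matrix complex_of_real R in A ** cadjoint A = mat 1 \<and> cadjoint A ** A = mat 1 \<and> det A = 1)"
    for R :: "real^'n^'n"
    by (auto simp: Let_def rotation_matrix_def orthogonal_matrix_def adj det_map_of_real inj
        simp flip: mul one)
  show ?thesis
  proof
    assume "A \<in> gauge_group G"
    then obtain R where "A = map_matrix complex_of_real R" "rotation_matrix R" using SO by auto
    then show "A ** cadjoint A = mat 1 \<and> cadjoint A ** A = mat 1 \<and> det A = 1 \<and>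
        (G = SO \<longrightarrow> (\<forall>i j. Im (A $ i $ j) = 0))"
      by (simp add: key Let_def)
  next
    assume A: "A ** cadjoint A = mat 1 \<and> cadjoint A ** A = mat 1 \<and> det A = 1 \<and>
        (G = SO \<longrightarrow> (\<forall>i j. Im (A $ i $ j) = 0))"
    then have "A = map_matrix complex_of_real (\<chi> i j. Re (A $ i $ j))"
      using SO by (simp add: vec_eq_iff complex_eq_iff)
    then show "A \<in> gauge_group G"
      using A SO key[of "\<chi> i j. Re (A $ i $ j)"] by (auto simp: Let_def)
  qed
qed auto

lemma Im_matrix_mul:
  assumes "\<And>i j. Im (A $ i $ j) = 0" "\<And>i j. Im (B $ i $ j) = 0"
  shows "Im (((A :: complex^'n^'n) ** (B :: complex^'n^'n)) $ i $ j) = 0"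
  using assms by (simp add: matrix_matrix_mult_def)

lemma gauge_group_mul:
  assumes "A \<in> gauge_group G" "B \<in> gauge_group G"
  shows "A ** B \<in> gauge_group G"
proof -
  have "A ** B ** cadjoint (A ** B) = A ** (B ** cadjoint B) ** cadjoint A"
    "cadjoint (A ** B) ** (A ** B) = cadjoint B ** (cadjoint A ** A) ** B"
    by (simp_all add: cadjoint_matrix_mul matrix_mul_assoc)
  then show ?thesis using assms by (auto simp: gauge_group_iff det_mul Im_matrix_mul)
qed

lemma gauge_group_cadjoint: "A \<in> gauge_group G \<Longrightarrow> cadjoint A \<in> gauge_group G"
  by (auto simp: gauge_group_iff det_cadjoint)

lemma gauge_group_one [simp]: "mat 1 \<in> gauge_group G"
  by (auto simp: gauge_group_iff) (simp add: mat_def)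

lemma norm_gauge_group: "A \<in> gauge_group G \<Longrightarrow> norm A = norm (mat 1 :: complex^'n^'n)" for A :: "complex^'n^'n"
  using norm_unitary_mul[of A "mat 1"] by (simp add: gauge_group_iff)

definition lie_algebra :: "gauge_type \<Rightarrow> (complex^'n^'n) set" where
  "lie_algebra G = {X. cadjoint X = - X \<and> trace X = 0 \<and> (G = SO \<longrightarrow> (\<forall>i j. Im (X $ i $ j) = 0))}"

lemma trace_scaleR: "trace (r *\<^sub>R X) = r *\<^sub>R trace (X :: complex^'n^'n)"
  by (simp add: trace_def scaleR_sum_right)

lemma subspace_lie_algebra: "subspace (lie_algebra G :: (complex^'n^'n) set)"
proof -
  have "trace (0 :: complex^'n^'n) = 0" by (simp add: trace_def)
  then show ?thesis
    unfolding subspace_def by (auto simp: lie_algebra_def cadjoint_linear trace_add trace_scaleR)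
qed

lemma lie_algebra_bracket:
  assumes "X \<in> lie_algebra G" "Y \<in> lie_algebra G"
  shows "X ** Y - Y ** X \<in> lie_algebra G"
proof -
  have "Im ((X ** Y) $ i $ j) = 0" "Im ((Y ** X) $ i $ j) = 0" if "G = SO" for i j
    using assms that by (auto simp: lie_algebra_def Im_matrix_mul)
  then show ?thesis
    using assms trace_mul_sym[of X Y]
    by (auto simp: lie_algebra_def cadjoint_linear cadjoint_matrix_mul matrix_mul_linear trace_sub)
qed

section \<open>Matrix units and one-parameter subgroups in closed form\<close>

definition munit :: "complex \<Rightarrow> 'n \<Rightarrow> 'n \<Rightarrow> complex^'n^'n" where
  "munit z i j = (\<chi> a b. if a = i \<and> b = j then z else 0)"

lemma munit_nth: "munit z i j $ a $ b = (if a = i \<and> b = j then z else 0)"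
  by (simp add: munit_def)

lemma munit_mul: "munit z i j ** munit w k l = (if j = k then munit (z * w) i l else 0)"
proof -
  have "(\<Sum>m\<in>UNIV. munit z i j $ a $ m * munit w k l $ m $ b) =
      (\<Sum>m\<in>UNIV. if m = j then (if a = i \<and> j = k \<and> b = l then z * w else 0) else 0)" for a b
    by (intro sum.cong) (auto simp: munit_nth)
  then show ?thesis by (simp add: vec_eq_iff matrix_matrix_mult_def munit_nth)
qed

lemma cadjoint_munit: "cadjoint (munit z i j) = munit (cnj z) j i"
  by (auto simp: vec_eq_iff munit_nth)

lemma munit_add: "munit z i j + munit w i j = munit (z + w) i j"
  by (auto simp: vec_eq_iff munit_nth)

lemma munit_uminus: "munit (- z) i j = - munit z i j"
  by (auto simp: vec_eq_iff munit_nth)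

lemma munit_zero [simp]: "munit 0 i j = 0"
  by (auto simp: vec_eq_iff munit_nth)

lemma scaleR_munit: "r *\<^sub>R munit z i j = munit (r *\<^sub>R z) i j"
  by (auto simp: vec_eq_iff munit_nth)

lemma munit_decomp: "munit z i j = Re z *\<^sub>R munit 1 i j + Im z *\<^sub>R munit \<i> i j"
proof -
  have "Re z *\<^sub>R 1 + Im z *\<^sub>R \<i> = z" by (simp add: complex_eq_iff)
  then show ?thesis unfolding scaleR_munit munit_add by simp
qed

lemma Im_munit_1: "Im (munit 1 i j $ a $ b) = 0"
  by (simp add: munit_nth)

lemma trace_munit: "trace (munit z i j) = (if i = j then z else 0)"
proof -
  have "trace (munit z i j) = (\<Sum>m\<in>UNIV. if m = i then (if i = j then z else 0) else 0)"
    unfolding trace_def by (intro sum.cong) (auto simp: munit_nth)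
  then show ?thesis by simp
qed

lemma matrix_eq_sum_munit: "X = (\<Sum>i\<in>UNIV. \<Sum>j\<in>UNIV. munit (X $ i $ j) i j)"
proof -
  have "(\<Sum>i\<in>UNIV. \<Sum>j\<in>UNIV. munit (X $ i $ j) i j $ a $ b) =
      (\<Sum>i\<in>UNIV. if i = a then (\<Sum>j\<in>UNIV. if j = b then X $ a $ b else 0) else 0)" for a b
    by (intro sum.cong) (auto simp: munit_nth intro!: sum.neutral sum.cong)
  then show ?thesis by (simp add: vec_eq_iff)
qed

text \<open>Rodrigues' formula for \<open>exp (t K)\<close> when \<open>K\<^sup>3 = - K\<close>.\<close>

definition rodrigues :: "complex^'n^'n \<Rightarrow> real \<Rightarrow> complex^'n^'n" where
  "rodrigues K t = mat 1 + sin t *\<^sub>R K + (1 - cos t) *\<^sub>R (K ** K)"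

lemma rodrigues_add:
  assumes "K ** K ** K = - K"
  shows "rodrigues K (s + t) = rodrigues K s ** rodrigues K t"
proof -
  have 3: "K ** (K ** K) = - K" using assms by (simp add: matrix_mul_assoc)
  then have 4: "K ** K ** (K ** K) = - (K ** K)"
    by (simp add: matrix_mul_linear flip: matrix_mul_assoc)
  have "rodrigues K s ** rodrigues K t = mat 1
      + (sin s * cos t + cos s * sin t) *\<^sub>R K
      + (1 - (cos s * cos t - sin s * sin t)) *\<^sub>R (K ** K)"
    unfolding rodrigues_def by (simp add: matrix_mul_linear assms 3 4 algebra_simps)
  then show ?thesis by (simp add: rodrigues_def sin_add cos_add)
qed

lemma rodrigues_0 [simp]: "rodrigues K 0 = mat 1"
  by (simp add: rodrigues_def)

lemma rodrigues_unitary: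
  assumes "K ** K ** K = - K" "cadjoint K = - K"
  shows "cadjoint (rodrigues K t) = rodrigues K (- t)"
    "rodrigues K t ** cadjoint (rodrigues K t) = mat 1"
    "cadjoint (rodrigues K t) ** rodrigues K t = mat 1"
proof -
  show *: "cadjoint (rodrigues K t) = rodrigues K (- t)"
    by (simp add: rodrigues_def cadjoint_linear cadjoint_matrix_mul matrix_mul_linear assms)
  show "rodrigues K t ** cadjoint (rodrigues K t) = mat 1"
    "cadjoint (rodrigues K t) ** rodrigues K t = mat 1"
    unfolding * by (simp_all flip: rodrigues_add[OF assms(1)])
qed

lemma rodrigues_derivative:
  assumes "K ** K ** K = - K"
  shows "((\<lambda>t. (rodrigues K t ** (A :: complex^'n^'n)) \<bullet> Y) has_real_derivative (K ** (rodrigues K t ** A)) \<bullet> Y) (at t)"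
proof -
  have 3: "K ** (K ** K ** A) = - (K ** A)"
    using assms by (simp add: matrix_mul_assoc matrix_mul_linear)
  have "K ** (rodrigues K t ** A) = cos t *\<^sub>R (K ** A) + sin t *\<^sub>R (K ** K ** A)"
    unfolding rodrigues_def by (simp add: matrix_mul_linear 3) (simp add: matrix_mul_assoc algebra_simps)
  moreover have "(rodrigues K t ** A) \<bullet> Y = A \<bullet> Y + sin t * ((K ** A) \<bullet> Y) + (1 - cos t) * ((K ** K ** A) \<bullet> Y)" for t
    unfolding rodrigues_def by (simp add: matrix_mul_linear inner_add_left)
  ultimately show ?thesis
    by (auto intro!: derivative_eq_intros simp: inner_add_left)
qed

text \<open>For these elements the exponential is the explicit \<open>rodrigues\<close> curve. They
  span the Lie algebra, and their curves generate the group, which is what integration by parts and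
  connectedness rest on.\<close>

definition generator :: "gauge_type \<Rightarrow> complex^'n^'n \<Rightarrow> bool" where
  "generator G K \<longleftrightarrow> K \<in> lie_algebra G \<and> K ** K ** K = - K \<and> cadjoint K = - K \<and> (\<forall>t. rodrigues K t \<in> gauge_group G)"

lemma generator_rotation:
  assumes "i \<noteq> j"
  shows "generator G (munit 1 i j - munit 1 j i)"
proof -
  let ?K = "munit 1 i j - munit 1 j i"
  have K3: "?K ** ?K ** ?K = - ?K" and adj: "cadjoint ?K = - ?K"
    using assms by (simp_all add: matrix_mul_linear munit_mul cadjoint_linear cadjoint_munit)
  have lie: "?K \<in> lie_algebra G"
    using assms by (simp add: lie_algebra_def adj trace_sub trace_munit Im_munit_1)
  have re: "Im (rodrigues ?K t $ a $ b) = 0" for t a b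
  proof -
    have K: "Im (?K $ a $ b) = 0" for a b by (simp add: Im_munit_1)
    have "Im ((?K ** ?K) $ a $ b) = 0" by (rule Im_matrix_mul) (rule K)+
    moreover have "Im ((mat 1 :: complex^'a^'a) $ a $ b) = 0" by (simp add: mat_def)
    ultimately show ?thesis using K[of a b] unfolding rodrigues_def by simp
  qed
  have "det (rodrigues ?K t) = 1" for t
  proof -
    \<comment> \<open>At half the angle the determinant is real and of modulus 1; its square is the
      determinant at the full angle.\<close>
    let ?d = "det (rodrigues ?K (t / 2))"
    have "(\<chi> a b. cnj (rodrigues ?K (t / 2) $ a $ b)) = rodrigues ?K (t / 2)"
      using re by (simp add: vec_eq_iff complex_eq_iff)
    then have "cnj ?d = ?d" using det_cnj[of "rodrigues ?K (t / 2)"] by simp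
    moreover have "?d * cnj ?d = 1"
      using rodrigues_unitary(2)[OF K3 adj, of "t / 2"] by (metis det_I det_cadjoint det_mul)
    ultimately have "?d * ?d = 1" by simp
    then show ?thesis using rodrigues_add[OF K3, of "t / 2" "t / 2"] by (simp add: det_mul)
  qed
  then show ?thesis
    unfolding generator_def gauge_group_iff using K3 adj re rodrigues_unitary[OF K3 adj] lie by auto
qed

lemma generator_phase:
  assumes "i \<noteq> j"
  shows "generator SU (munit \<i> i i - munit \<i> j j)"
proof -
  let ?K = "munit \<i> i i - munit \<i> j j"
  have K3: "?K ** ?K ** ?K = - ?K" and adj: "cadjoint ?K = - ?K"
    using assms by (simp_all add: matrix_mul_linear munit_mul cadjoint_linear cadjoint_munit munit_uminus)
  have lie: "?K \<in> lie_algebra SU"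
    by (simp add: lie_algebra_def adj trace_sub trace_munit)
  have "det (rodrigues ?K t) = 1" for t
  proof -
    have nth: "rodrigues ?K t $ a $ b = (if a = b then if a = i then cis t else if a = j then cis (- t) else 1 else 0)" for a b
      unfolding rodrigues_def using assms
      by (auto simp: matrix_mul_linear munit_mul munit_nth mat_def complex_eq_iff)
    have "det (rodrigues ?K t) = (\<Prod>a\<in>UNIV. rodrigues ?K t $ a $ a)"
      by (intro det_diagonal) (simp add: nth)
    also have "\<dots> = (\<Prod>a\<in>UNIV. (if a = i then cis t else 1) * (if a = j then cis (- t) else 1))"
      using assms by (intro prod.cong) (auto simp: nth)
    also have "\<dots> = 1" by (simp add: prod.distrib cis_mult)
    finally show ?thesis .
  qed
  then show ?thesis
    unfolding generator_def gauge_group_iff using K3 adj rodrigues_unitary[OF K3 adj] lie by auto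
qed

lemma generator_imaginary:
  assumes "i \<noteq> j"
  shows "generator SU (munit \<i> i j + munit \<i> j i)"
proof -
  let ?K = "munit \<i> i j + munit \<i> j i" and ?R = "munit 1 i j - munit 1 j i"
  \<comment> \<open>A diagonal unitary with entry \<i> at position \<open>i\<close>. It conjugates
    the real rotation generator into \<open>?K\<close>; its own determinant is \<i>, but conjugation
    preserves determinants.\<close>
  let ?U = "mat 1 + munit (\<i> - 1) i i"
  have K3: "?K ** ?K ** ?K = - ?K" and adj: "cadjoint ?K = - ?K"
    using assms by (simp_all add: matrix_mul_linear munit_mul cadjoint_linear cadjoint_munit munit_uminus)
  have lie: "?K \<in> lie_algebra SU"
    using assms by (simp add: lie_algebra_def adj trace_add trace_munit)
  have U: "?U ** cadjoint ?U = mat 1" "cadjoint ?U ** ?U = mat 1"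
    by (simp_all add: matrix_mul_linear cadjoint_linear cadjoint_munit munit_mul munit_add algebra_simps)
  have K: "?K = ?U ** ?R ** cadjoint ?U"
    using assms by (simp add: matrix_mul_linear cadjoint_linear cadjoint_munit munit_mul munit_add algebra_simps munit_uminus)
  have "?K ** ?K = ?U ** ?R ** (cadjoint ?U ** ?U) ** ?R ** cadjoint ?U"
    unfolding K by (simp only: matrix_mul_assoc)
  then have KK: "?K ** ?K = ?U ** (?R ** ?R) ** cadjoint ?U"
    unfolding U by (simp add: matrix_mul_assoc)
  have "rodrigues ?K t = ?U ** rodrigues ?R t ** cadjoint ?U" for t
    unfolding rodrigues_def[of ?K] KK
    unfolding K rodrigues_def[of ?R] using U(1)
    by (simp only: matrix_mul_linear matrix_mul_rid)
  then have "det (rodrigues ?K t) = det (?U ** cadjoint ?U) * det (rodrigues ?R t)" for t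
    by (simp add: det_mul mult_ac)
  also have "\<dots> t = 1" for t
    using generator_rotation[OF assms, of SU] by (simp add: U generator_def gauge_group_iff)
  finally show ?thesis
    unfolding generator_def gauge_group_iff using K3 adj rodrigues_unitary[OF K3 adj] lie by auto
qed

lemma lie_algebra_span: "lie_algebra G \<subseteq> span {K. generator G K}"
proof
  fix X :: "complex^'n^'n" assume X: "X \<in> lie_algebra G"
  let ?S = "span {K :: complex^'n^'n. generator G K}"
  \<comment> \<open>Any fixed index serves to compensate the diagonal entries.\<close>
  define k :: 'n where "k = undefined"
  have skew: "X $ i $ j = - cnj (X $ j $ i)" for i j
    using X by (auto simp: lie_algebra_def vec_eq_iff)
  have Re_diag: "Re (X $ i $ i) = 0" for i
    using skew[of i i] by (simp add: complex_eq_iff)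
  \<comment> \<open>Each unordered pair of indices is met twice, hence the factors 1/2.\<close>
  define Y where "Y i j = (Re (X $ i $ j) / 2) *\<^sub>R (munit 1 i j - munit 1 j i)
    + (Im (X $ i $ j) / 2) *\<^sub>R (munit \<i> i j + munit \<i> j i)" for i j
  have "X = (\<Sum>i\<in>UNIV. \<Sum>j\<in>UNIV. Y i j) "
  proof -
    have Y: "Y i j = (1/2) *\<^sub>R (munit (X $ i $ j) i j + munit (X $ j $ i) j i)" for i j
    proof -
      have X_ji: "Re (X $ j $ i) = - Re (X $ i $ j)" "Im (X $ j $ i) = Im (X $ i $ j)"
        using skew[of j i] by simp_all
      show ?thesis
        unfolding Y_def munit_decomp[of "X $ i $ j"] munit_decomp[of "X $ j $ i"] X_ji
        by (simp add: algebra_simps)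
    qed
    have "(\<Sum>i\<in>UNIV. \<Sum>j\<in>UNIV. Y i j) = (1/2) *\<^sub>R ((\<Sum>i\<in>UNIV. \<Sum>j\<in>UNIV. munit (X $ i $ j) i j)
        + (\<Sum>i\<in>UNIV. \<Sum>j\<in>UNIV. munit (X $ j $ i) j i))"
      by (simp add: Y scaleR_sum_right sum.distrib scaleR_add_right)
    also have "(\<Sum>i\<in>UNIV. \<Sum>j\<in>UNIV. munit (X $ j $ i) j i) = (\<Sum>i\<in>UNIV. \<Sum>j\<in>UNIV. munit (X $ i $ j) i j)"
      by (rule sum.swap)
    finally show ?thesis by (simp flip: matrix_eq_sum_munit scaleR_left_distrib)
  qed
  \<comment> \<open>The subtracted multiples of a single diagonal unit add up to zero because
    \<open>X\<close> has trace zero; they turn the diagonal part into phase generators.\<close>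
  also have "\<dots> = (\<Sum>i\<in>UNIV. \<Sum>j\<in>UNIV. if i = j then Y i i - Im (X $ i $ i) *\<^sub>R munit \<i> k k else Y i j)"
  proof -
    have "(\<Sum>i\<in>UNIV. \<Sum>j\<in>UNIV. if i = j then Y i i - Im (X $ i $ i) *\<^sub>R munit \<i> k k else Y i j)
       = (\<Sum>i\<in>UNIV. \<Sum>j\<in>UNIV. Y i j - (if j = i then Im (X $ i $ i) *\<^sub>R munit \<i> k k else 0))"
      by (intro sum.cong) auto
    also have "\<dots> = (\<Sum>i\<in>UNIV. \<Sum>j\<in>UNIV. Y i j) - (\<Sum>i\<in>UNIV. Im (X $ i $ i)) *\<^sub>R munit \<i> k k"
      by (simp add: sum_subtractf scaleR_sum_left)
    also have "(\<Sum>i\<in>UNIV. Im (X $ i $ i)) = Im (trace X)" by (simp add: trace_def)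
    also have "\<dots> = 0" using X by (simp add: lie_algebra_def)
    finally show ?thesis by simp
  qed
  also have "\<dots> \<in> ?S"
  proof (intro span_sum)
    fix i j
    have gen: "r *\<^sub>R K \<in> ?S" if "generator G K" for K r using that by (intro span_scale span_base) simp
    have zero: "0 \<in> ?S" by (rule span_zero)
    show "(if i = j then Y i i - Im (X $ i $ i) *\<^sub>R munit \<i> k k else Y i j) \<in> ?S"
    proof (cases "i = j")
      case True
      have "Y i i - Im (X $ i $ i) *\<^sub>R munit \<i> k k = Im (X $ i $ i) *\<^sub>R (munit \<i> i i - munit \<i> k k)"
        unfolding Y_def by (simp add: Re_diag scaleR_right_diff_distrib flip: scaleR_2)
      moreover have "Im (X $ i $ i) *\<^sub>R (munit \<i> i i - munit \<i> k k) \<in> ?S"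
      proof (cases "i = k \<or> G = SO")
        case True
        then have "Im (X $ i $ i) *\<^sub>R (munit \<i> i i - munit \<i> k k) = 0"
          using X by (auto simp: lie_algebra_def)
        then show ?thesis using zero by (simp only:)
      next
        case False
        then have "G = SU" "i \<noteq> k" by (cases G; auto)+
        then show ?thesis using gen generator_phase by blast
      qed
      ultimately show ?thesis using True by simp
    next
      case False
      have "(Im (X $ i $ j) / 2) *\<^sub>R (munit \<i> i j + munit \<i> j i) \<in> ?S"
      proof (cases G)
        case SO
        then have "Im (X $ i $ j) = 0" using X by (auto simp: lie_algebra_def)
        then show ?thesis using zero by simp
      next
        case SU
        then show ?thesis using gen generator_imaginary[OF False] by blast
      qed
      moreover have "(Re (X $ i $ j) / 2) *\<^sub>R (munit 1 i j - munit 1 j i) \<in> ?S"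
        using gen generator_rotation[OF False] by blast
      ultimately show ?thesis using False by (simp add: Y_def span_add)
    qed
  qed
  finally show "X \<in> ?S" .
qed

section \<open>Generation of the gauge groups by one-parameter subgroups\<close>

inductive_set generated :: "gauge_type \<Rightarrow> (complex^'n^'n) set" for G where
  generated_one: "mat 1 \<in> generated G"
| generated_step: "generator G K \<Longrightarrow> B \<in> generated G \<Longrightarrow> rodrigues K t ** B \<in> generated G"

text \<open>Elimination simplifies a matrix from the left, so membership has to be pulled back from
  the simplified matrix to the original one.\<close>

lemma generated_cancel:
  assumes "generator G K" "rodrigues K t ** A \<in> generated G"
  shows "A \<in> generated G"
proof -
  have "rodrigues K (- t) ** (rodrigues K t ** A) = A"
    using assms(1) rodrigues_add[of K "- t" t, symmetric] by (simp add: generator_def matrix_mul_assoc)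
  then show ?thesis using generated_step[OF assms, of "- t"] by simp
qed

lemma munit_mul_nth: "(munit z i j ** (A :: complex^'n^'n)) $ a $ b = (if a = i then z * A $ j $ b else 0)"
proof -
  have "(munit z i j ** A) $ a $ b = (\<Sum>m\<in>UNIV. munit z i j $ a $ m * A $ m $ b)"
    by (simp add: matrix_matrix_mult_def)
  also have "\<dots> = (\<Sum>m\<in>UNIV. if m = j then (if a = i then z * A $ j $ b else 0) else 0)"
    by (intro sum.cong) (auto simp: munit_nth)
  finally show ?thesis by simp
qed

lemma rotation_row:
  assumes "i \<noteq> j"
  shows "(rodrigues (munit 1 i j - munit 1 j i) t ** (A :: complex^'n^'n)) $ a $ b =
    (if a = i then cos t *\<^sub>R A $ i $ b + sin t *\<^sub>R A $ j $ b
     else if a = j then cos t *\<^sub>R A $ j $ b - sin t *\<^sub>R A $ i $ b else A $ a $ b)"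
proof -
  let ?K = "munit 1 i j - munit 1 j i"
  have KK: "?K ** ?K = - munit 1 i i - munit 1 j j"
    using assms by (simp add: matrix_mul_linear munit_mul)
  show ?thesis
    unfolding rodrigues_def KK using assms
    by (simp add: matrix_mul_linear munit_mul_nth algebra_simps)
qed

lemma phase_row:
  assumes "i \<noteq> j"
  shows "(rodrigues (munit \<i> i i - munit \<i> j j) t ** (A :: complex^'n^'n)) $ a $ b =
    (if a = i then cis t * A $ i $ b else if a = j then cis (- t) * A $ j $ b else A $ a $ b)"
proof -
  let ?K = "munit \<i> i i - munit \<i> j j"
  have KK: "?K ** ?K = - munit 1 i i - munit 1 j j"
    using assms by (simp add: matrix_mul_linear munit_mul munit_uminus)
  have cis: "cis t = 1 + \<i> * sin t + (cos t - 1)" "cis (- t) = 1 - \<i> * sin t + (cos t - 1)"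
    by (simp_all add: complex_eq_iff)
  show ?thesis
    unfolding rodrigues_def KK cis using assms
    by (simp add: matrix_mul_linear munit_mul_nth) (simp add: scaleR_conv_of_real algebra_simps)
qed

lemma polar: "\<exists>r\<ge>0. \<exists>t. (x::real) = r * cos t \<and> y = r * sin t"
proof -
  have "Complex x y = rcis (cmod (Complex x y)) (Arg (Complex x y))" by (simp add: rcis_cmod_Arg)
  then show ?thesis
    by (intro exI[of _ "cmod (Complex x y)"] conjI exI[of _ "Arg (Complex x y)"])
      (simp_all add: complex_eq_iff)
qed

text \<open>A Givens rotation of the rows \<open>i\<close> and \<open>j\<close>, made real by phases
  in the case \<open>SU\<close>. The last clause protects the columns that already agree with the
  identity.\<close>

lemma eliminate_entry:
  fixes A :: "complex^'n^'n"
  assumes ij: "i \<noteq> j" and A: "A \<in> gauge_group G"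
  shows "\<exists>B\<in>gauge_group G. (B \<in> generated G \<longrightarrow> A \<in> generated G) \<and> B $ j $ c = 0 \<and>
    (\<exists>r\<ge>0. B $ i $ c = complex_of_real r) \<and> (\<forall>a b. a \<noteq> i \<longrightarrow> a \<noteq> j \<longrightarrow> B $ a $ b = A $ a $ b) \<and>
    (\<forall>b. A $ i $ b = 0 \<longrightarrow> A $ j $ b = 0 \<longrightarrow> B $ i $ b = 0 \<and> B $ j $ b = 0)"
proof -
  let ?R = "rodrigues (munit 1 i j - munit 1 j i)" and ?P = "rodrigues (munit \<i> i i - munit \<i> j j)"
  show ?thesis
  proof (cases G)
    case SO
    then have re: "Im (A $ i $ c) = 0" "Im (A $ j $ c) = 0" using A by (auto simp: gauge_group_iff)
    obtain r t where r: "r \<ge> 0" "Re (A $ i $ c) = r * cos t" "Re (A $ j $ c) = r * sin t"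
      using polar by blast
    have g: "generator G (munit 1 i j - munit 1 j i)" by (rule generator_rotation[OF ij])
    have i: "(?R t ** A) $ i $ c = complex_of_real r"
      using ij re r sin_cos_squared_add[of t]
      by (simp add: rotation_row complex_eq_iff power2_eq_square algebra_simps flip: distrib_left)
    have j: "(?R t ** A) $ j $ c = 0"
      using ij re r by (simp add: rotation_row complex_eq_iff)
    show ?thesis
    proof (intro bexI[of _ "?R t ** A"] conjI impI)
      show "?R t ** A \<in> gauge_group G" using g A by (auto simp: generator_def intro: gauge_group_mul)
      show "A \<in> generated G" if "?R t ** A \<in> generated G" using generated_cancel[OF g that] .
    qed (use i j r ij in \<open>auto simp: rotation_row\<close>)
  next
    case SU
    define \<alpha> where "\<alpha> = Arg (A $ i $ c)"
    define \<gamma> where "\<gamma> = Arg (A $ j $ c)"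
    \<comment> \<open>The first phase multiplies row \<open>i\<close> by \<open>cis \<theta>\<close>
      and row \<open>j\<close> by its conjugate, so half the difference of the arguments gives both
      entries the common argument \<open>\<delta>\<close>. A real rotation can then clear one of
      them, and the phase \<open>- \<delta>\<close> makes the other real.\<close>
    define \<theta> where "\<theta> = (\<gamma> - \<alpha>) / 2"
    define \<delta> where "\<delta> = (\<gamma> + \<alpha>) / 2"
    obtain r t where r: "r \<ge> 0" "cmod (A $ i $ c) = r * cos t" "cmod (A $ j $ c) = r * sin t"
      using polar by blast
    have g: "generator G (munit 1 i j - munit 1 j i)" by (rule generator_rotation[OF ij])
    have p: "generator G (munit \<i> i i - munit \<i> j j)" using generator_phase[OF ij] SU by simp
    have ai: "A $ i $ c = cmod (A $ i $ c) * cis \<alpha>" "A $ j $ c = cmod (A $ j $ c) * cis \<gamma>"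
      using rcis_cmod_Arg[of "A $ i $ c"] rcis_cmod_Arg[of "A $ j $ c"] by (simp_all add: \<alpha>_def \<gamma>_def rcis_def)
    have 1: "(?P \<theta> ** A) $ i $ c = cmod (A $ i $ c) * cis \<delta>" "(?P \<theta> ** A) $ j $ c = cmod (A $ j $ c) * cis \<delta>"
    proof -
      have "\<theta> + \<alpha> = \<delta>" "- \<theta> + \<gamma> = \<delta>" by (simp_all add: \<theta>_def \<delta>_def field_simps)
      then have "cis \<theta> * cis \<alpha> = cis \<delta>" "cis (- \<theta>) * cis \<gamma> = cis \<delta>" by (simp_all add: cis_mult)
      moreover have "(?P \<theta> ** A) $ i $ c = cmod (A $ i $ c) * (cis \<theta> * cis \<alpha>)"
        using ij by (simp add: phase_row) (rule ai(1))
      moreover have "(?P \<theta> ** A) $ j $ c = cmod (A $ j $ c) * (cis (- \<theta>) * cis \<gamma>)"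
        using ij by (simp add: phase_row) (rule ai(2))
      ultimately show "(?P \<theta> ** A) $ i $ c = cmod (A $ i $ c) * cis \<delta>" "(?P \<theta> ** A) $ j $ c = cmod (A $ j $ c) * cis \<delta>"
        by simp_all
    qed
    let ?B = "?P (- \<delta>) ** (?R t ** (?P \<theta> ** A))"
    have 2: "(?R t ** (?P \<theta> ** A)) $ i $ c = r * cis \<delta>" "(?R t ** (?P \<theta> ** A)) $ j $ c = 0"
    proof -
      have "(?R t ** (?P \<theta> ** A)) $ i $ c = complex_of_real (r * (cos t * cos t + sin t * sin t)) * cis \<delta>"
        using ij by (simp add: rotation_row 1 r scaleR_conv_of_real algebra_simps del: sin_cos_squared_add3)
      then show "(?R t ** (?P \<theta> ** A)) $ i $ c = r * cis \<delta>" by simp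
      show "(?R t ** (?P \<theta> ** A)) $ j $ c = 0"
        using ij by (simp add: rotation_row 1 r scaleR_conv_of_real algebra_simps)
    qed
    have i: "?B $ i $ c = complex_of_real r" and j: "?B $ j $ c = 0"
      using ij by (simp_all add: phase_row 2 cis_mult mult.left_commute)
    show ?thesis
    proof (intro bexI[of _ ?B] conjI impI)
      show "?B \<in> gauge_group G"
        using g p A by (auto simp: generator_def intro!: gauge_group_mul)
      show "A \<in> generated G" if "?B \<in> generated G"
        using generated_cancel[OF p generated_cancel[OF g generated_cancel[OF p that]]] .
    qed (use i j r ij in \<open>auto simp: rotation_row phase_row\<close>)
  qed
qed

lemma unitary_column_norm:
  assumes "cadjoint A ** A = mat 1"
  shows "(\<Sum>a\<in>UNIV. (cmod (A $ a $ k))\<^sup>2) = 1"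
proof -
  have "(\<Sum>a\<in>UNIV. cnj (A $ a $ k) * A $ a $ k) = 1"
    using arg_cong[OF assms, of "\<lambda>M. M $ k $ k"] by (simp add: matrix_matrix_mult_def mat_def)
  moreover have "cnj z * z = complex_of_real ((cmod z)\<^sup>2)" for z
    using complex_norm_square[of z] by (simp add: mult.commute)
  ultimately have "complex_of_real (\<Sum>a\<in>UNIV. (cmod (A $ a $ k))\<^sup>2) = complex_of_real 1" by simp
  then show ?thesis by (simp only: of_real_eq_iff)
qed

definition fixes_outside :: "'n set \<Rightarrow> complex^'n^'n \<Rightarrow> bool" where
  "fixes_outside S A \<longleftrightarrow> (\<forall>k. k \<notin> S \<longrightarrow> (\<forall>b. A $ k $ b = (if k = b then 1 else 0) \<and> A $ b $ k = (if k = b then 1 else 0)))"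

text \<open>Elimination by plane rotations: the columns outside \<open>S\<close> are already those of the identity.\<close>

lemma gauge_group_generated_aux:
  fixes A :: "complex^'n^'n"
  assumes "A \<in> gauge_group G" "fixes_outside S A"
  shows "A \<in> generated G"
proof -
  have "finite S" by simp
  then show ?thesis using assms
  proof (induction S arbitrary: A rule: finite_psubset_induct)
    case (psubset S)
    show ?case
    proof (cases "\<exists>k l. k \<in> S \<and> l \<in> S \<and> k \<noteq> l")
      \<comment> \<open>At most one index is left: the matrix is diagonal and the remaining entry
        equals the determinant.\<close>
      case False
      have diag: "A $ a $ b = 0" if "a \<noteq> b" for a b
        using psubset.prems(2) False that unfolding fixes_outside_def by metis
      have ones: "A $ a $ a = 1" for a
      proof (cases "a \<in> S")
        case True
        then have "A $ b $ b = 1" if "b \<noteq> a" for b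
          using psubset.prems(2) False that unfolding fixes_outside_def by metis
        then have "(\<Prod>b\<in>UNIV. A $ b $ b) = (\<Prod>b\<in>UNIV. if b = a then A $ a $ a else 1)"
          by (intro prod.cong) auto
        then have "det A = A $ a $ a" using det_diagonal[of A] diag by simp
        then show ?thesis using psubset.prems(1) by (simp add: gauge_group_iff)
      next
        case False then show ?thesis using psubset.prems(2) unfolding fixes_outside_def by simp
      qed
      have "A = mat 1" using diag ones by (auto simp: vec_eq_iff mat_def)
      then show ?thesis by (simp add: generated_one)
    next
      case True
      then obtain k l where kl: "k \<in> S" "l \<in> S" "k \<noteq> l" by blast
      have elim: "\<exists>B\<in>gauge_group G. (B \<in> generated G \<longrightarrow> A \<in> generated G) \<and> fixes_outside S B \<and> B $ j $ k = 0 \<and>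
          (\<exists>r\<ge>0. B $ k $ k = complex_of_real r) \<and> (\<forall>a. a \<noteq> k \<longrightarrow> a \<noteq> j \<longrightarrow> B $ a $ k = A $ a $ k)"
        if j: "j \<in> S" "j \<noteq> k" and A: "A \<in> gauge_group G" "fixes_outside S A" for j and A :: "complex^'n^'n"
      proof -
        obtain B where B: "B \<in> gauge_group G" "B \<in> generated G \<longrightarrow> A \<in> generated G" "B $ j $ k = 0"
          "\<exists>r\<ge>0. B $ k $ k = complex_of_real r"
          "\<And>a b. a \<noteq> k \<Longrightarrow> a \<noteq> j \<Longrightarrow> B $ a $ b = A $ a $ b"
          "\<And>b. A $ k $ b = 0 \<Longrightarrow> A $ j $ b = 0 \<Longrightarrow> B $ k $ b = 0 \<and> B $ j $ b = 0"
          using eliminate_entry[of k j A G k] j(2) A(1) by blast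
        have "B $ a $ b = (if a = b then 1 else 0) \<and> B $ b $ a = (if a = b then 1 else 0)" if a: "a \<notin> S" for a b
        proof -
          have A': "A $ a $ b = (if a = b then 1 else 0)" "A $ b $ a = (if a = b then 1 else 0)" for b
            using A(2) a unfolding fixes_outside_def by auto
          have ne: "a \<noteq> k" "a \<noteq> j" using a j kl by auto
          then have "B $ k $ a = 0 \<and> B $ j $ a = 0" using B(6)[of a] A' by auto
          then show ?thesis using ne A' B(5)[of a b] B(5)[of b a] by (cases "b = k"; cases "b = j"; simp)
        qed
        then have "fixes_outside S B" unfolding fixes_outside_def by blast
        then show ?thesis using B by blast
      qed
      \<comment> \<open>\<open>T\<close> collects the rows still to be cleared in column
        \<open>k\<close>.\<close>
      have "A \<in> generated G"
        if "T \<subseteq> S - {k}" "A \<in> gauge_group G" "fixes_outside S A" "\<forall>a\<in>S - {k} - T. A $ a $ k = 0"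
        for T and A :: "complex^'n^'n"
      proof -
        have "finite T" by simp
        then show ?thesis using that
        proof (induction T arbitrary: A rule: finite_induct)
          case empty
          \<comment> \<open>The column is already clear off the diagonal. Eliminating once more
            against \<open>l\<close> makes the diagonal entry real and nonnegative, and the unit
            norm of the column then forces it to be 1.\<close>
          obtain B r where B: "B \<in> gauge_group G" "B \<in> generated G \<longrightarrow> A \<in> generated G" "fixes_outside S B"
            "B $ l $ k = 0" "r \<ge> 0" "B $ k $ k = complex_of_real r"
            "\<And>a. a \<noteq> k \<Longrightarrow> a \<noteq> l \<Longrightarrow> B $ a $ k = A $ a $ k"
            using elim[of l A] kl empty by blast
          have col: "B $ a $ k = 0" if "a \<noteq> k" for a
          proof (cases "a \<in> S")
            case True then show ?thesis using B empty that by (cases "a = l") auto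
          next
            case False then show ?thesis using B(3) that unfolding fixes_outside_def by auto
          qed
          have "(\<Sum>a\<in>UNIV. (cmod (B $ a $ k))\<^sup>2) = (\<Sum>a\<in>UNIV. if a = k then r\<^sup>2 else 0)"
            using col B by (intro sum.cong) auto
          then have "r\<^sup>2 = 1" using unitary_column_norm[of B k] B(1) by (simp add: gauge_group_iff)
          then have kk: "B $ k $ k = 1" using B by (simp add: power2_eq_1_iff)
          \<comment> \<open>The row has unit norm too, so its other entries vanish.\<close>
          have "(\<Sum>b\<in>UNIV. (cmod (B $ k $ b))\<^sup>2) = 1"
            using unitary_column_norm[of "cadjoint B" k] B(1) by (simp add: gauge_group_iff)
          then have "(\<Sum>b\<in>UNIV - {k}. (cmod (B $ k $ b))\<^sup>2) = 0"
            by (subst (asm) sum.remove[of _ k]) (auto simp: kk)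
          then have row: "B $ k $ b = 0" if "b \<noteq> k" for b
            using that by (subst (asm) sum_nonneg_eq_0_iff) auto
          have "fixes_outside (S - {k}) B"
            using B(3) col row kk unfolding fixes_outside_def by auto
          then have "B \<in> generated G" using psubset.IH[of "S - {k}" B] B(1) kl by blast
          then show ?case using B(2) by blast
        next
          case (insert j T)
          obtain B where B: "B \<in> gauge_group G" "B \<in> generated G \<longrightarrow> A \<in> generated G" "fixes_outside S B"
            "B $ j $ k = 0" "\<And>a. a \<noteq> k \<Longrightarrow> a \<noteq> j \<Longrightarrow> B $ a $ k = A $ a $ k"
            using elim[of j A] insert.prems by blast
          have "\<forall>a\<in>S - {k} - T. B $ a $ k = 0"
            using B insert.prems by (metis DiffE DiffI insertE insertI1 singletonI)
          then have "B \<in> generated G" using insert B by auto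
          then show ?case using B(2) by blast
        qed
      qed
      from this[of "S - {k}" A] psubset.prems show ?thesis by auto
    qed
  qed
qed

lemma gauge_group_generated: "A \<in> gauge_group G \<Longrightarrow> A \<in> generated G"
  by (rule gauge_group_generated_aux[of A G UNIV]) (auto simp: fixes_outside_def)

section \<open>The Ricci curvature of the gauge groups\<close>

lemma munit_inner: "munit z i j \<bullet> M = Re (cnj z * M $ i $ j)"
proof -
  have "munit z i j \<bullet> M = (\<Sum>a\<in>UNIV. \<Sum>b\<in>UNIV. munit z i j $ a $ b \<bullet> M $ a $ b)"
    by (simp add: inner_vec_def)
  also have "\<dots> = (\<Sum>a\<in>UNIV. if a = i then \<Sum>b\<in>UNIV. if b = j then z \<bullet> M $ i $ j else 0 else 0)"
    by (intro sum.cong) (auto simp: munit_nth if_distrib[of "\<lambda>x. x \<bullet> _"] cong: if_cong)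
  finally show ?thesis by (simp add: inner_complex_def)
qed

lemma mul_munit_nth: "((M :: complex^'n^'n) ** munit z i j) $ a $ b = (if b = j then M $ a $ i * z else 0)"
proof -
  have "(M ** munit z i j) $ a $ b = (\<Sum>m\<in>UNIV. M $ a $ m * munit z i j $ m $ b)"
    by (simp add: matrix_matrix_mult_def)
  also have "\<dots> = (\<Sum>m\<in>UNIV. if m = i then (if b = j then M $ a $ i * z else 0) else 0)"
    by (intro sum.cong) (auto simp: munit_nth)
  finally show ?thesis by simp
qed

lemma sum_Basis_matrix:
  "(\<Sum>\<beta>\<in>(Basis :: (complex^'n^'n) set). F \<beta>) = (\<Sum>i\<in>UNIV. \<Sum>j\<in>UNIV. F (munit 1 i j) + F (munit \<i> i j))"
proof -
  let ?g = "\<lambda>(i, j, z). munit z i j :: complex^'n^'n"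
  have axis: "axis i (axis j z) = munit z i j" for i j and z :: complex
    by (auto simp: vec_eq_iff munit_nth axis_def)
  have eq: "(Basis :: (complex^'n^'n) set) = ?g ` (UNIV \<times> UNIV \<times> {1, \<i>})"
    by (auto simp: Basis_vec_def Basis_complex_def axis image_iff) blast+
  have inj: "inj_on ?g (UNIV \<times> UNIV \<times> {1, \<i>})"
  proof (rule inj_onI)
    fix x y assume xy: "x \<in> UNIV \<times> UNIV \<times> {1, \<i>}" "y \<in> UNIV \<times> UNIV \<times> {1, \<i>}" "?g x = ?g y"
    obtain i j z i' j' z' where x: "x = (i, j, z)" and y: "y = (i', j', z')" by (metis prod_cases3)
    have z: "z \<noteq> 0" using xy(1) x by auto
    have "munit z' i' j' $ i $ j = (munit z i j :: complex^'n^'n) $ i $ j" using xy(3) x y by simp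
    then have "munit z' i' j' $ i $ j = z" by (simp only: munit_nth refl simp_thms if_True)
    then show "x = y" using z x y by (auto simp: munit_nth split: if_splits)
  qed
  have "(\<Sum>\<beta>\<in>(Basis :: (complex^'n^'n) set). F \<beta>) = (\<Sum>(i, j, z)\<in>UNIV \<times> UNIV \<times> {1, \<i>}. F (munit z i j))"
    unfolding eq sum.reindex[OF inj] by (intro sum.cong) auto
  also have "\<dots> = (\<Sum>i\<in>UNIV. \<Sum>j\<in>UNIV. \<Sum>z\<in>{1, \<i>}. F (munit z i j))"
    by (simp only: sum.cartesian_product)
  finally show ?thesis by simp
qed

text \<open>Opposite in sign to the usual adjoint action, which quadratic expressions do not
  see.\<close>

definition ad :: "complex^'n^'n \<Rightarrow> complex^'n^'n \<Rightarrow> complex^'n^'n" where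
  "ad v X = X ** v - v ** X"

lemma linear_ad: "linear (ad v)"
  by (rule linearI) (simp_all add: ad_def matrix_mul_linear algebra_simps)

lemma ad_inner:
  assumes "cadjoint v = - v"
  shows "ad v X \<bullet> ad v Y = 2 * (X \<bullet> (v ** Y ** v)) - X \<bullet> (Y ** (v ** v)) - X \<bullet> (v ** v ** Y)"
proof -
  have "(X ** v) \<bullet> (Y ** v) = - (X \<bullet> (Y ** (v ** v)))" "(X ** v) \<bullet> (v ** Y) = - (X \<bullet> (v ** Y ** v))"
    "(v ** X) \<bullet> (Y ** v) = - (X \<bullet> (v ** Y ** v))" "(v ** X) \<bullet> (v ** Y) = - (X \<bullet> (v ** v ** Y))"
    by (simp_all add: inner_matrix_mul_right[of X v] inner_matrix_mul_left[of v X] assms matrix_mul_linear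
        matrix_mul_assoc)
  then show ?thesis unfolding ad_def by (simp add: inner_diff_left inner_diff_right)
qed

lemma skew_trace_square: "cadjoint v = - v \<Longrightarrow> Re (trace (v ** v)) = - (norm v)\<^sup>2"
  using hs_inner_eq_inner[of v v] unfolding hs_inner_def
  by (simp add: matrix_mul_linear power2_norm_eq_inner trace_def sum_negf)

lemma trace_product: "trace v * trace w = (\<Sum>i\<in>UNIV. \<Sum>j\<in>UNIV. v $ i $ i * w $ j $ j)"
  by (simp add: trace_def sum_product)

text \<open>Summing \<open>ad_inner\<close> over the matrix units leaves 2 Re (tr v)^2 - 2 N Re tr
  (v^2), and skewness gives Re tr (v^2) = -|v|^2. A unimodular \<open>z\<close> covers real and
  imaginary units.\<close>

lemma sum_ad_munit:
  fixes v :: "complex^'n^'n"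
  assumes "cadjoint v = - v" "trace v = 0" "cmod z = 1"
  shows "(\<Sum>i\<in>UNIV. \<Sum>j\<in>UNIV. ad v (munit z i j) \<bullet> ad v (munit z i j)) = 2 * real CARD('n) * (norm v)\<^sup>2"
proof -
  have z: "cnj z * z = 1" using assms(3) by (simp add: complex_norm_square[symmetric] mult.commute)
  have trm: "ad v (munit z i j) \<bullet> ad v (munit z i j) =
      2 * Re (v $ i $ i * v $ j $ j) - Re ((v ** v) $ j $ j) - Re ((v ** v) $ i $ i)" for i j
  proof -
    have "(v ** munit z i j ** v) $ i $ j = z * (v $ i $ i * v $ j $ j)"
    proof -
      have "(v ** munit z i j ** v) $ i $ j = (\<Sum>m\<in>UNIV. if m = j then v $ i $ i * z * v $ j $ j else 0)"
        by (simp add: matrix_matrix_mult_def[of "v ** munit z i j"] mul_munit_nth if_distrib[of "\<lambda>x. x * _"] cong: if_cong)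
      then show ?thesis by simp
    qed
    moreover have "cnj z * (z * w) = w" for w unfolding mult.assoc[symmetric] z by simp
    moreover have "cnj z * (w * z) = w" for w unfolding mult.left_commute[of "cnj z"] z by simp
    ultimately show ?thesis
      unfolding ad_inner[OF assms(1)] munit_inner munit_mul_nth mul_munit_nth by (simp only: refl if_True)
  qed
  have "(\<Sum>i\<in>UNIV. \<Sum>j\<in>UNIV. ad v (munit z i j) \<bullet> ad v (munit z i j)) =
      2 * Re (trace v * trace v) - 2 * real CARD('n) * Re (trace (v ** v))"
    unfolding trm trace_product
    by (simp add: sum_subtractf sum_distrib_left trace_def sum_negf mult.assoc)
  then show ?thesis using assms by (simp add: skew_trace_square)
qed

text \<open>These are the cross terms for the antisymmetrised units E_ij - E_ji: 2 |v|^2 comes from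
  the mixed products and another 2 |v|^2 from -2 Re tr (v^2).\<close>

lemma sum_ad_munit_transpose:
  fixes v :: "complex^'n^'n"
  assumes "cadjoint v = - v" "\<And>i j. Im (v $ i $ j) = 0"
  shows "(\<Sum>i\<in>UNIV. \<Sum>j\<in>UNIV. ad v (munit 1 i j) \<bullet> ad v (munit 1 j i)) = 4 * (norm v)\<^sup>2"
proof -
  have trm: "ad v (munit 1 i j) \<bullet> ad v (munit 1 j i) =
      2 * (Re (v $ i $ j))\<^sup>2 - (if j = i then 2 * Re ((v ** v) $ i $ i) else 0)" for i j
  proof -
    have "(v ** munit 1 j i ** v) $ i $ j = v $ i $ j * v $ i $ j"
    proof -
      have "(v ** munit 1 j i ** v) $ i $ j = (\<Sum>m\<in>UNIV. if m = i then v $ i $ j * v $ i $ j else 0)"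
        by (simp add: matrix_matrix_mult_def[of "v ** munit 1 j i"] mul_munit_nth if_distrib[of "\<lambda>x. x * _"] cong: if_cong)
      then show ?thesis by simp
    qed
    then show ?thesis
      unfolding ad_inner[OF assms(1)] munit_inner using assms(2)
      by (simp add: munit_mul_nth mul_munit_nth power2_eq_square)
  qed
  have norm: "(\<Sum>i\<in>UNIV. \<Sum>j\<in>UNIV. (Re (v $ i $ j))\<^sup>2) = (norm v)\<^sup>2"
    unfolding power2_norm_eq_inner inner_vec_def inner_complex_def using assms(2) by (simp add: power2_eq_square)
  have "(\<Sum>i\<in>UNIV. \<Sum>j\<in>UNIV. ad v (munit 1 i j) \<bullet> ad v (munit 1 j i)) =
      2 * (norm v)\<^sup>2 - 2 * Re (trace (v ** v))"
    unfolding trm norm[symmetric] by (simp add: sum_subtractf sum_distrib_left trace_def)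
  then show ?thesis using assms by (simp add: skew_trace_square)
qed

section \<open>Orthonormal bases of the Lie algebra and the Ricci constant\<close>

locale lie_basis =
  fixes G :: gauge_type and B :: "(complex^'n^'n) set"
  assumes B_sub: "B \<subseteq> lie_algebra G" and B_orth: "pairwise orthogonal B"
    and B_norm: "\<And>x. x \<in> B \<Longrightarrow> norm x = 1" and B_span: "span B = lie_algebra G" and finite_B [simp, intro]: "finite B"
begin

lemma B_inner: "b \<in> B \<Longrightarrow> b' \<in> B \<Longrightarrow> b \<bullet> b' = (if b = b' then 1 else 0)"
  using B_orth B_norm by (auto simp: pairwise_def orthogonal_def norm_eq_1)

lemma expansion:
  assumes "v \<in> lie_algebra G"
  shows "(\<Sum>b\<in>B. (v \<bullet> b) *\<^sub>R b) = v"
proof -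
  have "v \<in> span B" using assms B_span by simp
  then obtain a where v: "v = (\<Sum>b\<in>B. a b *\<^sub>R b)" using span_finite[OF finite_B] by auto
  have "v \<bullet> b = a b" if "b \<in> B" for b
  proof -
    have "v \<bullet> b = (\<Sum>b'\<in>B. if b' = b then a b else 0)"
      unfolding v inner_sum_left using that by (intro sum.cong) (auto simp: B_inner)
    then show ?thesis using that by simp
  qed
  then show ?thesis using v by simp
qed

lemma parseval:
  assumes "v \<in> lie_algebra G"
  shows "(\<Sum>b\<in>B. (v \<bullet> b) * (w \<bullet> b)) = v \<bullet> w"
proof -
  have "(\<Sum>b\<in>B. (v \<bullet> b) * (w \<bullet> b)) = (\<Sum>b\<in>B. (v \<bullet> b) *\<^sub>R b) \<bullet> w"
    unfolding inner_sum_left by (intro sum.cong) (simp_all add: inner_commute)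
  then show ?thesis using expansion[OF assms] by simp
qed

lemma bessel: "(\<Sum>b\<in>B. (v \<bullet> b)\<^sup>2) \<le> (norm v)\<^sup>2"
proof -
  let ?p = "\<Sum>b\<in>B. (v \<bullet> b) *\<^sub>R b"
  have p: "?p \<in> lie_algebra G"
    using B_sub subspace_lie_algebra[of G] by (intro subspace_sum subspace_scale) auto
  have pv: "?p \<bullet> v = (\<Sum>b\<in>B. (v \<bullet> b)\<^sup>2)" 
    unfolding inner_sum_left by (intro sum.cong) (simp_all add: power2_eq_square inner_commute)
  have pb: "?p \<bullet> b = v \<bullet> b" if "b \<in> B" for b
  proof -
    have "?p \<bullet> b = (\<Sum>b'\<in>B. if b' = b then v \<bullet> b else 0)"
      unfolding inner_sum_left using that by (intro sum.cong) (auto simp: B_inner)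
    then show ?thesis using that by simp
  qed
  have pp: "?p \<bullet> ?p = (\<Sum>b\<in>B. (v \<bullet> b)\<^sup>2)"
    using parseval[OF p, of ?p] pb by (simp add: power2_eq_square)
  have "0 \<le> (v - ?p) \<bullet> (v - ?p)" by simp
  also have "\<dots> = v \<bullet> v - (\<Sum>b\<in>B. (v \<bullet> b)\<^sup>2)"
    using pv pp by (simp add: inner_diff_left inner_diff_right inner_commute)
  finally show ?thesis by (simp add: power2_norm_eq_inner)
qed

text \<open>The squared Hilbert-Schmidt norm of \<open>T\<close> on the Lie algebra does not depend
  on the orthonormal basis. As \<open>p\<close> is the orthogonal projection,
  \<open>p \<beta>\<close> has coordinates \<open>\<beta> \<bullet> b\<close>, and Parseval over
  \<open>Basis\<close> keeps only diagonal terms. Thus the abstract \<open>B\<close> gives way to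
  projected matrix units.\<close>

lemma sum_basis_eq_sum_projection:
  assumes T: "linear T" and p: "\<And>\<beta>. \<beta> \<in> Basis \<Longrightarrow> p \<beta> \<in> lie_algebra G"
    and orth: "\<And>\<beta> Y. \<beta> \<in> Basis \<Longrightarrow> Y \<in> lie_algebra G \<Longrightarrow> p \<beta> \<bullet> Y = \<beta> \<bullet> Y"
  shows "(\<Sum>b\<in>B. T b \<bullet> T b) = (\<Sum>\<beta>\<in>Basis. T (p \<beta>) \<bullet> (T (p \<beta>) :: complex^'n^'n))"
proof -
  interpret T: linear T by fact
  have "T (p \<beta>) \<bullet> T (p \<beta>) = (\<Sum>b\<in>B. \<Sum>b'\<in>B. (\<beta> \<bullet> b) * (\<beta> \<bullet> b') * (T b \<bullet> T b'))" if \<beta>: "\<beta> \<in> Basis" for \<beta>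
  proof -
    have "p \<beta> = (\<Sum>b\<in>B. (p \<beta> \<bullet> b) *\<^sub>R b)" using expansion[OF p[OF \<beta>]] by simp
    also have "\<dots> = (\<Sum>b\<in>B. (\<beta> \<bullet> b) *\<^sub>R b)" using orth[OF \<beta>] B_sub by (intro sum.cong) auto
    finally have "T (p \<beta>) = (\<Sum>b\<in>B. (\<beta> \<bullet> b) *\<^sub>R T b)" by (simp add: T.sum T.scaleR)
    then show ?thesis by (simp add: inner_sum_left inner_sum_right sum_distrib_left mult_ac) (simp add: inner_commute)
  qed
  then have "(\<Sum>\<beta>\<in>Basis. T (p \<beta>) \<bullet> T (p \<beta>)) = (\<Sum>\<beta>\<in>Basis. \<Sum>b\<in>B. \<Sum>b'\<in>B. (\<beta> \<bullet> b) * (\<beta> \<bullet> b') * (T b \<bullet> T b'))"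
    by simp
  also have "\<dots> = (\<Sum>b\<in>B. \<Sum>\<beta>\<in>Basis. \<Sum>b'\<in>B. (\<beta> \<bullet> b) * (\<beta> \<bullet> b') * (T b \<bullet> T b'))"
    by (rule sum.swap)
  also have "\<dots> = (\<Sum>b\<in>B. \<Sum>b'\<in>B. \<Sum>\<beta>\<in>Basis. (\<beta> \<bullet> b) * (\<beta> \<bullet> b') * (T b \<bullet> T b'))"
    by (rule sum.cong[OF refl], rule sum.swap)
  also have "\<dots> = (\<Sum>b\<in>B. \<Sum>b'\<in>B. (\<Sum>\<beta>\<in>Basis. (b \<bullet> \<beta>) * (b' \<bullet> \<beta>)) * (T b \<bullet> T b'))"
    by (simp add: sum_distrib_right inner_commute)
  also have "\<dots> = (\<Sum>b\<in>B. \<Sum>b'\<in>B. if b' = b then T b \<bullet> T b else 0)"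
    by (intro sum.cong refl) (auto simp: euclidean_inner[symmetric] B_inner)
  finally show ?thesis by simp
qed

lemma sum_ad_basis:
  assumes v: "v \<in> lie_algebra G"
  shows "(\<Sum>b\<in>B. ad v b \<bullet> ad v b) =
    (case G of SO \<Rightarrow> real CARD('n) - 2 | SU \<Rightarrow> 2 * real CARD('n)) * (norm v)\<^sup>2"
proof (cases G)
  case SO
  have skew: "cadjoint v = - v" and tr: "trace v = 0" and re: "\<And>i j. Im (v $ i $ j) = 0"
    using v SO by (auto simp: lie_algebra_def)
  have re1: "Im ((munit 1 i j :: complex^'n^'n) $ a $ b) = 0" for i j a b by (rule Im_munit_1)
  \<comment> \<open>The projection to real skew-symmetric matrices: the average of
    \<open>\<beta>\<close>, its conjugate and the negatives of its adjoint and transpose.\<close>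
  define p :: "complex^'n^'n \<Rightarrow> complex^'n^'n" where
    "p \<beta> = (1/4) *\<^sub>R (\<beta> - cadjoint \<beta> + (\<chi> i j. cnj (\<beta> $ i $ j)) - (\<chi> i j. \<beta> $ j $ i))" for \<beta>
  have p1: "p (munit 1 i j) = (1/2) *\<^sub>R (munit 1 i j - munit 1 j i)" for i j
  proof -
    have "(\<chi> a b. cnj (munit 1 i j $ a $ b)) = (munit 1 i j :: complex^'n^'n)"
      "(\<chi> a b. munit 1 i j $ b $ a) = (munit 1 j i :: complex^'n^'n)"
      by (auto simp: vec_eq_iff munit_nth)
    then show ?thesis by (simp add: p_def cadjoint_munit scaleR_right_diff_distrib scaleR_add_right flip: scaleR_left_distrib)
  qed
  have p2: "p (munit \<i> i j) = 0" for i j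
  proof -
    have "(\<chi> a b. cnj (munit \<i> i j $ a $ b)) = (munit (- \<i>) i j :: complex^'n^'n)"
      "(\<chi> a b. munit \<i> i j $ b $ a) = (munit \<i> j i :: complex^'n^'n)"
      by (auto simp: vec_eq_iff munit_nth)
    then show ?thesis by (simp add: p_def cadjoint_munit munit_uminus)
  qed
  have basis: "\<exists>i j. \<beta> = munit 1 i j \<or> \<beta> = munit \<i> i j" if "\<beta> \<in> Basis" for \<beta> :: "complex^'n^'n"
  proof -
    have axis: "axis i (axis j z) = munit z i j" for i j :: 'n and z :: complex
      by (auto simp: vec_eq_iff munit_nth axis_def)
    show ?thesis using that by (auto simp: Basis_vec_def Basis_complex_def axis)
  qed
  have "(\<Sum>b\<in>B. ad v b \<bullet> ad v b) = (\<Sum>\<beta>\<in>Basis. ad v (p \<beta>) \<bullet> ad v (p \<beta>))"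
  proof (rule sum_basis_eq_sum_projection[OF linear_ad])
    fix \<beta> :: "complex^'n^'n" assume "\<beta> \<in> Basis"
    then consider i j where "\<beta> = munit 1 i j" | i j where "\<beta> = munit \<i> i j" using basis by blast
    note cases = this
    show "p \<beta> \<in> lie_algebra G"
    proof (cases rule: cases)
      case (1 i j)
      have "munit 1 i j - munit 1 j i \<in> lie_algebra G"
        using re1 by (auto simp: lie_algebra_def cadjoint_linear cadjoint_munit trace_sub trace_munit)
      then show ?thesis unfolding 1 p1 by (rule subspace_scale[OF subspace_lie_algebra])
    qed (simp add: p2 subspace_0[OF subspace_lie_algebra])
    fix Y :: "complex^'n^'n" assume Y: "Y \<in> lie_algebra G"
    then have Yre: "Im (Y $ i $ j) = 0" and skewY: "cadjoint Y = - Y" for i j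
      using SO by (auto simp: lie_algebra_def)
    have Y': "Re (Y $ j $ i) = - Re (Y $ i $ j)" for i j
      using arg_cong[OF skewY, of "\<lambda>M. Re (M $ i $ j)"] by simp
    show "p \<beta> \<bullet> Y = \<beta> \<bullet> Y"
    proof (cases rule: cases)
      case (1 i j)
      show ?thesis unfolding 1 p1 by (simp only: inner_scaleR_left inner_diff_left munit_inner complex_cnj_one mult_1 Y'[of i j]) simp
    next
      case (2 i j)
      then show ?thesis using Yre[of i j] by (simp add: p2 munit_inner)
    qed
  qed
  also have "\<dots> = (\<Sum>i\<in>UNIV. \<Sum>j\<in>UNIV. ad v ((1/2) *\<^sub>R (munit 1 i j - munit 1 j i)) \<bullet> ad v ((1/2) *\<^sub>R (munit 1 i j - munit 1 j i)))"
    unfolding sum_Basis_matrix p1 p2 by (simp add: linear_0[OF linear_ad])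
  also have "\<dots> = (\<Sum>i\<in>UNIV. \<Sum>j\<in>UNIV. (1/4) * (ad v (munit 1 i j) \<bullet> ad v (munit 1 i j))
      + (1/4) * (ad v (munit 1 j i) \<bullet> ad v (munit 1 j i)) - (1/2) * (ad v (munit 1 i j) \<bullet> ad v (munit 1 j i)))"
    by (simp add: linear_cmul[OF linear_ad] linear_diff[OF linear_ad] inner_diff_left inner_diff_right inner_commute
        add_divide_distrib diff_divide_distrib)
  also have "\<dots> = (1/4) * (\<Sum>i\<in>UNIV. \<Sum>j\<in>UNIV. ad v (munit 1 i j) \<bullet> ad v (munit 1 i j))
      + (1/4) * (\<Sum>i\<in>UNIV. \<Sum>j\<in>UNIV. ad v (munit 1 j i) \<bullet> ad v (munit 1 j i))
      - (1/2) * (\<Sum>i\<in>UNIV. \<Sum>j\<in>UNIV. ad v (munit 1 i j) \<bullet> ad v (munit 1 j i))"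
    by (simp only: sum.distrib sum_subtractf sum_distrib_left)
  also have "(\<Sum>i\<in>UNIV. \<Sum>j\<in>UNIV. ad v (munit 1 j i) \<bullet> ad v (munit 1 j i)) = (\<Sum>i\<in>UNIV. \<Sum>j\<in>UNIV. ad v (munit 1 i j) \<bullet> ad v (munit 1 i j))"
    by (rule sum.swap)
  \<comment> \<open>The constant is 2N/4 + 2N/4 - 4/2 = N - 2.\<close>
  finally show ?thesis
    using SO by (simp add: sum_ad_munit[OF skew tr, of 1] sum_ad_munit_transpose[OF skew re] algebra_simps)
next
  case SU
  have skew: "cadjoint v = - v" and tr: "trace v = 0"
    using v by (auto simp: lie_algebra_def)
  \<comment> \<open>\<open>J\<close> is \<i> times the identity. It is central, so subtracting a
    multiple of it makes \<open>p \<beta>\<close> traceless without affecting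
    \<open>ad v\<close>.\<close>
  define J :: "complex^'n^'n" where "J = (\<chi> i j. if i = j then \<i> else 0)"
  have J_left: "(J ** M) $ a $ b = \<i> * M $ a $ b" for M :: "complex^'n^'n" and a b
  proof -
    have "(J ** M) $ a $ b = (\<Sum>m\<in>UNIV. J $ a $ m * M $ m $ b)"
      by (simp add: matrix_matrix_mult_def)
    also have "\<dots> = (\<Sum>m\<in>UNIV. if m = a then \<i> * M $ a $ b else 0)"
      by (intro sum.cong) (auto simp: J_def)
    finally show ?thesis by simp
  qed
  have J_right: "(M ** J) $ a $ b = \<i> * M $ a $ b" for M :: "complex^'n^'n" and a b
  proof -
    have "(M ** J) $ a $ b = (\<Sum>m\<in>UNIV. M $ a $ m * J $ m $ b)"
      by (simp add: matrix_matrix_mult_def)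
    also have "\<dots> = (\<Sum>m\<in>UNIV. if m = b then \<i> * M $ a $ b else 0)"
      by (intro sum.cong) (auto simp: J_def)
    finally show ?thesis by simp
  qed
  have J_comm: "J ** M = M ** J" for M :: "complex^'n^'n"
    by (simp add: vec_eq_iff J_left J_right)
  have J_adj: "cadjoint J = - J" and J_trace: "trace J = of_nat CARD('n) * \<i>"
    by (auto simp: J_def vec_eq_iff trace_def)
  have J_inner: "J \<bullet> Y = Im (trace Y)" for Y :: "complex^'n^'n"
  proof -
    have "J \<bullet> Y = (\<Sum>i\<in>UNIV. \<Sum>j\<in>UNIV. if j = i then Im (Y $ i $ j) else 0)"
      unfolding inner_vec_def by (intro sum.cong) (auto simp: J_def inner_complex_def)
    then show ?thesis by (simp add: trace_def)
  qed
  define p :: "complex^'n^'n \<Rightarrow> complex^'n^'n" where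
    "p \<beta> = (1/2) *\<^sub>R (\<beta> - cadjoint \<beta>) - (Im (trace \<beta>) / real CARD('n)) *\<^sub>R J" for \<beta>
  have ad_p: "ad v (p \<beta>) = (1/2) *\<^sub>R (ad v \<beta> - cadjoint (ad v \<beta>))" for \<beta>
    by (simp add: p_def ad_def cadjoint_linear cadjoint_matrix_mul matrix_mul_linear skew J_comm algebra_simps)
  have "(\<Sum>b\<in>B. ad v b \<bullet> ad v b) = (\<Sum>\<beta>\<in>Basis. ad v (p \<beta>) \<bullet> ad v (p \<beta>))"
  proof (rule sum_basis_eq_sum_projection[OF linear_ad])
    fix \<beta> :: "complex^'n^'n"
    have "trace (p \<beta>) = 0"
      by (simp add: p_def trace_sub trace_scaleR trace_cadjoint J_trace complex_eq_iff)
    then show "p \<beta> \<in> lie_algebra G"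
      using SU by (simp add: lie_algebra_def p_def cadjoint_linear J_adj algebra_simps)
    fix Y :: "complex^'n^'n" assume Y: "Y \<in> lie_algebra G"
    then have "cadjoint \<beta> \<bullet> Y = - (\<beta> \<bullet> Y)"
      using inner_cadjoint[of "cadjoint \<beta>" Y] by (simp add: lie_algebra_def)
    then show "p \<beta> \<bullet> Y = \<beta> \<bullet> Y"
      using Y by (simp add: p_def inner_diff_left J_inner lie_algebra_def)
  qed
  also have "\<dots> = (\<Sum>\<beta>\<in>Basis. (1/2) * (ad v \<beta> \<bullet> ad v \<beta>) - (1/2) * (ad v \<beta> \<bullet> cadjoint (ad v \<beta>)))"
    unfolding ad_p
    by (simp add: inner_diff_left inner_diff_right inner_cadjoint inner_commute diff_divide_distrib)
  also have "\<dots> = (1/2) * (\<Sum>\<beta>\<in>Basis. ad v \<beta> \<bullet> ad v \<beta>) - (1/2) * (\<Sum>\<beta>\<in>Basis. ad v \<beta> \<bullet> cadjoint (ad v \<beta>))"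
    by (simp only: sum_subtractf sum_distrib_left)
  \<comment> \<open>A matrix unit and its multiple by \<i> contribute opposite terms.\<close>
  also have "(\<Sum>\<beta>\<in>Basis. ad v \<beta> \<bullet> cadjoint (ad v \<beta>)) = 0"
  proof -
    have "munit \<i> i j = J ** munit 1 i j" for i j :: 'n
      by (simp add: vec_eq_iff J_left munit_nth)
    then have "ad v (munit \<i> i j) = J ** ad v (munit 1 i j)" for i j
      by (simp only: ad_def matrix_mul_linear J_comm[of v, symmetric] matrix_mul_assoc)
    moreover have "(J ** M) \<bullet> cadjoint (J ** M) = - (M \<bullet> cadjoint M)" for M :: "complex^'n^'n"
    proof -
      have JJ: "J ** J = - mat 1"
        by (simp add: vec_eq_iff J_left) (simp add: J_def mat_def)
      have "(J ** M) \<bullet> cadjoint (J ** M) = M \<bullet> (J ** J ** cadjoint M)"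
        by (simp add: inner_matrix_mul_left cadjoint_matrix_mul J_adj matrix_mul_linear J_comm[of "cadjoint M", symmetric])
          (simp add: matrix_mul_assoc)
      then show ?thesis by (simp add: JJ matrix_mul_linear)
    qed
    ultimately show ?thesis unfolding sum_Basis_matrix by simp
  qed
  also have "(\<Sum>\<beta>\<in>Basis. ad v \<beta> \<bullet> ad v \<beta>) = 4 * real CARD('n) * (norm v)\<^sup>2"
    unfolding sum_Basis_matrix sum.distrib by (simp add: sum_ad_munit[OF skew tr])
  finally show ?thesis using SU by simp
qed

text \<open>A skew factor moved to the other side of the inner product changes sign. This invariance
  makes the structure constants totally antisymmetric.\<close>

lemma bracket_inner_cyclic:
  assumes "X \<in> lie_algebra G" "Y \<in> lie_algebra G" "Z \<in> lie_algebra G"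
  shows "(X ** Y - Y ** X) \<bullet> Z = (Y ** Z - Z ** Y) \<bullet> X"
proof -
  have "(X ** Y) \<bullet> Z = - (X \<bullet> (Z ** Y))" "(Y ** X) \<bullet> Z = - (X \<bullet> (Y ** Z))"
    using assms by (simp_all add: inner_matrix_mul_right[of X Y] inner_matrix_mul_left[of Y X] lie_algebra_def
        matrix_mul_linear)
  then show ?thesis by (simp add: inner_diff_left inner_diff_right inner_commute)
qed

text \<open>The inner products \<open>\<langle>[b', b], v\<rangle> = \<langle>[b, v], b'\<rangle>\<close> are the coordinates of \<open>[b, v]\<close>.\<close>

lemma curvature_identity:
  assumes v: "v \<in> lie_algebra G"
  shows "(\<Sum>b\<in>B. \<Sum>b'\<in>B. ((b' ** b - b ** b') \<bullet> v)\<^sup>2) =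
    (case G of SO \<Rightarrow> real CARD('n) - 2 | SU \<Rightarrow> 2 * real CARD('n)) * (norm v)\<^sup>2"
proof -
  have "(\<Sum>b'\<in>B. ((b' ** b - b ** b') \<bullet> v)\<^sup>2) = ad v b \<bullet> ad v b" if b: "b \<in> B" for b
  proof -
    have bg: "b \<in> lie_algebra G" using b B_sub by auto
    then have "ad v b \<in> lie_algebra G" unfolding ad_def using v by (rule lie_algebra_bracket)
    moreover have "(b' ** b - b ** b') \<bullet> v = ad v b \<bullet> b'" if "b' \<in> B" for b'
      unfolding ad_def using that B_sub bg v by (intro bracket_inner_cyclic) auto
    ultimately show ?thesis using parseval[of "ad v b" "ad v b"] by (simp add: power2_eq_square)
  qed
  then show ?thesis using sum_ad_basis[OF v] by simp
qed

end

lemma lie_basis_exists: "\<exists>B. lie_basis G (B :: (complex^'n^'n) set)"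
proof -
  obtain B :: "(complex^'n^'n) set" where "B \<subseteq> lie_algebra G" "pairwise orthogonal B" "\<And>x. x \<in> B \<Longrightarrow> norm x = 1"
    "independent B" "card B = dim (lie_algebra G :: (complex^'n^'n) set)" "span B = lie_algebra G"
    using orthonormal_basis_subspace[OF subspace_lie_algebra[of G]] by metis
  then show ?thesis by (intro exI[of _ B]) (simp add: lie_basis_def independent_imp_finite)
qed

section \<open>Integration by parts against the product of Haar measures\<close>

definition single :: "'e \<Rightarrow> complex^'n^'n \<Rightarrow> 'e \<Rightarrow> complex^'n^'n" where
  "single e X = (\<lambda>e'. if e' = e then X else 0)"

locale haar_product =
  fixes G :: gauge_type and haar :: "(complex^'n^'n) measure" and E :: "'e set"
  assumes haar: "haar_prob (gauge_group G) haar" and finite_E [simp, intro]: "finite E"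
begin

abbreviation "\<nu> \<equiv> \<Pi>\<^sub>M e\<in>E. haar"

sublocale haar: prob_space haar
  using haar by (simp add: haar_prob_def)

lemma sets_haar: "sets haar = sets (restrict_space borel (gauge_group G))"
  using haar by (simp add: haar_prob_def)

lemma space_haar: "space haar = gauge_group G"
  using sets_eq_imp_space_eq[OF sets_haar] by (simp add: space_restrict_space)

lemma space_\<nu>: "space \<nu> = E \<rightarrow>\<^sub>E gauge_group G"
  by (simp add: space_PiM space_haar)

lemma borel_measurable_haar: 
  "continuous_on UNIV f \<Longrightarrow> (f :: complex^'n^'n \<Rightarrow> 'z::topological_space) \<in> borel_measurable haar"
  unfolding measurable_cong_sets[OF sets_haar refl]
  by (intro measurable_restrict_space1 borel_measurable_continuous_onI)

lemma left_mul_measurable: "A \<in> gauge_group G \<Longrightarrow> (\<lambda>B. A ** B) \<in> measurable haar haar"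
proof -
  assume A: "A \<in> gauge_group G"
  have "continuous_on UNIV (\<lambda>B::complex^'n^'n. A ** B)"
    by (rule linear_continuous_on) (simp only: linear_matrix_mul_right linear_conv_bounded_linear[symmetric])
  then show ?thesis
    unfolding measurable_cong_sets[OF refl sets_haar]
    by (intro measurable_restrict_space2 borel_measurable_haar)
      (auto simp: space_haar gauge_group_mul[OF A])
qed

lemma distr_left_mul: "A \<in> gauge_group G \<Longrightarrow> distr haar haar (\<lambda>B. A ** B) = haar"
  using haar by (simp add: haar_prob_def)

lemma prob_space_\<nu>: "prob_space \<nu>"
  by (intro prob_space_PiM haar.prob_space_axioms)

sublocale \<nu>: prob_space \<nu>
  by (rule prob_space_\<nu>)

lemma distr_translate:
  assumes A: "\<And>e. e \<in> E \<Longrightarrow> A e \<in> gauge_group G"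
  shows "distr \<nu> \<nu> (\<lambda>Q. \<lambda>e\<in>E. A e ** Q e) = \<nu>"
proof -
  interpret product_sigma_finite "\<lambda>_. haar" ..
  let ?T = "\<lambda>Q. \<lambda>e\<in>E. A e ** Q e"
  have T: "?T \<in> measurable \<nu> \<nu>"
    using A by (intro measurable_restrict measurable_compose[OF measurable_component_singleton] left_mul_measurable)
  show ?thesis
  proof (rule PiM_eqI)
    fix B assume B: "\<And>e. e \<in> E \<Longrightarrow> B e \<in> sets haar"
    let ?B' = "\<lambda>e. (\<lambda>M. A e ** M) -` B e \<inter> space haar"
    have B': "?B' e \<in> sets haar" if "e \<in> E" for e
      using A B that by (intro measurable_sets[OF left_mul_measurable]) auto
    have "?T -` (Pi\<^sub>E E B) \<inter> space \<nu> = Pi\<^sub>E E ?B'"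
      by (auto simp: space_PiM PiE_iff)
    then have "emeasure (distr \<nu> \<nu> ?T) (Pi\<^sub>E E B) = emeasure \<nu> (Pi\<^sub>E E ?B')"
      using T B by (subst emeasure_distr) (auto intro!: sets_PiM_I_finite)
    also have "\<dots> = (\<Prod>e\<in>E. emeasure haar (?B' e))"
      using B' by (intro emeasure_PiM) auto
    also have "\<dots> = (\<Prod>e\<in>E. emeasure haar (B e))"
    proof (rule prod.cong[OF refl])
      fix e assume e: "e \<in> E"
      then have "emeasure haar (B e) = emeasure (distr haar haar (\<lambda>M. A e ** M)) (B e)"
        using A by (simp add: distr_left_mul)
      also have "\<dots> = emeasure haar (?B' e)"
        using A B e by (intro emeasure_distr left_mul_measurable) auto
      finally show "emeasure haar (?B' e) = emeasure haar (B e)" ..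
    qed
    finally show "emeasure (distr \<nu> \<nu> ?T) (Pi\<^sub>E E B) = (\<Prod>e\<in>E. emeasure haar (B e))" .
  qed auto
qed

lemma update_in_space:
  assumes "Q \<in> space \<nu>" "e \<in> E" "A \<in> gauge_group G"
  shows "Q(e := A ** Q e) \<in> space \<nu>"
  using assms by (auto simp: space_\<nu> PiE_iff gauge_group_mul extensional_def)

lemma integral_translate:
  fixes F :: "('e \<Rightarrow> complex^'n^'n) \<Rightarrow> real"
  assumes e: "e \<in> E" and A: "A \<in> gauge_group G" and F: "F \<in> borel_measurable \<nu>"
  shows "(\<integral>Q. F (Q(e := A ** Q e)) \<partial>\<nu>) = (\<integral>Q. F Q \<partial>\<nu>)"
    and "(\<lambda>Q. F (Q(e := A ** Q e))) \<in> borel_measurable \<nu>"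
proof -
  let ?A = "\<lambda>e'. if e' = e then A else mat 1"
  let ?T = "\<lambda>Q. \<lambda>e\<in>E. ?A e ** Q e"
  have mem: "?A e' \<in> gauge_group G" for e' using A by simp
  have T: "?T \<in> measurable \<nu> \<nu>"
    by (intro measurable_restrict measurable_compose[OF measurable_component_singleton] left_mul_measurable mem)
  have eq: "Q(e := A ** Q e) = ?T Q" if "Q \<in> space \<nu>" for Q
    using that e by (auto simp: space_PiM PiE_iff extensional_def fun_eq_iff)
  have "(\<integral>Q. F Q \<partial>\<nu>) = (\<integral>Q. F Q \<partial>(distr \<nu> \<nu> ?T))"
    using distr_translate[of ?A] mem by simp
  also have "\<dots> = (\<integral>Q. F (?T Q) \<partial>\<nu>)" using T F by (rule integral_distr)
  also have "\<dots> = (\<integral>Q. F (Q(e := A ** Q e)) \<partial>\<nu>)"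
    using eq by (intro Bochner_Integration.integral_cong) auto
  finally show "(\<integral>Q. F (Q(e := A ** Q e)) \<partial>\<nu>) = (\<integral>Q. F Q \<partial>\<nu>)" ..
  have "(\<lambda>Q. F (?T Q)) \<in> borel_measurable \<nu>" using T F by (rule measurable_compose)
  then show "(\<lambda>Q. F (Q(e := A ** Q e))) \<in> borel_measurable \<nu>"
    using eq by (subst measurable_cong[where g = "\<lambda>Q. F (?T Q)"]) auto
qed

lemma polys_measurable [measurable, intro]: "f \<in> polys E \<Longrightarrow> f \<in> borel_measurable \<nu>"
proof (induction rule: polys.induct)
  case (polys_coord e Y)
  have "(\<lambda>M. M \<bullet> Y) \<in> borel_measurable haar"
    by (intro borel_measurable_haar continuous_intros)
  with measurable_component_singleton[OF polys_coord] show ?case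
    by (rule measurable_compose)
qed auto

lemma polys_bounded: "f \<in> polys E \<Longrightarrow> \<exists>C. \<forall>Q\<in>space \<nu>. \<bar>f Q\<bar> \<le> C"
proof (induction rule: polys.induct)
  case (polys_coord e Y)
  have "\<bar>Q e \<bullet> Y\<bar> \<le> norm (mat 1 :: complex^'n^'n) * norm Y" if "Q \<in> space \<nu>" for Q
  proof -
    have "Q e \<in> gauge_group G" using that polys_coord by (auto simp: space_\<nu>)
    then show ?thesis using Cauchy_Schwarz_ineq2[of "Q e" Y] norm_gauge_group[of "Q e" G] by simp
  qed
  then show ?case by blast
next
  case (polys_add f g)
  then obtain C C' where C: "\<And>Q. Q \<in> space \<nu> \<Longrightarrow> \<bar>f Q\<bar> \<le> C" and C': "\<And>Q. Q \<in> space \<nu> \<Longrightarrow> \<bar>g Q\<bar> \<le> C'" by blast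
  have "\<bar>f Q + g Q\<bar> \<le> C + C'" if "Q \<in> space \<nu>" for Q
    using C[OF that] C'[OF that] by linarith
  then show ?case by blast
next
  case (polys_mult f g)
  then obtain C C' where C: "\<And>Q. Q \<in> space \<nu> \<Longrightarrow> \<bar>f Q\<bar> \<le> C" and C': "\<And>Q. Q \<in> space \<nu> \<Longrightarrow> \<bar>g Q\<bar> \<le> C'" by blast
  have "\<bar>f Q * g Q\<bar> \<le> \<bar>C\<bar> * \<bar>C'\<bar>" if "Q \<in> space \<nu>" for Q
    unfolding abs_mult using C[OF that] C'[OF that] by (intro mult_mono) auto
  then show ?case by blast
qed auto

definition bdd :: "(('e \<Rightarrow> complex^'n^'n) \<Rightarrow> real) \<Rightarrow> bool" where
  "bdd f \<longleftrightarrow> (\<exists>C\<ge>0. \<forall>Q\<in>space \<nu>. \<bar>f Q\<bar> \<le> C)"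

lemma bdd_polys: "f \<in> polys E \<Longrightarrow> bdd f"
  unfolding bdd_def using polys_bounded[of f] by (meson abs_ge_self abs_ge_zero order.trans)

lemma bddE:
  assumes "bdd f"
  obtains C where "C \<ge> 0" "\<And>Q. Q \<in> space \<nu> \<Longrightarrow> \<bar>f Q\<bar> \<le> C"
  using assms unfolding bdd_def by auto

lemma integrable_bdd: "f \<in> borel_measurable \<nu> \<Longrightarrow> bdd f \<Longrightarrow> integrable \<nu> f"
  unfolding bdd_def by (elim exE conjE) (rule \<nu>.integrable_const_bound, auto intro!: AE_I2)

text \<open>Along the orbit the link variable solves M' = K M, so \<open>D\<close> at the moved
  configuration is the true derivative at every time, not only at 0.\<close>

lemma D_curve:
  assumes K: "generator G K" and f: "f \<in> polys E"
  shows "((\<lambda>t. f (Q(e := rodrigues K t ** Q e))) has_real_derivative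
    D (single e K) f (Q(e := rodrigues K t ** Q e))) (at t)"
  using f
proof (induction rule: polys.induct)
  case (polys_coord e' Y)
  show ?case
  proof (cases "e' = e")
    case True
    then show ?thesis
      using rodrigues_derivative[of K "Q e" Y t] K
      by (simp add: single_def generator_def inner_matrix_mul_left[of K])
  qed (simp add: single_def)
next
  case (polys_add f g)
  then show ?case unfolding D_add[OF polys_add.hyps] by (intro DERIV_add)
next
  case (polys_mult f g)
  then show ?case
    unfolding D_mult[OF polys_mult.hyps]
    by (intro DERIV_cong[OF DERIV_mult[OF polys_mult.IH]]) (simp only: mult.commute)
qed simp

text \<open>By translation invariance every difference quotient along the orbit integrates to 0. The
  mean value theorem bounds the quotients by the bound of \<open>F'\<close>, and dominated
  convergence passes to the limit.\<close>

lemma integral_derivative_zero: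
  assumes K: "generator G K" and e: "e \<in> E"
    and deriv: "\<And>Q t. ((\<lambda>t. F (Q(e := rodrigues K t ** Q e))) has_real_derivative
      F' (Q(e := rodrigues K t ** Q e))) (at t)"
    and meas: "F \<in> borel_measurable \<nu>" "F' \<in> borel_measurable \<nu>" and bdd: "bdd F" "bdd F'"
  shows "(\<integral>Q. F' Q \<partial>\<nu>) = 0"
proof -
  define H where "H Q t = F (Q(e := rodrigues K t ** Q e))" for Q t
  have mem: "rodrigues K t \<in> gauge_group G" for t using K by (simp add: generator_def)
  have H0: "H Q 0 = F Q" for Q by (simp add: H_def)
  have int: "integrable \<nu> F" "integrable \<nu> (\<lambda>Q. H Q t)" for t
  proof -
    have "bdd (\<lambda>Q. H Q t)" using bdd(1) update_in_space[OF _ e mem[of t]] unfolding bdd_def H_def by meson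
    then show "integrable \<nu> F" "integrable \<nu> (\<lambda>Q. H Q t)"
      using integrable_bdd[OF meas(1) bdd(1)] integrable_bdd[OF integral_translate(2)[OF e mem[of t] meas(1)]]
      unfolding H_def by blast+
  qed
  obtain C where C: "\<And>Q. Q \<in> space \<nu> \<Longrightarrow> \<bar>F' Q\<bar> \<le> C" using bdd(2) by (rule bddE) blast
  define s where "s n Q = (H Q (0 + inverse (real (Suc n))) - H Q 0) / inverse (real (Suc n))" for n Q
  have "(\<lambda>n. \<integral>Q. s n Q \<partial>\<nu>) \<longlonglongrightarrow> (\<integral>Q. F' Q \<partial>\<nu>)"
  proof (rule integral_dominated_convergence)
    have lim0: "filterlim (\<lambda>n. inverse (real (Suc n))) (at 0) sequentially"
      using LIMSEQ_inverse_real_of_nat by (intro filterlim_atI) auto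
    have "((\<lambda>h. (H Q (0 + h) - H Q 0) / h) \<longlongrightarrow> F' Q) (at 0)" for Q
      using deriv[of Q 0] by (simp add: H_def DERIV_def)
    from filterlim_compose[OF this lim0] show "AE Q in \<nu>. (\<lambda>n. s n Q) \<longlonglongrightarrow> F' Q"
      unfolding s_def by (intro AE_I2)
    show "AE Q in \<nu>. norm (s n Q) \<le> C" for n
    proof (rule AE_I2)
      fix Q assume Q: "Q \<in> space \<nu>"
      have "\<exists>z. 0 < z \<and> z < inverse (real (Suc n)) \<and> H Q (inverse (real (Suc n))) - H Q 0
          = (inverse (real (Suc n)) - 0) * F' (Q(e := rodrigues K z ** Q e))"
        by (rule MVT2) (use deriv in \<open>auto simp: H_def\<close>)
      then show "norm (s n Q) \<le> C" using C[OF update_in_space[OF Q e mem]] by (auto simp: s_def abs_mult)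
    qed
    show "s n \<in> borel_measurable \<nu>" for n unfolding s_def using int by measurable
  qed (use meas in auto)
  moreover have "(\<integral>Q. s n Q \<partial>\<nu>) = 0" for n
    using int integral_translate(1)[OF e mem meas(1)] by (simp add: s_def H0) (simp add: H_def)
  ultimately show ?thesis by (simp add: LIMSEQ_const_iff)
qed

lemma single_linear:
  "single e (X + Y) = (\<lambda>e'. single e X e' + single e Y e')"
  "single e (r *\<^sub>R X) = (\<lambda>e'. r *\<^sub>R single e X e')"
  "single e 0 = (\<lambda>e'. 0)"
  by (auto simp: single_def)

text \<open>For a generator the integrand is the derivative of \<open>f * exp (t * S)\<close> along
  its orbit. The integral is linear in \<open>X\<close>, and the generators span the Lie
  algebra.\<close>

lemma integration_by_parts:
  assumes X: "X \<in> lie_algebra G" and e: "e \<in> E" and f: "f \<in> polys E" and S: "S \<in> polys E"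
  shows "(\<integral>Q. (D (single e X) f Q + t * (f Q * D (single e X) S Q)) * exp (t * S Q) \<partial>\<nu>) = 0"
proof -
  let ?w = "\<lambda>Q. exp (t * S Q)"
  let ?F = "\<lambda>X Q. (D (single e X) f Q + t * (f Q * D (single e X) S Q)) * ?w Q"
  have u: "(\<lambda>Q. t * S Q) \<in> polys E" using S by auto
  have bddw: "bdd ?w"
  proof -
    obtain B where "\<And>Q. Q \<in> space \<nu> \<Longrightarrow> \<bar>t * S Q\<bar> \<le> B" using polys_bounded[OF u] by blast
    then show ?thesis unfolding bdd_def by (intro exI[of _ "exp B"]) (auto simp: abs_le_iff)
  qed
  have w: "?w \<in> borel_measurable \<nu>" using S by measurable
  have bdd_mult: "bdd (\<lambda>Q. g Q * ?w Q)" if g: "g \<in> polys E" for g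
  proof -
    obtain B where B: "B \<ge> 0" "\<And>Q. Q \<in> space \<nu> \<Longrightarrow> \<bar>g Q\<bar> \<le> B" using bdd_polys[OF g] by (rule bddE) blast
    obtain B' where B': "B' \<ge> 0" "\<And>Q. Q \<in> space \<nu> \<Longrightarrow> \<bar>?w Q\<bar> \<le> B'" using bddw by (rule bddE) blast
    show ?thesis unfolding bdd_def
    proof (intro exI[of _ "B * B'"] conjI ballI)
      fix Q assume "Q \<in> space \<nu>"
      with B B' show "\<bar>g Q * ?w Q\<bar> \<le> B * B'"
        unfolding abs_mult by (intro mult_mono) auto
    qed (use B B' in auto)
  qed
  have poly: "(\<lambda>Q. D (single e X) f Q + t * (f Q * D (single e X) S Q)) \<in> polys E" for X
    using f S by auto
  have int: "integrable \<nu> (?F X)" for X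
    by (rule integrable_bdd[OF borel_measurable_times[OF polys_measurable[OF poly] w] bdd_mult[OF poly]])
  have gen: "(\<integral>Q. ?F K Q \<partial>\<nu>) = 0" if K: "generator G K" for K
  proof (rule integral_derivative_zero[OF K e])
    show "((\<lambda>r. f (Q(e := rodrigues K r ** Q e)) * ?w (Q(e := rodrigues K r ** Q e))) has_real_derivative
        ?F K (Q(e := rodrigues K r ** Q e))) (at r)" for Q r
      by (auto intro!: derivative_eq_intros D_curve[OF K f] D_curve[OF K S] simp: algebra_simps)
    show "(\<lambda>Q. f Q * ?w Q) \<in> borel_measurable \<nu>" 
      by (rule borel_measurable_times[OF polys_measurable[OF f] w])
    show "?F K \<in> borel_measurable \<nu>" using int by (rule borel_measurable_integrable)
    show "bdd (\<lambda>Q. f Q * ?w Q)" by (rule bdd_mult[OF f])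
    show "bdd (?F K)" by (rule bdd_mult[OF poly])
  qed
  have "X \<in> span {K. generator G K}" using X lie_algebra_span by blast
  then show ?thesis
  proof (induction rule: span_induct)
    case base
    show ?case
      unfolding subspace_def
    proof (intro conjI ballI allI)
      show "0 \<in> {X. (\<integral>Q. ?F X Q \<partial>\<nu>) = 0}"
        using f S by (simp add: single_linear)
    next
      fix X Y assume *: "X \<in> {X. (\<integral>Q. ?F X Q \<partial>\<nu>) = 0}" "Y \<in> {X. (\<integral>Q. ?F X Q \<partial>\<nu>) = 0}"
      have "?F (X + Y) = (\<lambda>Q. ?F X Q + ?F Y Q)"
        using f S by (auto simp: single_linear D_vadd[where E = E] algebra_simps)
      then show "X + Y \<in> {X. (\<integral>Q. ?F X Q \<partial>\<nu>) = 0}"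
        using * int[of X] int[of Y] by simp
    next
      fix r :: real and X assume *: "X \<in> {X. (\<integral>Q. ?F X Q \<partial>\<nu>) = 0}"
      have "?F (r *\<^sub>R X) = (\<lambda>Q. r * ?F X Q)"
        using f S by (auto simp: single_linear D_vscaleR[where E = E] algebra_simps)
      then show "r *\<^sub>R X \<in> {X. (\<integral>Q. ?F X Q \<partial>\<nu>) = 0}" using * by simp
    qed
  next
    case (step X) then show ?case using gen by simp
  qed
qed

section \<open>Full support of the Haar measure and functions with vanishing gradient\<close>

lemma open_Int_in_sets: "open V \<Longrightarrow> V \<inter> gauge_group G \<in> sets haar"
  unfolding sets_haar sets_restrict_space Int_commute[of V] by (rule imageI) simp

text \<open>If the open set were null, so would be its translates, which cover the group; a
  countable subcover would make the whole group null.\<close>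

lemma haar_open_pos:
  assumes U: "open U" and A0: "A0 \<in> U" "A0 \<in> gauge_group G"
  shows "emeasure haar (U \<inter> gauge_group G) > 0"
proof (rule ccontr)
  assume "\<not> ?thesis"
  then have null: "emeasure haar (U \<inter> gauge_group G) = 0" by simp
  note meas = open_Int_in_sets
  \<comment> \<open>Left multiplication by \<open>A0 ** cadjoint A\<close> takes \<open>A\<close> to
    \<open>A0\<close>, so \<open>V A\<close> is a neighbourhood of \<open>A\<close>.\<close>
  define V where "V A = (\<lambda>M. (A0 ** cadjoint A) ** M) -` U" for A
  have openV: "open (V A)" for A
  proof -
    have "continuous_on UNIV (\<lambda>M::complex^'n^'n. (A0 ** cadjoint A) ** M)"
      by (rule linear_continuous_on) (simp only: linear_matrix_mul_right linear_conv_bounded_linear[symmetric])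
    then show ?thesis unfolding V_def using U by (simp add: continuous_on_open_vimage)
  qed
  have nullV: "V A \<inter> gauge_group G \<in> null_sets haar" if A: "A \<in> gauge_group G" for A
  proof -
    let ?B = "A0 ** cadjoint A"
    have B: "?B \<in> gauge_group G" using A A0 by (intro gauge_group_mul gauge_group_cadjoint)
    have "emeasure haar (U \<inter> gauge_group G) = emeasure (distr haar haar (\<lambda>M. ?B ** M)) (U \<inter> gauge_group G)"
      by (simp add: distr_left_mul[OF B])
    also have "\<dots> = emeasure haar ((\<lambda>M. ?B ** M) -` (U \<inter> gauge_group G) \<inter> space haar)"
      by (intro emeasure_distr left_mul_measurable[OF B] meas U)
    also have "(\<lambda>M. ?B ** M) -` (U \<inter> gauge_group G) \<inter> space haar = V A \<inter> gauge_group G"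
      using gauge_group_mul[OF B] by (auto simp: V_def space_haar)
    finally show ?thesis using null meas[OF openV] by auto
  qed
  obtain \<F> where \<F>: "\<F> \<subseteq> V ` gauge_group G" "countable \<F>" "\<Union>\<F> = \<Union>(V ` gauge_group G)"
    using Lindelof[of "V ` gauge_group G"] openV by blast
  have "A \<in> V A" if "A \<in> gauge_group G" for A
    using A0 that by (simp add: V_def gauge_group_iff flip: matrix_mul_assoc)
  then have "gauge_group G = (\<Union>W\<in>\<F>. W \<inter> gauge_group G)" using \<F>(3) by blast
  also have "\<dots> \<in> null_sets haar" using \<F> nullV by (intro null_sets_UN') auto
  finally show False using haar.emeasure_space_1 by (simp add: space_haar null_sets_def)
qed

lemma polys_continuous: "f \<in> polys E \<Longrightarrow> continuous_on UNIV f"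
proof (induction rule: polys.induct)
  case (polys_coord e Y)
  show ?case by (intro continuous_intros continuous_on_product_coordinates)
qed (auto intro: continuous_intros)

text \<open>A continuous function that vanishes almost everywhere vanishes wherever the measure has
  full support. This makes the integrated hypothesis of \<open>kernel\<close> pointwise.\<close>

lemma polys_square_zero:
  assumes f: "f \<in> polys E" and zero: "(\<integral>Q. (f Q)\<^sup>2 \<partial>\<nu>) = 0" and Q0: "Q0 \<in> space \<nu>"
  shows "f Q0 = 0"
proof (rule ccontr)
  assume nz: "f Q0 \<noteq> 0"
  have sq: "(\<lambda>Q. (f Q)\<^sup>2) \<in> polys E" using f by (simp add: power2_eq_square)
  have "AE Q in \<nu>. (f Q)\<^sup>2 = 0"
    using zero integrable_bdd[OF polys_measurable[OF sq] bdd_polys[OF sq]]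
    by (subst (asm) integral_nonneg_eq_0_iff_AE) auto
  then have AE: "AE Q in \<nu>. f Q = 0" by simp
  have "open {Q. f Q \<noteq> 0}"
    by (intro open_Collect_neq polys_continuous f continuous_on_const)
  then obtain W where W: "Q0 \<in> Pi\<^sub>E UNIV W" "\<And>e. open (W e)" "Pi\<^sub>E UNIV W \<subseteq> {Q. f Q \<noteq> 0}"
    using product_topology_open_contains_basis[of "\<lambda>_. euclidean" UNIV "{Q. f Q \<noteq> 0}" Q0] nz
    unfolding open_fun_def by auto
  interpret P: product_sigma_finite "\<lambda>_. haar" ..
  let ?W = "\<lambda>e. W e \<inter> gauge_group G"
  have meas: "?W e \<in> sets haar" for e by (rule open_Int_in_sets[OF W(2)])
  have Q0W: "Q0 e \<in> W e" for e using PiE_mem[OF W(1)] by simp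
  have Q0G: "Q0 e \<in> gauge_group G" if "e \<in> E" for e using Q0 that by (auto simp: space_\<nu>)
  have "emeasure \<nu> (Pi\<^sub>E E ?W) = (\<Prod>e\<in>E. emeasure haar (?W e))"
    using meas by (intro P.emeasure_PiM) auto
  also have "\<dots> \<noteq> 0"
  proof -
    have "emeasure haar (?W e) \<noteq> 0" if "e \<in> E" for e
      using haar_open_pos[OF W(2), of "Q0 e" e] Q0W Q0G[OF that] by simp
    then show ?thesis by simp
  qed
  finally have pos: "emeasure \<nu> (Pi\<^sub>E E ?W) \<noteq> 0" .
  have "AE Q in \<nu>. Q \<notin> Pi\<^sub>E E ?W"
    using AE
  proof (rule AE_mp, intro AE_I2 impI notI)
    fix Q assume Q: "Q \<in> space \<nu>" "f Q = 0" "Q \<in> Pi\<^sub>E E ?W"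
    have "Q e \<in> W e" for e
    proof (cases "e \<in> E")
      case True
      then show ?thesis using PiE_mem[OF Q(3)] by auto
    next
      \<comment> \<open>Off \<open>E\<close> all configurations of the space take the same default
        value, so \<open>Q\<close> inherits the membership from \<open>Q0\<close>.\<close>
      case False
      then have "Q e = Q0 e" using Q(1) Q0 by (auto simp: space_\<nu> PiE_iff extensional_def)
      then show ?thesis using Q0W by simp
    qed
    then show False using W(3) Q(2) by auto
  qed
  moreover have "Pi\<^sub>E E ?W \<in> sets \<nu>" using meas by (intro sets_PiM_I_finite) auto
  ultimately have "emeasure \<nu> (Pi\<^sub>E E ?W) = 0"
    by (simp add: AE_iff_null_sets[symmetric] null_setsD1)
  then show False using pos by simp
qed

lemma invariant_one_parameter:
  assumes f: "f \<in> polys E" and K: "generator G K" and e: "e \<in> E" and Q: "Q \<in> space \<nu>"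
    and zero: "\<And>Q. Q \<in> space \<nu> \<Longrightarrow> D (single e K) f Q = 0"
  shows "f (Q(e := rodrigues K t ** Q e)) = f Q"
proof -
  have "D (single e K) f (Q(e := rodrigues K t ** Q e)) = 0" for t
    using K by (intro zero update_in_space Q e) (auto simp: generator_def)
  then have "f (Q(e := rodrigues K t ** Q e)) = f (Q(e := rodrigues K 0 ** Q e))"
    using D_curve[OF K f, of Q e] by (intro DERIV_isconst_all[of "\<lambda>t. f (Q(e := rodrigues K t ** Q e))"]) auto
  then show ?thesis by simp
qed

lemma gradient_zero_imp_constant:
  assumes f: "f \<in> polys E"
    and zero: "\<And>e X Q. e \<in> E \<Longrightarrow> X \<in> lie_algebra G \<Longrightarrow> Q \<in> space \<nu> \<Longrightarrow> D (single e X) f Q = 0"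
  shows "\<exists>r. \<forall>Q\<in>space \<nu>. f Q = r"
proof -
  have gen: "A \<in> gauge_group G \<and> (\<forall>Q\<in>space \<nu>. \<forall>e\<in>E. f (Q(e := A ** Q e)) = f Q)" if "A \<in> generated G" for A
    using that
  proof (induction rule: generated.induct)
    case (generated_step K B t)
    have K: "rodrigues K t \<in> gauge_group G" "K \<in> lie_algebra G"
      using generated_step by (auto simp: generator_def)
    have "f (Q(e := (rodrigues K t ** B) ** Q e)) = f Q" if Q: "Q \<in> space \<nu>" "e \<in> E" for Q e
    proof -
      let ?R = "Q(e := B ** Q e)"
      have R: "?R \<in> space \<nu>" using generated_step Q by (intro update_in_space) auto
      have "f (?R(e := rodrigues K t ** ?R e)) = f ?R"
        by (rule invariant_one_parameter[OF f generated_step(1) Q(2) R zero[OF Q(2) K(2)]])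
      then show ?thesis using generated_step Q by (simp add: matrix_mul_assoc)
    qed
    then show ?case using gauge_group_mul[OF K(1)] generated_step.IH by blast
  qed auto
  have upd: "f (Q(e := A)) = f Q" if "Q \<in> space \<nu>" "e \<in> E" "A \<in> gauge_group G" for Q e A
  proof -
    have Qe: "Q e \<in> gauge_group G" using that by (auto simp: space_\<nu>)
    \<comment> \<open>This element carries the old value \<open>Q e\<close> to \<open>A\<close>, so
      a single link can be changed at will.\<close>
    have "A ** cadjoint (Q e) \<in> generated G"
      using that Qe by (intro gauge_group_generated gauge_group_mul gauge_group_cadjoint)
    then have "f (Q(e := (A ** cadjoint (Q e)) ** Q e)) = f Q" using gen that by blast
    moreover have "A ** cadjoint (Q e) ** Q e = A"
      using Qe by (simp add: gauge_group_iff flip: matrix_mul_assoc)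
    ultimately show ?thesis by (simp only:)
  qed
  have "f Q = f Q'" if Q: "Q \<in> space \<nu>" and Q': "Q' \<in> space \<nu>" for Q Q'
  proof -
    define R where "R F = (\<lambda>e. if e \<in> F then Q' e else Q e)" for F
    have "R F \<in> space \<nu> \<and> f (R F) = f Q" if "F \<subseteq> E" for F
    proof -
      have "finite F" using that finite_E by (rule finite_subset)
      then show ?thesis using that
      proof (induction rule: finite_induct)
        case empty then show ?case using Q by (simp add: R_def)
      next
        case (insert e F)
        have eq: "R (insert e F) = (R F)(e := Q' e)" by (auto simp: R_def fun_eq_iff)
        have Q'e: "Q' e \<in> gauge_group G" using insert Q' by (auto simp: space_\<nu>)
        have R: "R F \<in> space \<nu>" "f (R F) = f Q" "e \<in> E" using insert by auto
        have "(R F)(e := Q' e) \<in> space \<nu>"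
          using R(1,3) Q'e by (auto simp: space_\<nu> PiE_iff extensional_def)
        moreover have "f ((R F)(e := Q' e)) = f Q"
          using upd[OF R(1,3) Q'e] R(2) by (rule trans)
        ultimately show ?case unfolding eq by blast
      qed
    qed
    moreover have "R E = Q'"
      using Q Q' by (auto simp: R_def fun_eq_iff space_\<nu> PiE_iff extensional_def)
    ultimately show ?thesis by (metis order.refl)
  qed
  then show ?thesis by blast
qed

end

section \<open>The Hessian of the action\<close>

text \<open>Matrix-valued derivatives are tested against every \<open>Y\<close>, so that only real
  polynomials are ever differentiated.\<close>

definition mder :: "('e \<Rightarrow> complex^'n^'n) \<Rightarrow> 'e set \<Rightarrow> (('e \<Rightarrow> complex^'n^'n) \<Rightarrow> complex^'n^'n) \<Rightarrow>
    (('e \<Rightarrow> complex^'n^'n) \<Rightarrow> complex^'n^'n) \<Rightarrow> bool" where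
  "mder v E M M' \<longleftrightarrow> (\<forall>Y. (\<lambda>Q. M Q \<bullet> Y) \<in> polys E \<and> D v (\<lambda>Q. M Q \<bullet> Y) = (\<lambda>Q. M' Q \<bullet> Y))"

lemma mder_coord: "e \<in> E \<Longrightarrow> mder v E (\<lambda>Q. Q e) (\<lambda>Q. v e ** Q e)"
  by (simp add: mder_def inner_matrix_mul_left)

lemma mder_adjoint: 
  assumes "e \<in> E"
  shows "mder v E (\<lambda>Q. cadjoint (Q e)) (\<lambda>Q. cadjoint (Q e) ** cadjoint (v e))"
proof -
  have adj: "cadjoint M \<bullet> Y = M \<bullet> cadjoint Y" for M Y :: "complex^'b^'b"
    using inner_cadjoint[of M "cadjoint Y"] by simp
  have "(cadjoint M ** cadjoint V) \<bullet> Y = M \<bullet> (cadjoint V ** cadjoint Y)" for M V Y :: "complex^'b^'b"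
    by (simp add: adj inner_matrix_mul_left flip: cadjoint_matrix_mul)
  then show ?thesis using assms by (simp add: mder_def adj)
qed

lemma mder_const: "mder v E (\<lambda>Q. A) (\<lambda>Q. 0)"
  by (simp add: mder_def)

lemma mder_add:
  assumes "mder v E M M'" "mder v E N N'"
  shows "mder v E (\<lambda>Q. M Q + N Q) (\<lambda>Q. M' Q + N' Q)"
  using assms unfolding mder_def by (auto simp: inner_add_left D_add[where E = E])

text \<open>The product rule for \<open>mder\<close> needs the pairing of a product as a polynomial
  in the coordinates of both factors.\<close>

lemma inner_matrix_mul_expand: "((M :: complex^'n^'n) ** (N :: complex^'n^'n)) \<bullet> Y = (\<Sum>b\<in>Basis. (M \<bullet> b) * (N \<bullet> (cadjoint b ** Y)))"
proof -
  have "(M ** N) \<bullet> Y = ((\<Sum>b\<in>Basis. (M \<bullet> b) *\<^sub>R b) ** N) \<bullet> Y" by (simp add: euclidean_representation)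
  also have "(\<Sum>b\<in>Basis. (M \<bullet> b) *\<^sub>R b) ** N = (\<Sum>b\<in>Basis. (M \<bullet> b) *\<^sub>R (b ** N))"
    unfolding matrix_mul_scaleR_left[symmetric] by (rule linear_sum[OF linear_matrix_mul_left])
  finally show ?thesis by (simp add: inner_sum_left inner_matrix_mul_left)
qed

lemma mder_mult:
  assumes M: "mder v E M M'" and N: "mder v E N N'"
  shows "mder v E (\<lambda>Q. M Q ** N Q) (\<lambda>Q. M' Q ** N Q + M Q ** N' Q)"
  unfolding mder_def
proof (intro allI conjI)
  fix Y
  have MP: "(\<lambda>Q. M Q \<bullet> Z) \<in> polys E" "D v (\<lambda>Q. M Q \<bullet> Z) = (\<lambda>Q. M' Q \<bullet> Z)" for Z
    using M by (auto simp: mder_def)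
  have NP: "(\<lambda>Q. N Q \<bullet> Z) \<in> polys E" "D v (\<lambda>Q. N Q \<bullet> Z) = (\<lambda>Q. N' Q \<bullet> Z)" for Z
    using N by (auto simp: mder_def)
  have prod: "(\<lambda>Q. (M Q \<bullet> b) * (N Q \<bullet> (cadjoint b ** Y))) \<in> polys E" for b
    by (rule polys_mult[OF MP(1) NP(1)])
  show "(\<lambda>Q. (M Q ** N Q) \<bullet> Y) \<in> polys E"
    unfolding inner_matrix_mul_expand by (rule polys_sum) (rule prod)
  have "D v (\<lambda>Q. (M Q ** N Q) \<bullet> Y) = (\<lambda>Q. \<Sum>b\<in>Basis. D v (\<lambda>Q. (M Q \<bullet> b) * (N Q \<bullet> (cadjoint b ** Y))) Q)"
    unfolding inner_matrix_mul_expand by (rule D_sum) (rule prod)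
  also have "\<dots> = (\<lambda>Q. \<Sum>b\<in>Basis. (M' Q \<bullet> b) * (N Q \<bullet> (cadjoint b ** Y)) + (M Q \<bullet> b) * (N' Q \<bullet> (cadjoint b ** Y)))"
    unfolding D_mult[OF MP(1) NP(1)] MP(2) NP(2) ..
  also have "\<dots> = (\<lambda>Q. (M' Q ** N Q + M Q ** N' Q) \<bullet> Y)"
    unfolding inner_add_left inner_matrix_mul_expand sum.distrib ..
  finally show "D v (\<lambda>Q. (M Q ** N Q) \<bullet> Y) = (\<lambda>Q. (M' Q ** N Q + M Q ** N' Q) \<bullet> Y)" .
qed

definition unitary :: "complex^'n^'n \<Rightarrow> bool" where
  "unitary U \<longleftrightarrow> U ** cadjoint U = mat 1 \<and> cadjoint U ** U = mat 1"

lemma unitary_mult: "unitary U \<Longrightarrow> unitary V \<Longrightarrow> unitary (U ** V)"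
proof -
  assume "unitary U" "unitary V"
  moreover have "U ** V ** cadjoint (U ** V) = U ** (V ** cadjoint V) ** cadjoint U"
    "cadjoint (U ** V) ** (U ** V) = cadjoint V ** (cadjoint U ** U) ** V"
    by (simp_all add: cadjoint_matrix_mul matrix_mul_assoc)
  ultimately show ?thesis by (simp add: unitary_def)
qed

lemma unitary_cadjoint: "unitary U \<Longrightarrow> unitary (cadjoint U)"
  by (simp add: unitary_def)

lemma gauge_group_unitary: "A \<in> gauge_group G \<Longrightarrow> unitary A"
  by (simp add: unitary_def gauge_group_iff)

lemma norm_unitary:
  assumes "unitary U"
  shows "norm (U ** A) = norm A" "norm (A ** U) = norm A"
  using assms by (simp_all add: unitary_def norm_unitary_mul norm_mul_unitary)

text \<open>The trace of a second derivative splits at its two differentiated factors, so that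
  Cauchy--Schwarz loses no power of the dimension.\<close>

definition jet :: "('e \<Rightarrow> complex^'n^'n) \<Rightarrow> 'e set \<Rightarrow> ('e \<Rightarrow> complex^'n^'n) \<Rightarrow>
    (('e \<Rightarrow> complex^'n^'n) \<Rightarrow> complex^'n^'n) \<Rightarrow> real \<Rightarrow> bool" where
  "jet v E Q M a \<longleftrightarrow> unitary (M Q) \<and> (\<exists>M' M''. mder v E M M' \<and> mder v E M' M'' \<and>
    norm (M' Q) \<le> a \<and> (\<forall>R. unitary R \<longrightarrow> \<bar>M'' Q \<bullet> R\<bar> \<le> a\<^sup>2))"

text \<open>The second derivative contains \<open>v e\<close> twice; moving one copy across the
  inner product lets Cauchy-Schwarz see two matrices, each of the norm of
  \<open>v e\<close>.\<close>

lemma jet_coord: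
  fixes v :: "'e \<Rightarrow> complex^'n^'n"
  assumes e: "e \<in> E" and U: "unitary (Q e)"
  shows "jet v E Q (\<lambda>Q. Q e) (norm (v e))"
  unfolding jet_def
proof (rule conjI[OF U], rule exI[of _ "\<lambda>Q. v e ** Q e"], rule exI[of _ "\<lambda>Q. v e ** (v e ** Q e)"],
    intro conjI allI impI)
  show "mder v E (\<lambda>Q. Q e) (\<lambda>Q. v e ** Q e)" by (rule mder_coord[OF e])
  show "mder v E (\<lambda>Q. v e ** Q e) (\<lambda>Q. v e ** (v e ** Q e))"
    using mder_mult[OF mder_const mder_coord[OF e], of v "v e"] by simp
  show "norm (v e ** Q e) \<le> norm (v e)" using U by (simp add: norm_unitary)
  fix R :: "complex^'n^'n" assume R: "unitary R"
  have "\<bar>(v e ** (v e ** Q e)) \<bullet> R\<bar> \<le> norm (v e ** Q e) * norm (cadjoint (v e) ** R)"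
    unfolding inner_matrix_mul_left[of "v e" "v e ** Q e"] by (rule Cauchy_Schwarz_ineq2)
  then show "\<bar>(v e ** (v e ** Q e)) \<bullet> R\<bar> \<le> (norm (v e))\<^sup>2"
    using U R by (simp add: norm_unitary power2_eq_square)
qed

lemma jet_adjoint:
  fixes v :: "'e \<Rightarrow> complex^'n^'n"
  assumes e: "e \<in> E" and U: "unitary (Q e)"
  shows "jet v E Q (\<lambda>Q. cadjoint (Q e)) (norm (v e))"
  unfolding jet_def
proof (rule conjI[OF unitary_cadjoint[OF U]], rule exI[of _ "\<lambda>Q. cadjoint (Q e) ** cadjoint (v e)"],
    rule exI[of _ "\<lambda>Q. (cadjoint (Q e) ** cadjoint (v e)) ** cadjoint (v e)"], intro conjI allI impI)
  note U' = unitary_cadjoint[OF U]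
  show "mder v E (\<lambda>Q. cadjoint (Q e)) (\<lambda>Q. cadjoint (Q e) ** cadjoint (v e))" by (rule mder_adjoint[OF e])
  show "mder v E (\<lambda>Q. cadjoint (Q e) ** cadjoint (v e)) (\<lambda>Q. (cadjoint (Q e) ** cadjoint (v e)) ** cadjoint (v e))"
    using mder_mult[OF mder_adjoint[OF e] mder_const, of v "cadjoint (v e)"] by simp
  show "norm (cadjoint (Q e) ** cadjoint (v e)) \<le> norm (v e)" using U' by (simp add: norm_unitary)
  fix R :: "complex^'n^'n" assume R: "unitary R"
  have "\<bar>((cadjoint (Q e) ** cadjoint (v e)) ** cadjoint (v e)) \<bullet> R\<bar>
      \<le> norm (cadjoint (Q e) ** cadjoint (v e)) * norm (R ** cadjoint (cadjoint (v e)))"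
    unfolding inner_matrix_mul_right[of "cadjoint (Q e) ** cadjoint (v e)"] by (rule Cauchy_Schwarz_ineq2)
  then show "\<bar>((cadjoint (Q e) ** cadjoint (v e)) ** cadjoint (v e)) \<bullet> R\<bar> \<le> (norm (v e))\<^sup>2"
    using U' R by (simp add: norm_unitary power2_eq_square)
qed

text \<open>Unitary factors are moved across the inner product into \<open>R\<close>, which is why
  \<open>jet\<close> asks for its bound at every unitary \<open>R\<close>. The two mixed terms are
  at most a b each, so the bounds add up to (a + b)^2.\<close>

lemma jet_mult:
  fixes v :: "'e \<Rightarrow> complex^'n^'n"
  assumes M: "jet v E Q M a" and N: "jet v E Q N b"
  shows "jet v E Q (\<lambda>Q. M Q ** N Q) (a + b)"
proof -
  obtain M' M'' where M': "unitary (M Q)" "mder v E M M'" "mder v E M' M''" "norm (M' Q) \<le> a"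
    "\<And>R. unitary R \<Longrightarrow> \<bar>M'' Q \<bullet> R\<bar> \<le> a\<^sup>2" using M unfolding jet_def by blast
  obtain N' N'' where N': "unitary (N Q)" "mder v E N N'" "mder v E N' N''" "norm (N' Q) \<le> b"
    "\<And>R. unitary R \<Longrightarrow> \<bar>N'' Q \<bullet> R\<bar> \<le> b\<^sup>2" using N unfolding jet_def by blast
  show ?thesis
    unfolding jet_def
  proof (rule conjI[OF unitary_mult[OF M'(1) N'(1)]], rule exI[of _ "\<lambda>Q. M' Q ** N Q + M Q ** N' Q"],
      rule exI[of _ "\<lambda>Q. (M'' Q ** N Q + M' Q ** N' Q) + (M' Q ** N' Q + M Q ** N'' Q)"], intro conjI allI impI)
    show "mder v E (\<lambda>Q. M Q ** N Q) (\<lambda>Q. M' Q ** N Q + M Q ** N' Q)" by (rule mder_mult[OF M'(2) N'(2)])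
    show "mder v E (\<lambda>Q. M' Q ** N Q + M Q ** N' Q)
        (\<lambda>Q. (M'' Q ** N Q + M' Q ** N' Q) + (M' Q ** N' Q + M Q ** N'' Q))"
      by (intro mder_add mder_mult M' N')
    show "norm (M' Q ** N Q + M Q ** N' Q) \<le> a + b"
      using norm_triangle_ineq[of "M' Q ** N Q" "M Q ** N' Q"] M'(1,4) N'(1,4)
      by (simp add: norm_unitary)
    fix R :: "complex^'n^'n" assume R: "unitary R"
    have 1: "\<bar>(M'' Q ** N Q) \<bullet> R\<bar> \<le> a\<^sup>2"
      unfolding inner_matrix_mul_right[of _ "N Q"] by (intro M'(5) unitary_mult R unitary_cadjoint N'(1))
    have 2: "\<bar>(M Q ** N'' Q) \<bullet> R\<bar> \<le> b\<^sup>2"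
      unfolding inner_matrix_mul_left[of "M Q"] by (intro N'(5) unitary_mult R unitary_cadjoint M'(1))
    have "\<bar>(M' Q ** N' Q) \<bullet> R\<bar> \<le> norm (M' Q) * norm (R ** cadjoint (N' Q))"
      unfolding inner_matrix_mul_right[of _ "N' Q"] by (rule Cauchy_Schwarz_ineq2)
    also have "\<dots> \<le> a * b"
      using M'(4) N'(4) R order.trans[OF norm_ge_zero M'(4)] by (intro mult_mono) (auto simp: norm_unitary)
    finally have 3: "\<bar>(M' Q ** N' Q) \<bullet> R\<bar> \<le> a * b" .
    show "\<bar>((M'' Q ** N Q + M' Q ** N' Q) + (M' Q ** N' Q + M Q ** N'' Q)) \<bullet> R\<bar> \<le> (a + b)\<^sup>2"
      using 1 2 3 unfolding inner_add_left power2_sum by linarith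
  qed
qed

lemma jet_second_derivative:
  assumes "jet v E Q M a"
  shows "(\<lambda>Q. M Q \<bullet> mat 1) \<in> polys E" "\<bar>D v (D v (\<lambda>Q. M Q \<bullet> mat 1)) Q\<bar> \<le> a\<^sup>2"
proof -
  obtain M' M'' where M': "mder v E M M'" "mder v E M' M''" "\<And>R. unitary R \<Longrightarrow> \<bar>M'' Q \<bullet> R\<bar> \<le> a\<^sup>2"
    using assms unfolding jet_def by blast
  show "(\<lambda>Q. M Q \<bullet> mat 1) \<in> polys E" using M'(1) unfolding mder_def by blast
  have "D v (D v (\<lambda>Q. M Q \<bullet> mat 1)) = (\<lambda>Q. M'' Q \<bullet> mat 1)"
    using M'(1,2) unfolding mder_def by metis
  then show "\<bar>D v (D v (\<lambda>Q. M Q \<bullet> mat 1)) Q\<bar> \<le> a\<^sup>2"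
    using M'(3)[of "mat 1"] by (simp add: unitary_def)
qed


section \<open>The Poincare inequality for a system of plaquettes\<close>

text \<open>All that the inequality needs from the lattice is that every edge occurs
  \<open>m\<close> times among the plaquettes; \<open>count\<close> says so, with multiplicity, as
  an identity for arbitrary weights on the edges.\<close>

locale plaquette_system = haar_product G haar E + lie_basis G B
  for G :: gauge_type and haar :: "(complex^'n^'n) measure" and E :: "'e set" and B :: "(complex^'n^'n) set" +
  fixes P :: "'p set" and s1 s2 s3 s4 :: "'p \<Rightarrow> 'e" and c m :: real
  assumes finite_P: "finite P"
    and edges: "\<And>p. p \<in> P \<Longrightarrow> s1 p \<in> E \<and> s2 p \<in> E \<and> s3 p \<in> E \<and> s4 p \<in> E"
    and count: "\<And>g :: 'e \<Rightarrow> real. (\<Sum>p\<in>P. g (s1 p) + g (s2 p) + g (s3 p) + g (s4 p)) = m * (\<Sum>e\<in>E. g e)"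
    and m_nonneg: "m \<ge> 0"
begin

text \<open>The adjoint agrees with the inverse on the group and keeps the action polynomial in the
  entries.\<close>

definition plaq :: "'p \<Rightarrow> ('e \<Rightarrow> complex^'n^'n) \<Rightarrow> complex^'n^'n" where
  "plaq p Q = Q (s1 p) ** Q (s2 p) ** cadjoint (Q (s3 p)) ** cadjoint (Q (s4 p))"

definition act :: "('e \<Rightarrow> complex^'n^'n) \<Rightarrow> real" where
  "act Q = c * (\<Sum>p\<in>P. plaq p Q \<bullet> mat 1)"

definition ind :: "('e \<times> (complex^'n^'n)) set" where
  "ind = E \<times> B"

definition X :: "'e \<times> (complex^'n^'n) \<Rightarrow> (('e \<Rightarrow> complex^'n^'n) \<Rightarrow> real) \<Rightarrow> ('e \<Rightarrow> complex^'n^'n) \<Rightarrow> real" where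
  "X = (\<lambda>(e, b). D (single e b))"

text \<open>The bracket is reversed to match \<open>D_commutator\<close>; fields on different edges
  commute.\<close>

definition struct :: "'e \<times> (complex^'n^'n) \<Rightarrow> 'e \<times> (complex^'n^'n) \<Rightarrow> 'e \<times> (complex^'n^'n) \<Rightarrow> real" where
  "struct = (\<lambda>(e, b) (e', b') (e'', b''). if e = e' \<and> e' = e'' then (b' ** b - b ** b') \<bullet> b'' else 0)"

text \<open>One quarter of the constant in \<open>sum_ad_basis\<close>: the Ricci curvature of the
  bi-invariant metric.\<close>

definition \<kappa> :: real where
  "\<kappa> = (case G of SO \<Rightarrow> (real CARD('n) - 2) / 4 | SU \<Rightarrow> real CARD('n) / 2)"

text \<open>A single direction with coordinates \<open>a\<close>, so that the Hessian form at
  \<open>a\<close> becomes one iterated derivative.\<close>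

definition field :: "('e \<times> (complex^'n^'n) \<Rightarrow> real) \<Rightarrow> 'e \<Rightarrow> complex^'n^'n" where
  "field a e = (\<Sum>b\<in>B. a (e, b) *\<^sub>R b)"

lemma field_in: "field a e \<in> lie_algebra G"
  unfolding field_def using B_sub subspace_lie_algebra[of G] by (intro subspace_sum subspace_scale) auto

lemma norm_field: "(norm (field a e))\<^sup>2 = (\<Sum>b\<in>B. (a (e, b))\<^sup>2)"
proof -
  have "field a e \<bullet> b = a (e, b)" if "b \<in> B" for b
  proof -
    have "field a e \<bullet> b = (\<Sum>b'\<in>B. if b' = b then a (e, b) else 0)"
      unfolding field_def inner_sum_left using that by (intro sum.cong) (auto simp: B_inner)
    then show ?thesis using that by simp
  qed
  then show ?thesis using parseval[OF field_in, of a e "field a e"]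
    by (simp add: power2_norm_eq_inner) (simp add: power2_eq_square)
qed

lemma jet_plaq:
  assumes p: "p \<in> P" and Q: "Q \<in> space \<nu>"
  shows "jet v E Q (plaq p) (norm (v (s1 p)) + norm (v (s2 p)) + norm (v (s3 p)) + norm (v (s4 p)))"
proof -
  have U: "unitary (Q e)" if "e \<in> E" for e
    using Q that gauge_group_unitary by (auto simp: space_\<nu>)
  show ?thesis
    unfolding plaq_def using edges[OF p] by (intro jet_mult jet_coord jet_adjoint U) auto
qed

lemma space_nonempty: "\<exists>Q. Q \<in> space \<nu>"
  using \<nu>.not_empty by blast

lemma plaq_polys: "p \<in> P \<Longrightarrow> (\<lambda>Q. plaq p Q \<bullet> mat 1) \<in> polys E"
  using space_nonempty jet_second_derivative(1)[OF jet_plaq] by blast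

lemma act_polys: "act \<in> polys E"
  unfolding act_def[abs_def] by (intro polys_cmult polys_sum plaq_polys)

text \<open>Per plaquette the second derivative is at most the square of a sum of four norms, hence
  4 times the sum of their squares; \<open>count\<close> collects these into \<open>m\<close> for
  each edge.\<close>

lemma second_derivative_act:
  assumes Q: "Q \<in> space \<nu>"
  shows "D v (D v act) Q \<le> 4 * \<bar>c\<bar> * m * (\<Sum>e\<in>E. (norm (v e))\<^sup>2)"
proof -
  have eq: "D v (D v act) Q = c * (\<Sum>p\<in>P. D v (D v (\<lambda>Q. plaq p Q \<bullet> mat 1)) Q)"
    unfolding act_def[abs_def]
    by (simp add: D_cmult[where E = E] D_sum[where E = E] plaq_polys)
  have "\<bar>\<Sum>p\<in>P. D v (D v (\<lambda>Q. plaq p Q \<bullet> mat 1)) Q\<bar> \<le> (\<Sum>p\<in>P. \<bar>D v (D v (\<lambda>Q. plaq p Q \<bullet> mat 1)) Q\<bar>)"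
    by (rule sum_abs)
  also have "\<dots> \<le> (\<Sum>p\<in>P. 4 * ((norm (v (s1 p)))\<^sup>2 + (norm (v (s2 p)))\<^sup>2 + (norm (v (s3 p)))\<^sup>2 + (norm (v (s4 p)))\<^sup>2))"
  proof (rule sum_mono)
    fix p assume p: "p \<in> P"
    have quad: "(x + y + z + w)\<^sup>2 \<le> 4 * (x\<^sup>2 + y\<^sup>2 + z\<^sup>2 + w\<^sup>2)" for x y z w :: real
    proof -
      have "0 \<le> (x - y)\<^sup>2 + (x - z)\<^sup>2 + (x - w)\<^sup>2 + (y - z)\<^sup>2 + (y - w)\<^sup>2 + (z - w)\<^sup>2" by simp
      then show ?thesis by (simp add: power2_eq_square algebra_simps)
    qed
    show "\<bar>D v (D v (\<lambda>Q. plaq p Q \<bullet> mat 1)) Q\<bar> \<le>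
        4 * ((norm (v (s1 p)))\<^sup>2 + (norm (v (s2 p)))\<^sup>2 + (norm (v (s3 p)))\<^sup>2 + (norm (v (s4 p)))\<^sup>2)"
      by (rule order.trans[OF jet_second_derivative(2)[OF jet_plaq[OF p Q]] quad])
  qed
  also have "\<dots> = 4 * (m * (\<Sum>e\<in>E. (norm (v e))\<^sup>2))"
    unfolding sum_distrib_left[symmetric] count[of "\<lambda>e. (norm (v e))\<^sup>2"] ..
  finally have "\<bar>c\<bar> * \<bar>\<Sum>p\<in>P. D v (D v (\<lambda>Q. plaq p Q \<bullet> mat 1)) Q\<bar> \<le> \<bar>c\<bar> * (4 * (m * (\<Sum>e\<in>E. (norm (v e))\<^sup>2)))"
    by (intro mult_left_mono) auto
  then show ?thesis unfolding eq by (simp add: abs_mult[symmetric] mult_ac)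
qed

lemma D_field:
  assumes "f \<in> polys E"
  shows "D (field a) f = (\<lambda>Q. \<Sum>i\<in>ind. a i * X i f Q)"
proof
  fix Q
  have "D (field a) f Q = D (\<lambda>e. \<Sum>i\<in>ind. a i *\<^sub>R (case i of (e', b) \<Rightarrow> single e' b e)) f Q"
  proof (rule fun_cong[OF D_cong[OF assms]])
    fix e assume e: "e \<in> E"
    have "(\<Sum>i\<in>ind. a i *\<^sub>R (case i of (e', b) \<Rightarrow> single e' b e)) = (\<Sum>e'\<in>E. \<Sum>b\<in>B. a (e', b) *\<^sub>R single e' b e)"
      unfolding ind_def by (simp add: sum.cartesian_product case_prod_unfold)
    also have "\<dots> = (\<Sum>e'\<in>E. if e' = e then field a e else 0)"
      by (intro sum.cong) (auto simp: single_def field_def)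
    finally show "field a e = (\<Sum>i\<in>ind. a i *\<^sub>R (case i of (e', b) \<Rightarrow> single e' b e))" using e by simp
  qed
  also have "\<dots> = (\<Sum>i\<in>ind. a i * X i f Q)"
    using assms by (simp add: D_vsum D_vscaleR X_def case_prod_unfold)
  finally show "D (field a) f Q = (\<Sum>i\<in>ind. a i * X i f Q)" .
qed

lemma sum_ind: "(\<Sum>i\<in>ind. F i) = (\<Sum>e\<in>E. \<Sum>b\<in>B. F (e, b))"
  unfolding ind_def by (simp add: sum.cartesian_product)

lemma X_single: "X (e, b) = D (single e b)"
  by (simp add: X_def)

lemma X_const: "X i (\<lambda>_. r) = (\<lambda>_. 0)"
  by (cases i) (simp add: X_single)

lemma X_commutator:
  assumes i: "i \<in> ind" and j: "j \<in> ind" and f: "f \<in> polys E"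
  shows "X i (X j f) Q - X j (X i f) Q = (\<Sum>k\<in>ind. struct i j k * X k f Q)"
proof -
  obtain e b where ib: "i = (e, b)" "e \<in> E" "b \<in> B" using i by (auto simp: ind_def)
  obtain e' b' where jb: "j = (e', b')" "e' \<in> E" "b' \<in> B" using j by (auto simp: ind_def)
  let ?w = "b' ** b - b ** b'"
  have lhs: "X i (X j f) Q - X j (X i f) Q = D (\<lambda>x. single e' b' x ** single e b x - single e b x ** single e' b' x) f Q"
    unfolding ib jb X_single by (rule D_commutator[OF f])
  show ?thesis
  proof (cases "e = e'")
    case False
    then have "(\<lambda>x. single e' b' x ** single e b x - single e b x ** single e' b' x) = (\<lambda>x. 0)"
      by (auto simp: single_def)
    then show ?thesis using lhs f False by (simp add: sum_ind struct_def ib jb)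
  next
    case True
    have w: "?w \<in> lie_algebra G" using ib jb B_sub by (intro lie_algebra_bracket) auto
    have "(\<lambda>x. single e' b' x ** single e b x - single e b x ** single e' b' x)
        = (\<lambda>x. \<Sum>b''\<in>B. (?w \<bullet> b'') *\<^sub>R single e b'' x)"
      using expansion[OF w] True by (auto simp: single_def fun_eq_iff)
    then have "X i (X j f) Q - X j (X i f) Q = (\<Sum>b''\<in>B. (?w \<bullet> b'') * X (e, b'') f Q)"
      unfolding lhs using f by (simp add: D_vsum D_vscaleR X_single)
    also have "\<dots> = (\<Sum>e''\<in>E. if e'' = e then \<Sum>b''\<in>B. (?w \<bullet> b'') * X (e, b'') f Q else 0)"
      using ib by simp
    also have "\<dots> = (\<Sum>k\<in>ind. struct i j k * X k f Q)"
      unfolding sum_ind using True by (intro sum.cong) (auto simp: struct_def ib jb)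
    finally show ?thesis .
  qed
qed

lemma struct_swap12: "struct i j k = - struct j i k"
  by (cases i; cases j; cases k) (auto simp: struct_def inner_diff_left)

lemma struct_swap23: "i \<in> ind \<Longrightarrow> j \<in> ind \<Longrightarrow> k \<in> ind \<Longrightarrow> struct i j k = - struct i k j"
proof -
  assume ijk: "i \<in> ind" "j \<in> ind" "k \<in> ind"
  obtain e b where i: "i = (e, b)" "b \<in> lie_algebra G" using ijk(1) B_sub by (auto simp: ind_def)
  obtain e' b' where j: "j = (e', b')" "b' \<in> lie_algebra G" using ijk(2) B_sub by (auto simp: ind_def)
  obtain e'' b'' where k: "k = (e'', b'')" "b'' \<in> lie_algebra G" using ijk(3) B_sub by (auto simp: ind_def)
  show ?thesis
    using bracket_inner_cyclic[OF j(2) i(2) k(2)] by (auto simp: struct_def i j k inner_diff_left)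
qed

text \<open>Brackets between different edges vanish, so the sum splits into the curvature identity
  of a single group at each edge.\<close>

lemma curvature_sum:
  "\<kappa> * (\<Sum>k\<in>ind. (a k)\<^sup>2) = (1/4) * (\<Sum>j\<in>ind. \<Sum>i\<in>ind. (\<Sum>k\<in>ind. struct i j k * a k)\<^sup>2)"
proof -
  let ?w = "\<lambda>b b'. b' ** b - b ** b'"
  have inner: "(\<Sum>k\<in>ind. struct (e, b) (e', b') k * a k) = (if e = e' then ?w b b' \<bullet> field a e else 0)"
    if "e \<in> E" for e e' b b'
  proof (cases "e = e'")
    case True
    have "(\<Sum>k\<in>ind. struct (e, b) (e', b') k * a k) = (\<Sum>e''\<in>E. if e'' = e then \<Sum>b''\<in>B. (?w b b' \<bullet> b'') * a (e, b'') else 0)"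
      unfolding sum_ind using True by (intro sum.cong) (auto simp: struct_def)
    then show ?thesis using True that by (simp add: field_def inner_sum_right mult.commute)
  qed (simp add: sum_ind struct_def)
  define F where "F i j = (\<Sum>k\<in>ind. struct i j k * a k)\<^sup>2" for i j
  have "(\<Sum>j\<in>ind. \<Sum>i\<in>ind. F i j) = (\<Sum>e'\<in>E. \<Sum>b'\<in>B. \<Sum>e\<in>E. \<Sum>b\<in>B. F (e, b) (e', b'))"
    by (simp only: sum_ind)
  also have "\<dots> = (\<Sum>e'\<in>E. \<Sum>b'\<in>B. \<Sum>e\<in>E. if e = e' then \<Sum>b\<in>B. (?w b b' \<bullet> field a e')\<^sup>2 else 0)"
    by (intro sum.cong refl) (auto simp: F_def inner)
  also have "\<dots> = (\<Sum>e\<in>E. \<Sum>b'\<in>B. \<Sum>b\<in>B. (?w b b' \<bullet> field a e)\<^sup>2)" by simp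
  also have "\<dots> = (\<Sum>e\<in>E. \<Sum>b\<in>B. \<Sum>b'\<in>B. (?w b b' \<bullet> field a e)\<^sup>2)"
    by (rule sum.cong[OF refl], rule sum.swap)
  also have "\<dots> = (\<Sum>e\<in>E. (4 * \<kappa>) * (\<Sum>b\<in>B. (a (e, b))\<^sup>2))"
  proof -
    have "(case G of SO \<Rightarrow> real CARD('n) - 2 | SU \<Rightarrow> 2 * real CARD('n)) = 4 * \<kappa>"
      by (simp add: \<kappa>_def split: gauge_type.split)
    then show ?thesis unfolding curvature_identity[OF field_in] norm_field by simp
  qed
  also have "\<dots> = 4 * (\<kappa> * (\<Sum>k\<in>ind. (a k)\<^sup>2))"
    unfolding sum_ind by (simp add: sum_distrib_left mult.assoc)
  finally show ?thesis by (simp add: F_def)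
qed

text \<open>The coordinates \<open>a\<close> are constants, so differentiating twice along
  \<open>field a\<close> produces exactly the double sum.\<close>

lemma hessian_act:
  assumes Q: "Q \<in> space \<nu>"
  shows "(\<Sum>j\<in>ind. \<Sum>i\<in>ind. a j * a i * X j (X i act) Q) \<le> (4 * \<bar>c\<bar> * m) * (\<Sum>i\<in>ind. (a i)\<^sup>2)"
proof -
  have X_polys: "X i f \<in> polys E" if "f \<in> polys E" for i f
    using that by (auto simp: X_def split: prod.splits)
  have "D (field a) (D (field a) act) Q = (\<Sum>j\<in>ind. a j * X j (\<lambda>Q. \<Sum>i\<in>ind. a i * X i act Q) Q)"
    by (simp add: D_field act_polys X_polys)
  also have "\<dots> = (\<Sum>j\<in>ind. a j * (\<Sum>i\<in>ind. a i * X j (X i act) Q))"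
  proof (rule sum.cong[OF refl])
    fix j :: "'e \<times> (complex^'n^'n)"
    obtain e b where j: "j = (e, b)" by (cases j)
    show "a j * X j (\<lambda>Q. \<Sum>i\<in>ind. a i * X i act Q) Q = a j * (\<Sum>i\<in>ind. a i * X j (X i act) Q)"
      unfolding j X_single by (simp add: D_sum[where E = E] D_cmult[where E = E] act_polys X_polys)
  qed
  also have "\<dots> = (\<Sum>j\<in>ind. \<Sum>i\<in>ind. a j * a i * X j (X i act) Q)"
    by (simp add: sum_distrib_left mult.assoc)
  finally show ?thesis
    using second_derivative_act[OF Q, of "field a"] by (simp add: norm_field sum_ind)
qed

lemma X_finite_span:
  assumes "f \<in> polys E"
  shows "\<exists>n a. (\<exists>k\<le>n::nat. a k \<noteq> (0::real)) \<and>
      (\<forall>q. (\<Sum>k\<le>n. a k * ((\<lambda>f q. \<Sum>i\<in>ind. X i (X i f) q) ^^ k) f q) = 0)"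
proof -
  obtain M where M: "finite M" "M \<subseteq> polys E" "f \<in> lin_span M" "\<And>v m. m \<in> M \<Longrightarrow> D v m \<in> lin_span M"
    using polys_finite_span[OF assms] by blast
  have D_span: "D v g \<in> lin_span M" if g: "g \<in> lin_span M" for g v
  proof -
    obtain a where "g = (\<lambda>q. \<Sum>m\<in>M. a m * m q)" using g unfolding lin_span_def by blast
    then have "D v g = (\<lambda>q. \<Sum>m\<in>M. a m * D v m q)"
      using M(2) by (auto simp: D_sum[where E = E] D_cmult[where E = E] subset_iff)
    also have "\<dots> \<in> lin_span M" by (intro lin_span_sum lin_span_cmult M(4))
    finally show ?thesis .
  qed
  have X_span: "X i g \<in> lin_span M" if "g \<in> lin_span M" for g i
    using D_span[OF that] by (cases i) (simp add: X_single)
  have "((\<lambda>f q. \<Sum>i\<in>ind. X i (X i f) q) ^^ k) f \<in> lin_span M" for k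
  proof (induction k)
    case (Suc k)
    have "(\<lambda>q. \<Sum>i\<in>ind. X i (X i (((\<lambda>f q. \<Sum>i\<in>ind. X i (X i f) q) ^^ k) f)) q) \<in> lin_span M"
      by (intro lin_span_sum X_span Suc.IH)
    then show ?case by simp
  qed (simp add: M)
  then show ?thesis by (rule lin_span_dependent[OF M(1)])
qed

text \<open>Each \<open>X i f\<close> has zero norm and so vanishes at every point; expansion in
  \<open>B\<close> then reaches all directions of the Lie algebra.\<close>

lemma X_kernel:
  assumes f: "f \<in> polys E" and zero: "(\<integral>Q. (\<Sum>i\<in>ind. (X i f Q)\<^sup>2) \<partial>\<nu>) = 0"
  shows "\<exists>r. \<forall>Q\<in>space \<nu>. f Q = r"
proof (rule gradient_zero_imp_constant[OF f])
  fix e Q and Y :: "complex^'n^'n" assume e: "e \<in> E" and Y: "Y \<in> lie_algebra G" and Q: "Q \<in> space \<nu>"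
  have sq: "(\<lambda>Q. (X i f Q)\<^sup>2) \<in> polys E" for i
    using f by (auto simp: X_def power2_eq_square split: prod.splits)
  have int: "integrable \<nu> (\<lambda>Q. (X i f Q)\<^sup>2)" for i
    by (rule integrable_bdd[OF polys_measurable[OF sq] bdd_polys[OF sq]])
  have "(\<Sum>i\<in>ind. (\<integral>Q. (X i f Q)\<^sup>2 \<partial>\<nu>)) = 0" using zero int by simp
  moreover have "finite ind" by (simp add: ind_def)
  ultimately have z: "(\<integral>Q. (X i f Q)\<^sup>2 \<partial>\<nu>) = 0" if "i \<in> ind" for i
    using that by (subst (asm) sum_nonneg_eq_0_iff) auto
  have "D (single e b) f Q = 0" if "b \<in> B" for b
    using polys_square_zero[of "D (single e b) f", OF D_closed[OF f] _ Q] z[of "(e, b)"] that e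
    by (simp add: ind_def X_single)
  moreover have "D (single e Y) f Q = D (\<lambda>x. \<Sum>b\<in>B. (Y \<bullet> b) *\<^sub>R single e b x) f Q"
  proof -
    have "single e Y = (\<lambda>x. \<Sum>b\<in>B. (Y \<bullet> b) *\<^sub>R single e b x)"
      using expansion[OF Y] by (auto simp: single_def fun_eq_iff)
    then show ?thesis by simp
  qed
  ultimately show "D (single e Y) f Q = 0"
    using f by (simp add: D_vsum D_vscaleR)
qed

lemma derivation_algebra:
  assumes "4 * \<bar>c\<bar> * m < \<kappa>"
  shows "derivation_algebra \<nu> (polys E) ind X struct act \<kappa> (4 * \<bar>c\<bar> * m)"
proof (unfold_locales; (elim conjE)?)
  show "finite ind" by (simp add: ind_def)
  fix i and f g :: "('e \<Rightarrow> complex^'n^'n) \<Rightarrow> real" assume "i \<in> ind" and f: "f \<in> polys E" and g: "g \<in> polys E"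
  show "X i (\<lambda>q. f q + g q) = (\<lambda>q. X i f q + X i g q)"
    using D_add[OF f g] by (simp add: X_def case_prod_unfold)
  show "X i (\<lambda>q. f q * g q) = (\<lambda>q. X i f q * g q + f q * X i g q)"
    using D_mult[OF f g] by (simp add: X_def case_prod_unfold)
next
  fix i and f :: "('e \<Rightarrow> complex^'n^'n) \<Rightarrow> real" assume "i \<in> ind" and f: "f \<in> polys E"
  then obtain e b where i: "i = (e, b)" "e \<in> E" "b \<in> B" by (auto simp: ind_def)
  show "X i f \<in> polys E" using f by (simp add: i X_single)
  show "\<nu>.expectation (\<lambda>q. (X i f q + t * (f q * X i act q)) * exp (t * act q)) = 0" for t
    unfolding i X_single using i B_sub by (intro integration_by_parts f act_polys) auto
qed (use assms in \<open>auto simp: X_const curvature_sum m_nonneg act_polys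
  intro: X_commutator struct_swap12 struct_swap23 polys_bounded hessian_act X_finite_span X_kernel\<close>)

end

locale plaquette_gap = plaquette_system G haar E B P s1 s2 s3 s4 c m
  for G :: gauge_type and haar :: "(complex^'n^'n) measure" and E :: "'e set" and B :: "(complex^'n^'n) set"
    and P :: "'p set" and s1 s2 s3 s4 :: "'p \<Rightarrow> 'e" and c m :: real +
  assumes gap: "4 * \<bar>c\<bar> * m < \<kappa>"
begin

sublocale DA: derivation_algebra \<nu> "polys E" ind X struct act \<kappa> "4 * \<bar>c\<bar> * m"
  by (rule derivation_algebra[OF gap])

section \<open>The Gibbs measure and its covariances\<close>

definition gibbs :: "('e \<Rightarrow> complex^'n^'n) measure" where
  "gibbs = density \<nu> (\<lambda>Q. ennreal (exp (act Q) / (\<integral>Q. exp (act Q) \<partial>\<nu>)))"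

definition Z :: real where
  "Z = (\<integral>Q. exp (act Q) \<partial>\<nu>)"

lemma Z_pos: "Z > 0"
proof -
  have int: "integrable \<nu> (\<lambda>Q. exp (act Q))"
    using DA.integrable_weighted[of "\<lambda>_. 1" 1] by simp
  have "Z \<noteq> 0"
  proof
    assume "Z = 0"
    then have "AE Q in \<nu>. exp (act Q) = 0"
      using int unfolding Z_def by (subst (asm) integral_nonneg_eq_0_iff_AE) auto
    then show False by (simp add: \<nu>.AE_False)
  qed
  moreover have "Z \<ge> 0" unfolding Z_def by simp
  ultimately show ?thesis by simp
qed

lemma gibbs_integral:
  assumes f: "f \<in> borel_measurable \<nu>"
  shows "(\<integral>Q. f Q \<partial>gibbs) = (\<integral>Q. f Q * exp (act Q) \<partial>\<nu>) / Z"
proof -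
  have "(\<lambda>Q. exp (act Q) / Z) \<in> borel_measurable \<nu>"
    using polys_measurable[OF act_polys] by measurable
  then have "(\<integral>Q. f Q \<partial>gibbs) = (\<integral>Q. (exp (act Q) / Z) *\<^sub>R f Q \<partial>\<nu>)"
    unfolding gibbs_def Z_def[symmetric] using Z_pos f by (intro integral_density) auto
  then show ?thesis by (simp add: mult.commute)
qed

lemma gibbs_J: "f \<in> polys E \<Longrightarrow> (\<integral>Q. f Q \<partial>gibbs) = DA.J 1 f / Z"
  by (simp add: gibbs_integral polys_measurable DA.J_def)

lemma J_1: "DA.J 1 (\<lambda>_. r) = r * Z"
  by (simp add: DA.J_def Z_def)

lemma covariance_sum:
  assumes f: "f \<in> polys E" and g: "\<And>e. e \<in> F \<Longrightarrow> g e \<in> polys E"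
  shows "covariance gibbs f (\<lambda>Q. \<Sum>e\<in>F. g e Q) = (\<Sum>e\<in>F. covariance gibbs f (g e))"
proof -
  let ?m = "\<lambda>f. \<integral>Q. f Q \<partial>gibbs"
  have "?m (\<lambda>Q. \<Sum>e\<in>F. g e Q) = (\<Sum>e\<in>F. ?m (g e))"
    using g by (simp add: gibbs_J DA.J_sum sum_divide_distrib)
  then have "covariance gibbs f (\<lambda>Q. \<Sum>e\<in>F. g e Q) = ?m (\<lambda>Q. \<Sum>e\<in>F. (f Q - ?m f) * (g e Q - ?m (g e)))"
    unfolding covariance_def by (simp add: sum_subtractf[symmetric] sum_distrib_left)
  also have "\<dots> = DA.J 1 (\<lambda>Q. \<Sum>e\<in>F. (f Q - ?m f) * (g e Q - ?m (g e))) / Z"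
    using f g by (intro gibbs_J polys_sum polys_mult polys_diff) auto
  also have "\<dots> = (\<Sum>e\<in>F. DA.J 1 (\<lambda>Q. (f Q - ?m f) * (g e Q - ?m (g e))) / Z)"
    using f g by (subst DA.J_sum) (auto intro!: polys_mult polys_diff simp: sum_divide_distrib)
  also have "\<dots> = (\<Sum>e\<in>F. covariance gibbs f (g e))"
    unfolding covariance_def using f g by (intro sum.cong refl gibbs_J[symmetric] polys_mult polys_diff) auto
  finally show ?thesis .
qed

lemma covariance_commute: "covariance M f g = covariance M g f"
  by (simp add: covariance_def mult.commute)

text \<open>The normalisation \<open>Z\<close> divides both sides of the Poincare inequality and
  cancels.\<close>

lemma variance_bound:
  assumes f: "f \<in> polys E" and grad: "\<And>Q. Q \<in> space \<nu> \<Longrightarrow> (\<Sum>i\<in>ind. (X i f Q)\<^sup>2) \<le> r"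
  shows "0 \<le> covariance gibbs f f" "covariance gibbs f f \<le> r / (\<kappa> - 4 * \<bar>c\<bar> * m)"
proof -
  define u where "u = DA.J 1 f / DA.J 1 (\<lambda>_. 1)"
  have u: "u = (\<integral>Q. f Q \<partial>gibbs)" using f by (simp add: u_def gibbs_J J_1)
  have cov: "covariance gibbs f f = DA.J 1 (\<lambda>Q. (f Q - u)\<^sup>2) / Z"
    unfolding covariance_def u[symmetric] power2_eq_square
    using f by (intro gibbs_J polys_mult polys_diff) auto
  show "0 \<le> covariance gibbs f f"
    unfolding cov using Z_pos by (intro divide_nonneg_pos DA.J_nonneg) auto
  have "(\<kappa> - 4 * \<bar>c\<bar> * m) * DA.J 1 (\<lambda>Q. (f Q - u)\<^sup>2) \<le> DA.J 1 (DA.grad f f)"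
    unfolding u_def by (rule DA.poincare[OF f])
  also have "\<dots> \<le> DA.J 1 (\<lambda>_. r)"
  proof (rule DA.J_mono)
    fix Q assume "Q \<in> space \<nu>"
    then show "DA.grad f f Q \<le> r" using grad[of Q] by (simp add: DA.grad_def power2_eq_square)
  qed (use f in auto)
  also have "\<dots> = r * Z" by (rule J_1)
  finally show "covariance gibbs f f \<le> r / (\<kappa> - 4 * \<bar>c\<bar> * m)"
    unfolding cov using gap Z_pos by (simp add: divide_simps mult_ac)
qed

section \<open>The link observables\<close>

definition obs :: "complex^'n^'n \<Rightarrow> 'e \<Rightarrow> ('e \<Rightarrow> complex^'n^'n) \<Rightarrow> real" where
  "obs Y e = (\<lambda>Q. Q e \<bullet> Y)"

lemma obs_polys: "e \<in> E \<Longrightarrow> obs Y e \<in> polys E"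
  unfolding obs_def by (rule polys_coord)

lemma X_obs: "X (e', b) (obs Y e) Q = (if e = e' then b \<bullet> (Y ** cadjoint (Q e)) else 0)"
proof (cases "e = e'")
  case True
  have "Q e' \<bullet> (cadjoint b ** Y) = b \<bullet> (Y ** cadjoint (Q e'))"
    by (simp flip: inner_matrix_mul_left inner_matrix_mul_right)
  then show ?thesis using True by (simp add: obs_def X_single single_def)
qed (simp add: obs_def X_single single_def)

text \<open>The summands are the coordinates of the gradient of \<open>obs Y e\<close>, the
  projection of \<open>Y ** cadjoint (Q e)\<close> to the Lie algebra; a unitary factor keeps the
  norm of \<open>Y\<close>.\<close>

lemma bessel_obs:
  assumes "Q \<in> space \<nu>" "e \<in> E" "norm Y = 1"
  shows "(\<Sum>b\<in>B. (b \<bullet> (Y ** cadjoint (Q e)))\<^sup>2) \<le> 1"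
proof -
  have "unitary (cadjoint (Q e))"
    using assms(1,2) gauge_group_unitary by (auto simp: space_\<nu> intro!: unitary_cadjoint)
  then show ?thesis
    using bessel[of "Y ** cadjoint (Q e)"] assms(3) by (simp add: norm_unitary inner_commute)
qed

lemma grad_obs:
  assumes "Q \<in> space \<nu>" "e \<in> E" "norm Y = 1"
  shows "(\<Sum>i\<in>ind. (X i (obs Y e) Q)\<^sup>2) \<le> 1"
proof -
  have "(\<Sum>i\<in>ind. (X i (obs Y e) Q)\<^sup>2) = (\<Sum>e'\<in>E. if e' = e then \<Sum>b\<in>B. (b \<bullet> (Y ** cadjoint (Q e)))\<^sup>2 else 0)"
    unfolding sum_ind by (intro sum.cong) (auto simp: X_obs)
  then show ?thesis using bessel_obs[OF assms] assms(2) by simp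
qed

text \<open>Each derivative sees one edge only, so the squared gradient grows like the number of
  edges and not like its square. This makes the final bound independent of the volume.\<close>

lemma grad_obs_sum:
  assumes "Q \<in> space \<nu>" "norm Y = 1"
  shows "(\<Sum>i\<in>ind. (X i (\<lambda>Q. \<Sum>e\<in>E. obs Y e Q) Q)\<^sup>2) \<le> real (card E)"
proof -
  have "X (e', b) (\<lambda>Q. \<Sum>e\<in>E. obs Y e Q) Q = b \<bullet> (Y ** cadjoint (Q e'))" if e': "e' \<in> E" for e' b
  proof -
    have "X (e', b) (\<lambda>Q. \<Sum>e\<in>E. obs Y e Q) Q = (\<Sum>e\<in>E. X (e', b) (obs Y e) Q)"
      unfolding X_single by (subst D_sum[where E = E]) (auto simp: obs_polys)
    then show ?thesis using e' by (simp add: X_obs)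
  qed
  then have "(\<Sum>i\<in>ind. (X i (\<lambda>Q. \<Sum>e\<in>E. obs Y e Q) Q)\<^sup>2) = (\<Sum>e\<in>E. \<Sum>b\<in>B. (b \<bullet> (Y ** cadjoint (Q e)))\<^sup>2)"
    unfolding sum_ind by (intro sum.cong) auto
  also have "\<dots> \<le> (\<Sum>e\<in>E. 1)" using assms by (intro sum_mono bessel_obs)
  finally show ?thesis by simp
qed

text \<open>Permuting coordinates preserves a product of identical measures, and \<open>inv\<close>
  says that it preserves the weight.\<close>

lemma gibbs_reindex:
  fixes f :: "('e \<Rightarrow> complex^'n^'n) \<Rightarrow> real"
  assumes \<tau>: "bij_betw \<tau> E E"
    and inv: "\<And>Q. Q \<in> space \<nu> \<Longrightarrow> act (\<lambda>e\<in>E. Q (\<tau> e)) = act Q"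
    and f: "f \<in> borel_measurable \<nu>"
  shows "(\<integral>Q. f (\<lambda>e\<in>E. Q (\<tau> e)) \<partial>gibbs) = (\<integral>Q. f Q \<partial>gibbs)"
proof -
  let ?T = "\<lambda>Q. \<lambda>e\<in>E. Q (\<tau> e)"
  have \<tau>E: "\<tau> e \<in> E" if "e \<in> E" for e using \<tau> that by (auto simp: bij_betw_def)
  have T: "?T \<in> measurable \<nu> \<nu>"
    using \<tau>E by (intro measurable_restrict measurable_component_singleton)
  have distr: "distr \<nu> \<nu> ?T = \<nu>"
    using distr_PiM_reindex[of E "\<lambda>_. haar" \<tau> E] \<tau> \<tau>E haar.prob_space_axioms
    by (auto simp: bij_betw_def)
  have fe: "(\<lambda>Q. f Q * exp (act Q)) \<in> borel_measurable \<nu>"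
    using f polys_measurable[OF act_polys] by measurable
  have "(\<integral>Q. f Q \<partial>gibbs) = (\<integral>Q. f Q * exp (act Q) \<partial>(distr \<nu> \<nu> ?T)) / Z"
    unfolding distr by (rule gibbs_integral[OF f])
  also have "\<dots> = (\<integral>Q. f (?T Q) * exp (act (?T Q)) \<partial>\<nu>) / Z"
    by (simp add: integral_distr[OF T fe])
  also have "\<dots> = (\<integral>Q. f (?T Q) * exp (act Q) \<partial>\<nu>) / Z"
    using inv by (metis (mono_tags, lifting) Bochner_Integration.integral_cong)
  also have "\<dots> = (\<integral>Q. f (?T Q) \<partial>gibbs)"
    by (intro gibbs_integral[symmetric] measurable_compose[OF T f])
  finally show ?thesis ..
qed

lemma covariance_reindex:
  assumes \<tau>: "bij_betw \<tau> E E"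
    and inv: "\<And>Q. Q \<in> space \<nu> \<Longrightarrow> act (\<lambda>e\<in>E. Q (\<tau> e)) = act Q"
    and e: "e \<in> E" "e' \<in> E"
  shows "covariance gibbs (obs Y (\<tau> e)) (obs Y (\<tau> e')) = covariance gibbs (obs Y e) (obs Y e')"
proof -
  have mean: "(\<integral>Q. obs Y (\<tau> e) Q \<partial>gibbs) = (\<integral>Q. obs Y e Q \<partial>gibbs)" if "e \<in> E" for e
    using gibbs_reindex[OF \<tau> inv polys_measurable[OF obs_polys[OF that]]] that by (simp add: obs_def)
  let ?f = "\<lambda>Q. (obs Y e Q - (\<integral>Q. obs Y e Q \<partial>gibbs)) * (obs Y e' Q - (\<integral>Q. obs Y e' Q \<partial>gibbs))"
  have "?f \<in> polys E" using e by (intro polys_mult polys_diff obs_polys) auto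
  from gibbs_reindex[OF \<tau> inv polys_measurable[OF this]] show ?thesis
    unfolding covariance_def mean[OF e(1)] mean[OF e(2)] using e by (simp add: obs_def)
qed

text \<open>The lower bounds, both from nonnegative variances, are what later controls the sum
  without its diagonal term.\<close>

theorem covariance_bounds:
  assumes Y: "norm Y = 1" and e0: "e0 \<in> E"
    and trans: "\<And>e. e \<in> E \<Longrightarrow> \<exists>\<tau>. bij_betw \<tau> E E \<and> \<tau> e0 = e \<and>
      (\<forall>Q\<in>space \<nu>. act (\<lambda>e\<in>E. Q (\<tau> e)) = act Q)"
  defines "R \<equiv> \<Sum>e\<in>E. covariance gibbs (obs Y e0) (obs Y e)"
  shows "0 \<le> R" "R \<le> 1 / (\<kappa> - 4 * \<bar>c\<bar> * m)"
    "0 \<le> covariance gibbs (obs Y e0) (obs Y e0)"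
    "covariance gibbs (obs Y e0) (obs Y e0) \<le> 1 / (\<kappa> - 4 * \<bar>c\<bar> * m)"
proof -
  show "0 \<le> covariance gibbs (obs Y e0) (obs Y e0)"
    "covariance gibbs (obs Y e0) (obs Y e0) \<le> 1 / (\<kappa> - 4 * \<bar>c\<bar> * m)"
    using variance_bound[OF obs_polys[OF e0] grad_obs[OF _ e0 Y]] by auto
  have row: "(\<Sum>e'\<in>E. covariance gibbs (obs Y e) (obs Y e')) = R" if e: "e \<in> E" for e
  proof -
    obtain \<tau> where \<tau>: "bij_betw \<tau> E E" "\<tau> e0 = e" "\<And>Q. Q \<in> space \<nu> \<Longrightarrow> act (\<lambda>e\<in>E. Q (\<tau> e)) = act Q"
      using trans[OF e] by blast
    have "(\<Sum>e'\<in>E. covariance gibbs (obs Y e) (obs Y e')) = (\<Sum>e'\<in>E. covariance gibbs (obs Y (\<tau> e0)) (obs Y (\<tau> e')))"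
      using sum.reindex_bij_betw[OF \<tau>(1), of "\<lambda>e'. covariance gibbs (obs Y e) (obs Y e')"] by (simp add: \<tau>(2))
    also have "\<dots> = R"
      unfolding R_def by (intro sum.cong refl covariance_reindex \<tau>(1) \<tau>(3) e0)
    finally show ?thesis .
  qed
  let ?F = "\<lambda>Q. \<Sum>e\<in>E. obs Y e Q"
  have F: "?F \<in> polys E" by (intro polys_sum obs_polys)
  have "covariance gibbs ?F ?F = (\<Sum>e\<in>E. covariance gibbs ?F (obs Y e))"
    by (rule covariance_sum[OF F obs_polys])
  also have "\<dots> = (\<Sum>e\<in>E. \<Sum>e'\<in>E. covariance gibbs (obs Y e) (obs Y e'))"
  proof (rule sum.cong[OF refl])
    fix e assume e: "e \<in> E"
    have "covariance gibbs ?F (obs Y e) = covariance gibbs (obs Y e) ?F" by (rule covariance_commute)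
    also have "\<dots> = (\<Sum>e'\<in>E. covariance gibbs (obs Y e) (obs Y e'))"
      by (rule covariance_sum[OF obs_polys[OF e] obs_polys])
    finally show "covariance gibbs ?F (obs Y e) = (\<Sum>e'\<in>E. covariance gibbs (obs Y e) (obs Y e'))" .
  qed
  also have "\<dots> = real (card E) * R" by (simp add: row)
  finally have FF: "covariance gibbs ?F ?F = real (card E) * R" .
  have n: "real (card E) > 0" using e0 by (auto simp: card_gt_0_iff)
  have "0 \<le> real (card E) * R" "real (card E) * R \<le> real (card E) / (\<kappa> - 4 * \<bar>c\<bar> * m)"
    using variance_bound[OF F grad_obs_sum[OF _ Y]] unfolding FF by auto
  then show "0 \<le> R" "R \<le> 1 / (\<kappa> - 4 * \<bar>c\<bar> * m)"
    using mult_le_cancel_left_pos[OF n, of 0 R] mult_le_cancel_left_pos[OF n, of R "1 / (\<kappa> - 4 * \<bar>c\<bar> * m)"]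
    by simp_all
qed

end

section \<open>The torus and its symmetries\<close>

definition red :: "nat \<Rightarrow> nat \<Rightarrow> point \<Rightarrow> point" where
  "red d L x = (\<lambda>i\<in>{..<d}. x i mod int L)"

definition ed :: "nat \<Rightarrow> nat \<Rightarrow> point \<Rightarrow> nat \<Rightarrow> edge" where
  "ed d L x k = edge_rep d L (x, x(k := x k + 1))"

text \<open>A permutation of the coordinates followed by a translation; as no coordinate is
  reflected, edges keep their orientation.\<close>

definition tr :: "nat \<Rightarrow> (nat \<Rightarrow> nat) \<Rightarrow> point \<Rightarrow> point \<Rightarrow> point" where
  "tr d \<pi> a x = (\<lambda>i\<in>{..<d}. x (\<pi> i) + a i)"

lemma ed_eq: "k < d \<Longrightarrow> ed d L x k = (red d L x, (red d L x)(k := red d L x k + 1))"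
  by (auto simp: ed_def edge_rep_def red_def fun_eq_iff minus_mult_div_eq_mod)

lemma ed_cong: "k < d \<Longrightarrow> red d L x = red d L y \<Longrightarrow> ed d L x k = ed d L y k"
  by (simp add: ed_eq)

lemma red_in_box: "L > 0 \<Longrightarrow> red d L x \<in> box d L"
  by (auto simp: red_def box_def)

lemma red_box: "x \<in> box d L \<Longrightarrow> red d L x = x"
  by (auto simp: red_def box_def fun_eq_iff PiE_iff extensional_def)

lemma red_red [simp]: "red d L (red d L x) = red d L x"
  by (auto simp: red_def fun_eq_iff)

lemma box_lattice: "x \<in> box d L \<Longrightarrow> x \<in> lattice d"
  by (auto simp: box_def lattice_def)

lemma finite_box: "finite (box d L)"
  unfolding box_def by (intro finite_PiE) auto

lemma lattice_step: "x \<in> lattice d \<Longrightarrow> k < d \<Longrightarrow> x(k := x k + 1) \<in> lattice d"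
  by (auto simp: lattice_def PiE_iff extensional_def)

lemma ed_in_edges: "L > 0 \<Longrightarrow> k < d \<Longrightarrow> ed d L x k \<in> pos_edges d L"
  unfolding pos_edges_eq using red_in_box[of L d x] by (auto simp: ed_eq)

lemma ed_inj:
  assumes "k < d" "k' < d" "ed d L x k = ed d L y k'"
  shows "red d L x = red d L y" "k = k'"
proof -
  show red: "red d L x = red d L y" using assms by (simp add: ed_eq)
  have "(red d L x)(k := red d L x k + 1) = (red d L x)(k' := red d L x k' + 1)"
    using assms red by (simp add: ed_eq)
  from fun_cong[OF this, of k] show "k = k'" by (auto split: if_splits)
qed

lemma pos_edges_ed: "pos_edges d L = (\<lambda>(x, k). ed d L x k) ` (box d L \<times> {..<d})"
  unfolding pos_edges_eq by (intro image_cong) (auto simp: ed_eq red_box)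

lemma sum_pos_edges: "(\<Sum>e\<in>pos_edges d L. g e) = (\<Sum>k<d. \<Sum>x\<in>box d L. g (ed d L x k))"
proof -
  have "inj_on (\<lambda>(x, k). ed d L x k) (box d L \<times> {..<d})"
  proof (rule inj_onI, clarify)
    fix x k y k' assume "x \<in> box d L" "y \<in> box d L" "k < d" "k' < d" "ed d L x k = ed d L y k'"
    then show "x = y \<and> k = k'" using ed_inj[of k d k' L x y] by (simp add: red_box)
  qed
  then have "(\<Sum>e\<in>pos_edges d L. g e) = (\<Sum>(x, k)\<in>box d L \<times> {..<d}. g (ed d L x k))"
    unfolding pos_edges_ed by (simp add: sum.reindex case_prod_unfold)
  also have "\<dots> = (\<Sum>x\<in>box d L. \<Sum>k<d. g (ed d L x k))" by (simp add: sum.cartesian_product)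
  finally show ?thesis by (simp add: sum.swap[of _ "box d L"])
qed

lemma red_tr_cong:
  assumes "red d L x = red d L y" "bij_betw \<pi> {..<d} {..<d}"
  shows "red d L (tr d \<pi> a x) = red d L (tr d \<pi> a y)"
proof
  fix i
  show "red d L (tr d \<pi> a x) i = red d L (tr d \<pi> a y) i"
  proof (cases "i < d")
    case True
    then have "\<pi> i < d" using assms(2) by (auto simp: bij_betw_def)
    then have "x (\<pi> i) mod int L = y (\<pi> i) mod int L"
      using fun_cong[OF assms(1), of "\<pi> i"] by (simp add: red_def)
    then show ?thesis using True by (simp add: red_def tr_def) (metis mod_add_left_eq)
  qed (simp add: red_def)
qed

lemma red_tr_inj:
  assumes "red d L (tr d \<pi> a x) = red d L (tr d \<pi> a y)" "bij_betw \<pi> {..<d} {..<d}"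
  shows "red d L x = red d L y"
proof
  fix j
  show "red d L x j = red d L y j"
  proof (cases "j < d")
    case True
    then have "j \<in> \<pi> ` {..<d}" using assms(2) by (simp add: bij_betw_def)
    then obtain i where i: "i < d" "\<pi> i = j" by auto
    then have "(x j + a i) mod int L = (y j + a i) mod int L"
      using fun_cong[OF assms(1), of i] by (simp add: red_def tr_def)
    then have "x j mod int L = y j mod int L" by (metis add_diff_cancel_right' mod_diff_left_eq)
    then show ?thesis using True by (simp add: red_def)
  qed (simp add: red_def)
qed

lemma box_bij:
  assumes "L > 0" "bij_betw \<pi> {..<d} {..<d}"
  shows "bij_betw (\<lambda>x. red d L (tr d \<pi> a x)) (box d L) (box d L)"
proof -
  have "inj_on (\<lambda>x. red d L (tr d \<pi> a x)) (box d L)"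
    by (rule inj_onI) (use red_tr_inj[OF _ assms(2)] red_box in metis)
  moreover have "(\<lambda>x. red d L (tr d \<pi> a x)) ` box d L \<subseteq> box d L" using red_in_box[OF assms(1)] by auto
  ultimately show ?thesis unfolding bij_betw_def using endo_inj_surj[OF finite_box] by auto
qed

text \<open>In general the new direction is the preimage of \<open>k\<close>; for an involution this
  is \<open>\<pi> k\<close>. Transpositions are enough for transitivity on edges.\<close>

lemma tr_step:
  assumes "bij_betw \<pi> {..<d} {..<d}" "\<And>i. \<pi> (\<pi> i) = i" "k < d"
  shows "tr d \<pi> a (x(k := x k + 1)) = (tr d \<pi> a x)(\<pi> k := tr d \<pi> a x (\<pi> k) + 1)"
proof
  fix i
  have "\<pi> k < d" using assms(1,3) by (auto simp: bij_betw_def)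
  moreover have "\<pi> i = k \<longleftrightarrow> i = \<pi> k" using assms(2) by metis
  ultimately show "tr d \<pi> a (x(k := x k + 1)) i = ((tr d \<pi> a x)(\<pi> k := tr d \<pi> a x (\<pi> k) + 1)) i"
    using assms(2) by (auto simp: tr_def)
qed

lemma sum_box_shift:
  assumes L: "L > 0" and F: "\<And>x y. red d L x = red d L y \<Longrightarrow> F x = F y" and "bij_betw \<pi> {..<d} {..<d}"
  shows "(\<Sum>x\<in>box d L. F (tr d \<pi> a x)) = (\<Sum>x\<in>box d L. F x)"
proof -
  have "(\<Sum>x\<in>box d L. F (tr d \<pi> a x)) = (\<Sum>x\<in>box d L. F (red d L (tr d \<pi> a x)))"
    by (intro sum.cong refl F) simp
  also have "\<dots> = (\<Sum>x\<in>box d L. F x)" by (rule sum.reindex_bij_betw[OF box_bij[OF assms(1,3)]])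
  finally show ?thesis .
qed

lemma unit_shift:
  assumes "x \<in> lattice d" "k < d"
  shows "x(k := x k + 1) = tr d id (\<lambda>i. if i = k then 1 else 0) x"
  using assms by (auto simp: tr_def fun_eq_iff lattice_def PiE_iff extensional_def)

lemma red_step_cong:
  assumes "red d L x = red d L y"
  shows "red d L (x(k := x k + 1)) = red d L (y(k := y k + 1))"
proof
  fix i
  show "red d L (x(k := x k + 1)) i = red d L (y(k := y k + 1)) i"
    using fun_cong[OF assms, of i] by (auto simp: red_def) (metis mod_add_left_eq)
qed

section \<open>Sums over pairs of directions\<close>

lemma sum_triangle: "(\<Sum>j<d. \<Sum>i<j. a i + a j) = (real d - 1) * (\<Sum>k<d. a k)" for a :: "nat \<Rightarrow> real"
  by (induction d) (simp_all add: sum.distrib algebra_simps)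

lemma sum_triangle_symmetric:
  fixes V :: "nat \<Rightarrow> nat \<Rightarrow> real"
  assumes "\<And>i j. V i j = V j i"
  shows "2 * (\<Sum>j<d. \<Sum>i<j. V i j) = (\<Sum>j<d. \<Sum>i<d. if i = j then 0 else V i j)"
proof (induction d)
  case (Suc d)
  have "(\<Sum>j<Suc d. \<Sum>i<Suc d. if i = j then 0 else V i j) =
      (\<Sum>j<d. (\<Sum>i<d. if i = j then 0 else V i j) + V d j) + (\<Sum>i<d. V i d)"
  proof -
    have "(\<Sum>j<d. \<Sum>i<Suc d. if i = j then 0 else V i j) = (\<Sum>j<d. (\<Sum>i<d. if i = j then 0 else V i j) + V d j)"
      by (intro sum.cong) auto
    moreover have "(\<Sum>i<Suc d. if i = d then 0 else V i d) = (\<Sum>i<d. V i d)" by simp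
    ultimately show ?thesis by simp
  qed
  also have "\<dots> = 2 * (\<Sum>j<d. \<Sum>i<j. V i j) + 2 * (\<Sum>i<d. V i d)"
    using Suc assms by (simp add: sum.distrib)
  finally show ?case by simp
qed simp

text \<open>A permutation need not preserve \<open>i < j\<close>, so the sum is doubled to one over
  ordered pairs of distinct directions, which can be reindexed.\<close>

lemma sum_triangle_permute:
  fixes V :: "nat \<Rightarrow> nat \<Rightarrow> real"
  assumes sym: "\<And>i j. V i j = V j i" and \<pi>: "bij_betw \<pi> {..<d} {..<d}"
  shows "(\<Sum>j<d. \<Sum>i<j. V (\<pi> i) (\<pi> j)) = (\<Sum>j<d. \<Sum>i<j. V i j)"
proof -
  have "2 * (\<Sum>j<d. \<Sum>i<j. V (\<pi> i) (\<pi> j)) = (\<Sum>j<d. \<Sum>i<d. if i = j then 0 else V (\<pi> i) (\<pi> j))"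
    by (rule sum_triangle_symmetric) (rule sym)
  also have "\<dots> = (\<Sum>j<d. \<Sum>i<d. if \<pi> i = \<pi> j then 0 else V (\<pi> i) (\<pi> j))"
    using \<pi> by (intro sum.cong refl if_cong) (auto simp: bij_betw_def inj_on_def)
  also have "\<dots> = (\<Sum>j<d. \<Sum>i<d. if i = \<pi> j then 0 else V i (\<pi> j))"
    by (intro sum.cong refl sum.reindex_bij_betw[OF \<pi>, of "\<lambda>i. if i = \<pi> j then 0 else V i (\<pi> j)" for j])
  also have "\<dots> = (\<Sum>j<d. \<Sum>i<d. if i = j then 0 else V i j)"
    by (rule sum.reindex_bij_betw[OF \<pi>, of "\<lambda>j. \<Sum>i<d. if i = j then 0 else V i j"])
  also have "\<dots> = 2 * (\<Sum>j<d. \<Sum>i<j. V i j)" by (rule sum_triangle_symmetric[OF sym, symmetric])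
  finally show ?thesis by simp
qed

section \<open>Plaquettes as products around coordinate squares\<close>

lemma matrix_inv_gauge_group:
  assumes "A \<in> gauge_group G"
  shows "matrix_inv A = cadjoint A"
proof -
  have A: "A ** cadjoint A = mat 1" "cadjoint A ** A = mat 1" using assms by (auto simp: gauge_group_iff)
  have "A ** matrix_inv A = mat 1 \<and> matrix_inv A ** A = mat 1"
    unfolding matrix_inv_def by (rule someI[of _ "cadjoint A"]) (use A in blast)
  then have "cadjoint A ** (A ** matrix_inv A) = cadjoint A" by simp
  then show ?thesis by (simp add: matrix_mul_assoc A)
qed

lemma lex_step: "x \<in> lattice d \<Longrightarrow> k < d \<Longrightarrow> lex_less d x (x(k := x k + 1))"
  using nearest_neighbours_lex_iff[of d x "x(k := x k + 1)"] by blast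

lemma not_lex_step: "\<not> lex_less d (x(k := x k + 1)) x"
  by (auto simp: lex_less_def split: if_splits)

definition corner :: "nat \<Rightarrow> nat \<Rightarrow> (edge \<Rightarrow> complex^'n^'n) \<Rightarrow> point \<Rightarrow> nat \<Rightarrow> nat \<Rightarrow> complex^'n^'n" where
  "corner d L Q x i j = Q (ed d L x j) ** Q (ed d L (x(j := x j + 1)) i) **
     cadjoint (Q (ed d L (x(i := x i + 1)) j)) ** cadjoint (Q (ed d L x i))"

lemma plaquette_var_corner:
  assumes Q: "Q \<in> pos_edges d L \<rightarrow>\<^sub>E gauge_group G" and x: "x \<in> box d L" and ij: "i < j" "j < d" and L: "L > 0"
  shows "plaquette_var d L Q (x, x(j := x j + 1), x(i := x i + 1, j := x j + 1), x(i := x i + 1)) = corner d L Q x i j"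
proof -
  have xl: "x \<in> lattice d" using x by (rule box_lattice)
  have i: "i < d" using ij by simp
  let ?v2 = "x(j := x j + 1)" and ?v3 = "x(i := x i + 1, j := x j + 1)" and ?v4 = "x(i := x i + 1)"
  have v3: "?v3 = ?v2(i := ?v2 i + 1)" "?v3 = ?v4(j := ?v4 j + 1)" using ij by (auto simp: fun_eq_iff)
  have mem: "Q (ed d L y k) \<in> gauge_group G" if "k < d" for y k
    using Q ed_in_edges[OF L that] by auto
  have 1: "edge_var d L Q (x, ?v2) = Q (ed d L x j)"
    using lex_step[OF xl ij(2)] by (simp add: edge_var_def ed_def)
  have 2: "edge_var d L Q (?v2, ?v3) = Q (ed d L ?v2 i)"
    unfolding v3(1) using lex_step[OF lattice_step[OF xl ij(2)] i] unfolding edge_var_def ed_def by simp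
  have 3: "edge_var d L Q (?v3, ?v4) = cadjoint (Q (ed d L ?v4 j))"
    unfolding v3(2) matrix_inv_gauge_group[OF mem[OF ij(2)], symmetric]
    using not_lex_step[of d ?v4 j] unfolding edge_var_def ed_def by simp
  have 4: "edge_var d L Q (?v4, x) = cadjoint (Q (ed d L x i))"
    unfolding matrix_inv_gauge_group[OF mem[OF i], symmetric]
    using not_lex_step[of d x i] unfolding edge_var_def ed_def by simp
  show ?thesis unfolding plaquette_var_def prod.case 1 2 3 4 corner_def ..
qed

definition squares :: "nat \<Rightarrow> nat \<Rightarrow> (point \<times> nat \<times> nat) set" where
  "squares d L = box d L \<times> (SIGMA j:{..<d}. {..<j})"

lemma finite_squares: "finite (squares d L)"
  unfolding squares_def by (intro finite_cartesian_product finite_box finite_SigmaI) auto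

lemma sum_squares: "(\<Sum>(x, j, i)\<in>squares d L. F x i j) = (\<Sum>j<d. \<Sum>i<j. \<Sum>x\<in>box d L. F x i j)"
proof -
  have "(\<Sum>(x, j, i)\<in>squares d L. F x i j) = (\<Sum>x\<in>box d L. \<Sum>(j, i)\<in>(SIGMA j:{..<d}. {..<j}). F x i j)"
    unfolding squares_def by (simp add: sum.cartesian_product case_prod_unfold)
  also have "\<dots> = (\<Sum>(j, i)\<in>(SIGMA j:{..<d}. {..<j}). \<Sum>x\<in>box d L. F x i j)"
    unfolding case_prod_unfold by (rule sum.swap)
  also have "\<dots> = (\<Sum>j<d. \<Sum>i<j. \<Sum>x\<in>box d L. F x i j)" by (subst sum.Sigma) auto
  finally show ?thesis .
qed

lemma sum_pos_plaquettes:
  "(\<Sum>p\<in>pos_plaquettes d L. F p) =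
   (\<Sum>(x, j, i)\<in>squares d L. F (x, x(j := x j + 1), x(i := x i + 1, j := x j + 1), x(i := x i + 1)))"
proof -
  let ?h = "\<lambda>(x, j, i). (x :: point, x(j := x j + 1), x(i := x i + 1, j := x j + 1), x(i := x i + 1))"
  have "pos_plaquettes d L = ?h ` squares d L"
    unfolding pos_plaquettes_eq squares_def by (force simp: image_iff)
  moreover have "inj_on ?h (squares d L)"
  proof (rule inj_onI)
    fix p p' assume eq: "?h p = ?h p'"
    obtain x j i x' j' i' where p: "p = (x, j, i)" "p' = (x', j', i')" by (metis prod_cases3)
    then have "x = x'" and j: "x(j := x j + 1) = x(j' := x j' + 1)" and i: "x(i := x i + 1) = x(i' := x i' + 1)"
      using eq by auto
    moreover have "j = j'" using fun_cong[OF j, of j] \<open>x = x'\<close> by (simp split: if_splits)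
    moreover have "i = i'" using fun_cong[OF i, of i] \<open>x = x'\<close> by (simp split: if_splits)
    ultimately show "p = p'" using p by simp
  qed
  ultimately show ?thesis by (simp add: sum.reindex case_prod_unfold)
qed

lemma trace_inner: "M \<bullet> mat 1 = Re (trace M)"
  by (simp add: hs_inner_def flip: hs_inner_eq_inner)

lemma ym_action_corner:
  assumes Q: "Q \<in> pos_edges d L \<rightarrow>\<^sub>E gauge_group G" and L: "L > 0"
  shows "ym_action d L \<beta> (Q :: edge \<Rightarrow> complex^'n^'n) =
    real CARD('n) * \<beta> * (\<Sum>(x, j, i)\<in>squares d L. corner d L Q x i j \<bullet> mat 1)"
proof -
  have "(\<Sum>p\<in>pos_plaquettes d L. trace (plaquette_var d L Q p)) = (\<Sum>(x, j, i)\<in>squares d L. trace (corner d L Q x i j))"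
    unfolding sum_pos_plaquettes
    by (intro sum.cong) (auto simp: squares_def plaquette_var_corner[OF Q _ _ _ L])
  then show ?thesis by (simp add: ym_action_def trace_inner Re_sum case_prod_unfold)
qed

text \<open>Reversing a plaquette replaces the trace by its conjugate.\<close>

lemma corner_symmetric: "corner d L Q x i j \<bullet> mat 1 = corner d L Q x j i \<bullet> mat 1"
proof -
  have "corner d L Q x j i = cadjoint (corner d L Q x i j)"
    by (simp add: corner_def cadjoint_matrix_mul matrix_mul_assoc)
  then show ?thesis by (simp add: trace_inner trace_cadjoint)
qed

section \<open>Action of the torus symmetries on edges and plaquettes\<close>

definition symm :: "nat \<Rightarrow> nat \<Rightarrow> (nat \<Rightarrow> nat) \<Rightarrow> point \<Rightarrow> edge \<Rightarrow> edge" where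
  "symm d L \<pi> a = (\<lambda>(x, y). edge_rep d L (tr d \<pi> a x, tr d \<pi> a y))"

lemma symm_ed:
  assumes \<pi>: "bij_betw \<pi> {..<d} {..<d}" "\<And>i. \<pi> (\<pi> i) = i" and k: "k < d"
  shows "symm d L \<pi> a (ed d L x k) = ed d L (tr d \<pi> a x) (\<pi> k)"
proof -
  have "symm d L \<pi> a (ed d L x k) = ed d L (tr d \<pi> a (red d L x)) (\<pi> k)"
    unfolding ed_eq[OF k] symm_def prod.case tr_step[OF \<pi> k] by (simp add: ed_def)
  also have "\<dots> = ed d L (tr d \<pi> a x) (\<pi> k)"
    using \<pi>(1) k by (intro ed_cong red_tr_cong) (auto simp: bij_betw_def)
  finally show ?thesis .
qed

lemma symm_bij:
  assumes \<pi>: "bij_betw \<pi> {..<d} {..<d}" "\<And>i. \<pi> (\<pi> i) = i" and L: "L > 0"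
  shows "bij_betw (symm d L \<pi> a) (pos_edges d L) (pos_edges d L)"
proof -
  have \<pi>d: "\<pi> k < d" if "k < d" for k using \<pi>(1) that by (auto simp: bij_betw_def)
  have "inj_on (symm d L \<pi> a) (pos_edges d L)"
  proof (rule inj_onI)
    fix e e' assume e: "e \<in> pos_edges d L" "e' \<in> pos_edges d L" and eq: "symm d L \<pi> a e = symm d L \<pi> a e'"
    obtain x k x' k' where k: "e = ed d L x k" "k < d" "e' = ed d L x' k'" "k' < d"
      using e unfolding pos_edges_ed by auto
    have "ed d L (tr d \<pi> a x) (\<pi> k) = ed d L (tr d \<pi> a x') (\<pi> k')"
      using eq k by (simp add: symm_ed[OF \<pi>])
    from ed_inj[OF \<pi>d[OF k(2)] \<pi>d[OF k(4)] this] have eq: "red d L x = red d L x'" "k = k'"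
      using red_tr_inj[OF _ \<pi>(1)] \<pi>(2) by metis+
    have "ed d L x k = ed d L x' k" by (rule ed_cong[OF k(2) eq(1)])
    then show "e = e'" using k(1,3) eq(2) by simp
  qed
  moreover have "symm d L \<pi> a ` pos_edges d L \<subseteq> pos_edges d L"
  proof (rule image_subsetI)
    fix e assume "e \<in> pos_edges d L"
    then obtain x k where "e = ed d L x k" "k < d" unfolding pos_edges_ed by auto
    then show "symm d L \<pi> a e \<in> pos_edges d L" by (simp add: symm_ed[OF \<pi>] ed_in_edges[OF L] \<pi>d)
  qed
  ultimately show ?thesis unfolding bij_betw_def using endo_inj_surj[OF finite_pos_edges] by auto
qed

lemma corner_cong:
  assumes "red d L x = red d L y" "i < d" "j < d"
  shows "corner d L Q x i j = corner d L Q y i j"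
  unfolding corner_def using assms red_step_cong[OF assms(1)] by (simp add: ed_cong[of _ d L x y] ed_cong[of _ d L "x(_ := _)" "y(_ := _)"])

lemma corner_symm:
  assumes \<pi>: "bij_betw \<pi> {..<d} {..<d}" "\<And>i. \<pi> (\<pi> i) = i" and ij: "i < d" "j < d" and L: "L > 0"
  shows "corner d L (\<lambda>e\<in>pos_edges d L. Q (symm d L \<pi> a e)) x i j = corner d L Q (tr d \<pi> a x) (\<pi> i) (\<pi> j)"
  unfolding corner_def using ij by (simp add: ed_in_edges[OF L] symm_ed[OF \<pi>] tr_step[OF \<pi>])

text \<open>The translation is absorbed by summing over the periodic box, the permutation by
  \<open>corner_symmetric\<close>, which makes the sum over base points symmetric in the two
  directions.\<close>

lemma sum_corner_symm:
  assumes \<pi>: "bij_betw \<pi> {..<d} {..<d}" "\<And>i. \<pi> (\<pi> i) = i" and L: "L > 0"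
  shows "(\<Sum>(x, j, i)\<in>squares d L. corner d L (\<lambda>e\<in>pos_edges d L. Q (symm d L \<pi> a e)) x i j \<bullet> mat 1)
    = (\<Sum>(x, j, i)\<in>squares d L. corner d L Q x i j \<bullet> mat 1)"
proof -
  have \<pi>d: "\<pi> k < d" if "k < d" for k using \<pi>(1) that by (auto simp: bij_betw_def)
  define V where "V i j = (\<Sum>x\<in>box d L. corner d L Q x i j \<bullet> mat 1)" for i j
  have "(\<Sum>(x, j, i)\<in>squares d L. corner d L (\<lambda>e\<in>pos_edges d L. Q (symm d L \<pi> a e)) x i j \<bullet> mat 1)
      = (\<Sum>j<d. \<Sum>i<j. \<Sum>x\<in>box d L. corner d L Q (tr d \<pi> a x) (\<pi> i) (\<pi> j) \<bullet> mat 1)"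
    unfolding sum_squares by (intro sum.cong refl) (simp add: corner_symm[OF \<pi> _ _ L])
  also have "\<dots> = (\<Sum>j<d. \<Sum>i<j. V (\<pi> i) (\<pi> j))"
    unfolding V_def
  proof (rule sum.cong[OF refl], rule sum.cong[OF refl])
    fix j i assume "j \<in> {..<d}" "i \<in> {..<j}"
    then have "\<pi> i < d" "\<pi> j < d" using \<pi>d by auto
    then show "(\<Sum>x\<in>box d L. corner d L Q (tr d \<pi> a x) (\<pi> i) (\<pi> j) \<bullet> mat 1) = (\<Sum>x\<in>box d L. corner d L Q x (\<pi> i) (\<pi> j) \<bullet> mat 1)"
      by (intro sum_box_shift[OF L _ \<pi>(1), of "\<lambda>x. corner d L Q x (\<pi> i) (\<pi> j) \<bullet> mat 1"]) (metis corner_cong)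
  qed
  also have "\<dots> = (\<Sum>j<d. \<Sum>i<j. V i j)"
    by (rule sum_triangle_permute[OF _ \<pi>(1)]) (simp add: V_def corner_symmetric)
  also have "\<dots> = (\<Sum>(x, j, i)\<in>squares d L. corner d L Q x i j \<bullet> mat 1)"
    unfolding sum_squares V_def ..
  finally show ?thesis .
qed

lemma symm_transitive:
  assumes "e \<in> pos_edges d L" "e' \<in> pos_edges d L" and L: "L > 0"
  shows "\<exists>\<pi> a. bij_betw \<pi> {..<d} {..<d} \<and> (\<forall>i. \<pi> (\<pi> i) = i) \<and> symm d L \<pi> a e = e'"
proof -
  obtain x k where e: "e = ed d L x k" "k < d" using assms(1) unfolding pos_edges_ed by auto
  obtain x' k' where e': "e' = ed d L x' k'" "k' < d" using assms(2) unfolding pos_edges_ed by auto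
  \<comment> \<open>Exchanging the two directions matches the edges up to a translation, which
    \<open>a\<close> supplies.\<close>
  define \<pi> where "\<pi> = (\<lambda>i. if i = k then k' else if i = k' then k else i)"
  have inv: "\<pi> (\<pi> i) = i" for i by (simp add: \<pi>_def)
  have mem: "\<pi> i < d" if "i < d" for i using e e' that by (simp add: \<pi>_def)
  have bij: "bij_betw \<pi> {..<d} {..<d}"
    by (rule bij_betw_byWitness[where f' = \<pi>]) (auto simp: inv mem)
  define a where "a = (\<lambda>i. x' i - x (\<pi> i))"
  have red: "red d L (tr d \<pi> a x) = red d L x'" by (auto simp: red_def tr_def a_def)
  have "symm d L \<pi> a e = ed d L (tr d \<pi> a x) k'"
    unfolding e(1) symm_ed[OF bij inv e(2)] by (simp add: \<pi>_def)
  then have "symm d L \<pi> a e = e'" unfolding e'(1) ed_cong[OF e'(2) red] .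
  then show ?thesis using bij inv by blast
qed

text \<open>By periodicity the shifted edges of a square contribute like edges at its base point, so
  a pair of directions gives 2 V i + 2 V j; each direction lies in d - 1 pairs.\<close>

lemma count_squares:
  fixes g :: "edge \<Rightarrow> real"
  assumes L: "L > 0"
  shows "(\<Sum>(x, j, i)\<in>squares d L. g (ed d L x j) + g (ed d L (x(j := x j + 1)) i)
      + g (ed d L (x(i := x i + 1)) j) + g (ed d L x i)) = 2 * (real d - 1) * (\<Sum>e\<in>pos_edges d L. g e)"
proof -
  define V where "V k = (\<Sum>x\<in>box d L. g (ed d L x k))" for k
  have shift: "(\<Sum>x\<in>box d L. g (ed d L (x(j := x j + 1)) k)) = V k" if "j < d" "k < d" for j k
  proof -
    have "(\<Sum>x\<in>box d L. g (ed d L (x(j := x j + 1)) k)) =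
        (\<Sum>x\<in>box d L. g (ed d L (tr d id (\<lambda>i. if i = j then 1 else 0) x) k))"
      using that by (intro sum.cong refl) (simp add: unit_shift[OF box_lattice])
    also have "\<dots> = V k"
      unfolding V_def by (rule sum_box_shift[OF L _ bij_betw_id, of d "\<lambda>x. g (ed d L x k)"]) (metis ed_cong that(2))
    finally show ?thesis .
  qed
  have "(\<Sum>(x, j, i)\<in>squares d L. g (ed d L x j) + g (ed d L (x(j := x j + 1)) i)
      + g (ed d L (x(i := x i + 1)) j) + g (ed d L x i)) = (\<Sum>j<d. \<Sum>i<j. 2 * V i + 2 * V j)"
    unfolding sum_squares
    by (intro sum.cong refl) (simp add: sum.distrib shift, simp add: V_def)
  also have "\<dots> = (real d - 1) * (\<Sum>k<d. 2 * V k)" by (rule sum_triangle)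
  also have "\<dots> = 2 * (real d - 1) * (\<Sum>e\<in>pos_edges d L. g e)"
    unfolding sum_pos_edges V_def sum_distrib_left[symmetric] by simp
  finally show ?thesis .
qed

theorem corollary4p7:
  fixes d L :: nat and \<beta> :: real and G :: gauge_type
    and haar :: "(complex^'n^'n) measure" and e\<^sub>0 :: edge and E :: "complex^'n^'n"
  assumes "d \<ge> 2" and "L > 1"
    and "haar_prob (gauge_group G) haar"
    and "K_S G CARD('n) d \<beta> > 0"
    and "e\<^sub>0 \<in> pos_edges d L"
    and "hs_inner E E = 1"
  shows "(\<Sum>e\<in>pos_edges d L.
            covariance (ym_measure d L \<beta> haar) (\<lambda>Q. hs_inner (Q e\<^sub>0) E) (\<lambda>Q. hs_inner (Q e) E))
         \<le> (case G of SO \<Rightarrow> 1 / K_S SO CARD('n) d \<beta> | SU \<Rightarrow> 2 / K_S SU CARD('n) d \<beta>)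
       \<and> \<bar>\<Sum>e\<in>pos_edges d L - {e\<^sub>0}.
            covariance (ym_measure d L \<beta> haar) (\<lambda>Q. hs_inner (Q e\<^sub>0) E) (\<lambda>Q. hs_inner (Q e) E)\<bar>
         \<le> (case G of SO \<Rightarrow> 2 / K_S SO CARD('n) d \<beta> | SU \<Rightarrow> 4 / K_S SU CARD('n) d \<beta>)"
proof -
  have L: "L > 0" using assms(2) by simp
  obtain B :: "(complex^'n^'n) set" where B: "lie_basis G B" using lie_basis_exists by blast
  interpret B: lie_basis G B by (rule B)
  define c where "c = real CARD('n) * \<beta>"
  interpret P: plaquette_system G haar "pos_edges d L" B "squares d L"
    "\<lambda>(x, j, i). ed d L x j" "\<lambda>(x, j, i). ed d L (x(j := x j + 1)) i"
    "\<lambda>(x, j, i). ed d L (x(i := x i + 1)) j" "\<lambda>(x, j, i). ed d L x i" c "2 * (real d - 1)"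
  proof
    show "haar_prob (gauge_group G) haar" by fact
    show "finite (pos_edges d L)" by (rule finite_pos_edges)
    show "finite (squares d L)" by (rule finite_squares)
    fix g :: "edge \<Rightarrow> real"
    show "(\<Sum>p\<in>squares d L. g (case p of (x, j, i) \<Rightarrow> ed d L x j) + g (case p of (x, j, i) \<Rightarrow> ed d L (x(j := x j + 1)) i)
      + g (case p of (x, j, i) \<Rightarrow> ed d L (x(i := x i + 1)) j) + g (case p of (x, j, i) \<Rightarrow> ed d L x i))
      = 2 * (real d - 1) * sum g (pos_edges d L)"
      using count_squares[OF L, where d = d and g = g] by (simp add: case_prod_unfold)
  qed (use assms(1) L in \<open>auto simp: squares_def intro!: ed_in_edges\<close>)
  \<comment> \<open>The gap hypothesis of the abstract inequality is thus the positivity of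
    \<open>K_S\<close>.\<close>
  have K: "K_S G CARD('n) d \<beta> = P.\<kappa> - 4 * \<bar>c\<bar> * (2 * (real d - 1))"
    by (simp add: P.\<kappa>_def c_def abs_mult field_simps split: gauge_type.split)
  interpret P: plaquette_gap G haar "pos_edges d L" B "squares d L"
    "\<lambda>(x, j, i). ed d L x j" "\<lambda>(x, j, i). ed d L (x(j := x j + 1)) i"
    "\<lambda>(x, j, i). ed d L (x(i := x i + 1)) j" "\<lambda>(x, j, i). ed d L x i" c "2 * (real d - 1)"
    by unfold_locales (use K assms(4) in simp)
  have act: "P.act Q = c * (\<Sum>(x, j, i)\<in>squares d L. corner d L Q x i j \<bullet> mat 1)" for Q
    unfolding P.act_def P.plaq_def corner_def by (simp add: case_prod_unfold)
  \<comment> \<open>Adjoints are inverses on group-valued configurations, so the two actions are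
    compared on the space of the measure.\<close>
  have ym_act: "ym_action d L \<beta> Q = P.act Q" if "Q \<in> space P.\<nu>" for Q
    unfolding act using ym_action_corner[OF that[unfolded P.space_\<nu>] L, of \<beta>] by (simp only: c_def)
  have gibbs: "ym_measure d L \<beta> haar = P.gibbs"
  proof -
    have Z: "(\<integral>Q. exp (ym_action d L \<beta> Q) \<partial>P.\<nu>) = (\<integral>Q. exp (P.act Q) \<partial>P.\<nu>)"
      using ym_act by (intro Bochner_Integration.integral_cong) auto
    have [measurable]: "(\<lambda>Q. exp (P.act Q)) \<in> borel_measurable P.\<nu>"
      using P.polys_measurable[OF P.act_polys] by measurable
    then have [measurable]: "(\<lambda>Q. exp (ym_action d L \<beta> Q)) \<in> borel_measurable P.\<nu>"
      by (subst measurable_cong[where g = "\<lambda>Q. exp (P.act Q)"]) (simp_all add: ym_act)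
    show ?thesis
      unfolding ym_measure_def P.gibbs_def Let_def Z
    proof (rule density_cong)
      show "AE Q in P.\<nu>. ennreal (exp (ym_action d L \<beta> Q) / (\<integral>Q. exp (P.act Q) \<partial>P.\<nu>))
          = ennreal (exp (P.act Q) / (\<integral>Q. exp (P.act Q) \<partial>P.\<nu>))"
        by (rule AE_I2) (simp add: ym_act)
    qed measurable
  qed
  have obs: "(\<lambda>Q. hs_inner (Q e) E) = P.obs E e" for e
    by (simp add: P.obs_def hs_inner_eq_inner)
  let ?C = "\<lambda>e. covariance P.gibbs (P.obs E e\<^sub>0) (P.obs E e)"
  let ?K = "K_S G CARD('n) d \<beta>"
  have "norm E = 1" using assms(6) by (simp add: hs_inner_eq_inner norm_eq_1)
  moreover have "\<exists>\<tau>. bij_betw \<tau> (pos_edges d L) (pos_edges d L) \<and> \<tau> e\<^sub>0 = e \<and>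
      (\<forall>Q\<in>space P.\<nu>. P.act (\<lambda>e\<in>pos_edges d L. Q (\<tau> e)) = P.act Q)" if e: "e \<in> pos_edges d L" for e
  proof -
    obtain \<pi> a where \<pi>: "bij_betw \<pi> {..<d} {..<d}" "\<And>i. \<pi> (\<pi> i) = i" "symm d L \<pi> a e\<^sub>0 = e"
      using symm_transitive[OF assms(5) e L] by blast
    have "P.act (\<lambda>e\<in>pos_edges d L. Q (symm d L \<pi> a e)) = P.act Q" for Q
      unfolding act sum_corner_symm[OF \<pi>(1,2) L] ..
    then show ?thesis using symm_bij[OF \<pi>(1,2) L] \<pi>(3) by blast
  qed
  ultimately have bounds: "0 \<le> (\<Sum>e\<in>pos_edges d L. ?C e)" "(\<Sum>e\<in>pos_edges d L. ?C e) \<le> 1 / ?K" "0 \<le> ?C e\<^sub>0" "?C e\<^sub>0 \<le> 1 / ?K"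
    using P.covariance_bounds[OF _ assms(5)] unfolding K by blast+
  \<comment> \<open>Row sum and diagonal term both lie between 0 and \<open>1 / ?K\<close>, so their
    difference has absolute value at most \<open>1 / ?K\<close>.\<close>
  have "(\<Sum>e\<in>pos_edges d L - {e\<^sub>0}. ?C e) = (\<Sum>e\<in>pos_edges d L. ?C e) - ?C e\<^sub>0"
    using assms(5) finite_pos_edges by (simp add: sum_diff1)
  then have "\<bar>\<Sum>e\<in>pos_edges d L - {e\<^sub>0}. ?C e\<bar> \<le> 1 / ?K" using bounds by linarith
  moreover have "1 / ?K \<le> 2 / ?K" "2 / ?K \<le> 4 / ?K"
    using assms(4) by (simp_all add: divide_right_mono)
  ultimately show ?thesis
    unfolding gibbs obs using bounds(2) by (cases G) auto
qed

end
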